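(* Let $k\ge0$ be an integer, and let $\mathrm a_{\mathbf K,T}$ be the local bilinear form built with the stabilisation $$\mathrm s_{\mathbf K,T}(\underline v_T,\underline w_T)=(\mathbf K_T\nabla(v_T-\pi_T^{0,k}\mathrm p^{k+1}_{\mathbf K,T}\underline v_T),\nabla(w_T-\pi_T^{0,k}\mathrm p^{k+1}_{\mathbf K,T}\underline w_T))_T+h_T^{-1}(v_{\mathcal F_T}-\pi_{\mathcal F_T}^{0,k}\mathrm p^{k+1}_{\mathbf K,T}\underline v_T,\,w_{\mathcal F_T}-\pi_{\mathcal F_T}^{0,k}\mathrm p^{k+1}_{\mathbf K,T}\underline w_T)_{\mathbf K,\partial T}.$$ Then for all $T\in\mathcal T_h$ and all $\underline v_T\in\underline U_T^k$, $$\|\underline v_T\|_{1,\mathbf K,T}^2\lesssim\alpha_T\,\mathrm a_{\mathbf K,T}(\underline v_T,\underline v_T).$$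
   Context: Setting. $\Omega\subset\mathbb R^d$, $d\ge2$, is a domain. $(\cdot,\cdot)_X$ and $\|\cdot\|_X$ denote the $L^2$-inner product and norm on $X$ (scalar or vector valued, natural measure). $\mathbf K$ is a symmetric, uniformly elliptic and bounded, piecewise constant matrix-valued function on $\Omega$. Meshes. $\mathcal H\subset(0,\infty)$ is a countable set of mesh sizes with unique cluster point $0$. For each $h\in\mathcal H$ there is a mesh $(\mathcal T_h,\mathcal F_h)$ of $\Omega$. The elements $T\in\mathcal T_h$ are disjoint bounded simply connected domains with piecewise $C^1$ boundary $\partial T$, and $\overline\Omega=\bigcup_{T}\overline T$. The faces $F\in\mathcal F_h$ are disjoint finite $(d-1)$-dimensional $C^1$ manifolds (possibly curved) with $\bigcup_T\partial T=\bigcup_F\overline F$; each face is contained either in $\partial T_1\cap\partial T_2$ for two distinct elements or in $\partial T\cap\partial\Omega$ for one element. $\mathcal F_T=\{F\in\mathcal F_h:F\subset\partial T\}$. $h_T$ is the diameter of $T$ and $h=\max_T h_T$. $n_T$ is the outer unit normal on $\partial T$. $\mathbf K$ is constant on each $T$, with value $\mathbf K_T$; $0<\underline K_T\le\overline K_T$ satisfy $\underline K_T x\cdot x\le(\mathbf K_Tx)\cdot x\le\overline K_T x\cdot x$ for all $x\in\mathbb R^d$, and $\alpha_T=\overline K_T/\underline K_T$. Mesh regularity: there is $\varrho>0$ such that for all $h\in\mathcal H$ every $T\in\mathcal T_h$ is connected by star-shaped sets with parameter $\varrho$: $T$ is the union of open sets $U_1,\dots,U_N$ with $N\le1/\varrho$,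 each star-shaped with respect to every point of a ball of radius $\varrho h_T$, with $|U_i\cap U_{i+1}|\ge\varrho h_T^d$ for $1\le i<N$. Spaces. $\mathbb P^\ell(X)$ is the space of (restrictions to $X$ of) polynomials of degree $\le\ell$. For a face $F$ with unit normal $n_F$ (either choice), $\mathcal P^k(F)=\mathbb P^0(F)+\{(q|_F)\cdot n_F: q\in\mathbb P^k(\mathbb R^d)^d\}$, where $\mathbb P^0(F)$ is the space of constant functions on $F$. $\mathcal P^k(\mathcal F_T)$ is the set of $v\in L^1(\partial T)$ with $v|_F\in\mathcal P^k(F)$ for all $F\in\mathcal F_T$. $\underline U^k_T=\mathbb P^k(T)\times\mathcal P^k(\mathcal F_T)$, with elements $\underline v_T=(v_T,v_{\mathcal F_T})$. Operators. $\pi_T^{0,k}$, $\pi_F^{0,k}$ are the $L^2$-orthogonal projectors onto $\mathbb P^k(T)$, $\mathcal P^k(F)$; $\pi^{0,k}_{\mathcal F_T}$ acts as $\pi^{0,k}_F$ (on traces) on each $F\in\mathcal F_T$. The reconstruction $\mathrm p^{k+1}_{\mathbf K,T}:\underline U_T^k\to\mathbb P^{k+1}(T)$ is defined by $$(\mathbf K_T\nabla\mathrm p^{k+1}_{\mathbf K,T}\underline v_T,\nabla w)_T=-(v_T,\nabla\cdot(\mathbf K_T\nabla w))_T+(v_{\mathcal F_T},(\mathbf K_T\nabla w)\cdot n_T)_{\partial T}\quad\forall w\in\mathbb P^{k+1}(T),$$ and $\int_T(\mathrm p^{k+1}_{\mathbf K,T}\underline v_T-v_T)=0$. Norms and form.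 $(v,w)_{\mathbf K,\partial T}=([\mathbf K_Tn_T\cdot n_T]v,w)_{\partial T}$ with induced norm $\|\cdot\|_{\mathbf K,\partial T}$; $|v|_{\mathbf K,H^1(T)}=\|\mathbf K_T^{1/2}\nabla v\|_T$; $\|\underline v_T\|_{1,\mathbf K,T}^2=|v_T|^2_{\mathbf K,H^1(T)}+h_T^{-1}\|v_{\mathcal F_T}-v_T\|_{\mathbf K,\partial T}^2$. $\mathrm a_{\mathbf K,T}(\underline u_T,\underline v_T)=(\mathbf K_T\nabla\mathrm p^{k+1}_{\mathbf K,T}\underline u_T,\nabla\mathrm p^{k+1}_{\mathbf K,T}\underline v_T)_T+\mathrm s_{\mathbf K,T}(\underline u_T,\underline v_T)$. Convention. $A\lesssim B$ means $A\le CB$ with $C$ independent of $A$, $B$ (hence of the functions and the element involved), of $h$ and of $\mathbf K$; $C$ may depend on $d$, $k$, $\varrho$. *)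

theory Defs
  imports "HOL-Analysis.Analysis"
begin

section \<open>Surface measure\<close>

text \<open>
  The natural measure on hypersurfaces is the Hausdorff measure of dimension \<open>d - 1\<close>, normalised
  to agree with the Lebesgue measure on hyperplanes. Boundedness of the covering sets is required
  because \<^const>\<open>diameter\<close> is unspecified on unbounded sets.
\<close>

definition hausdorff_outer :: "nat \<Rightarrow> 'a::metric_space set \<Rightarrow> ennreal" where
  "hausdorff_outer m A =
     (SUP \<delta>\<in>{0::real<..}.
        INF C\<in>{C :: nat \<Rightarrow> 'a set. A \<subseteq> (\<Union>i. C i) \<and> (\<forall>i. bounded (C i) \<and> diameter (C i) \<le> \<delta>)}.
          \<Sum>i. ennreal (unit_ball_vol (real m) * (diameter (C i) / 2) ^ m))"

definition surface :: "'a::euclidean_space measure" where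
  "surface = measure_of UNIV (sets borel) (hausdorff_outer (DIM('a) - 1))"


section \<open>Hypersurfaces, boundaries and normals\<close>

definition domain :: "'a::euclidean_space set \<Rightarrow> bool" where
  "domain A \<longleftrightarrow> open A \<and> connected A \<and> A \<noteq> {}"

text \<open>\<open>\<phi>\<close> is a \<open>C\<^sup>1\<close> function on \<open>U\<close> with nowhere vanishing gradient \<open>g\<close>.\<close>

definition C1_submersion ::
    "'a::euclidean_space set \<Rightarrow> ('a \<Rightarrow> real) \<Rightarrow> ('a \<Rightarrow> 'a) \<Rightarrow> bool" where
  "C1_submersion U \<phi> g \<longleftrightarrow>
     open U \<and> (\<forall>y\<in>U. (\<phi> has_derivative (\<lambda>v. g y \<bullet> v)) (at y)) \<and>
     continuous_on U g \<and> (\<forall>y\<in>U. g y \<noteq> 0)"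

definition C1_hypersurface :: "'a::euclidean_space set \<Rightarrow> bool" where
  "C1_hypersurface S \<longleftrightarrow>
     (\<forall>x\<in>S. \<exists>U \<phi> g. C1_submersion U \<phi> g \<and> x \<in> U \<and> S \<inter> U = {y\<in>U. \<phi> y = 0})"

definition unit_normal_field :: "'a::euclidean_space set \<Rightarrow> ('a \<Rightarrow> 'a) \<Rightarrow> bool" where
  "unit_normal_field S n \<longleftrightarrow> continuous_on S n \<and>
     (\<forall>x\<in>S. \<exists>U \<phi> g. C1_submersion U \<phi> g \<and> x \<in> U \<and> S \<inter> U = {y\<in>U. \<phi> y = 0} \<and>
                     (n x = sgn (g x) \<or> n x = - sgn (g x)))"

text \<open>
  Near \<open>x\<close> the set \<open>T\<close> lies on one side of its boundary, which is a \<open>C\<^sup>1\<close> hypersurface with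
  normal \<open>n\<close> pointing out of \<open>T\<close>. There is at most one such \<open>n\<close>.
\<close>

definition outer_normal_at :: "'a::euclidean_space set \<Rightarrow> 'a \<Rightarrow> 'a \<Rightarrow> bool" where
  "outer_normal_at T x n \<longleftrightarrow>
     (\<exists>U \<phi> g. C1_submersion U \<phi> g \<and> x \<in> U \<and> \<phi> x = 0 \<and> T \<inter> U = {y\<in>U. \<phi> y < 0} \<and> n = sgn (g x))"

definition outer_normal :: "'a::euclidean_space set \<Rightarrow> 'a \<Rightarrow> 'a" where
  "outer_normal T x = (THE n. outer_normal_at T x n)"

text \<open>
  The boundary is \<open>C\<^sup>1\<close> away from a closed set (edges, corners) of surface measure zero, so that the
  outer unit normal exists almost everywhere on it.
\<close>

definition piecewise_C1_boundary :: "'a::euclidean_space set \<Rightarrow> bool" where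
  "piecewise_C1_boundary T \<longleftrightarrow> {x\<in>frontier T. \<nexists>n. outer_normal_at T x n} \<in> null_sets surface"


section \<open>Meshes\<close>

definition faces_of :: "'a::euclidean_space set set \<Rightarrow> 'a set \<Rightarrow> 'a set set" where
  "faces_of Fs T = {F\<in>Fs. F \<subseteq> frontier T}"

definition is_mesh :: "'a::euclidean_space set \<Rightarrow> 'a set set \<Rightarrow> 'a set set \<Rightarrow> bool" where
  "is_mesh \<Omega> Ts Fs \<longleftrightarrow>
     disjoint Ts \<and>
     (\<forall>T\<in>Ts. domain T \<and> bounded T \<and> simply_connected T \<and> piecewise_C1_boundary T) \<and>
     closure \<Omega> = (\<Union>T\<in>Ts. closure T) \<and>
     disjoint Fs \<and>
     (\<forall>F\<in>Fs. C1_hypersurface F \<and> emeasure surface F < \<infinity>) \<and>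
     (\<forall>T\<in>Ts. finite (faces_of Fs T)) \<and>
     (\<Union>T\<in>Ts. frontier T) = (\<Union>F\<in>Fs. closure F) \<and>
     (\<forall>F\<in>Fs. (\<exists>T1\<in>Ts. \<exists>T2\<in>Ts. T1 \<noteq> T2 \<and> F \<subseteq> frontier T1 \<inter> frontier T2) \<or>
              (\<exists>T\<in>Ts. F \<subseteq> frontier T \<inter> frontier \<Omega>))"

definition star_shaped_wrt_ball :: "'a::euclidean_space set \<Rightarrow> real \<Rightarrow> bool" where
  "star_shaped_wrt_ball U r \<longleftrightarrow>
     (\<exists>z. \<forall>x\<in>ball z r. x \<in> U \<and> (\<forall>y\<in>U. closed_segment x y \<subseteq> U))"

definition connected_by_star_shaped :: "real \<Rightarrow> 'a::euclidean_space set \<Rightarrow> bool" where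
  "connected_by_star_shaped \<rho> T \<longleftrightarrow>
     (\<exists>(N::nat) U. real N \<le> 1 / \<rho> \<and> T = (\<Union>i\<in>{1..N}. U i) \<and>
        (\<forall>i\<in>{1..N}. open (U i) \<and> star_shaped_wrt_ball (U i) (\<rho> * diameter T)) \<and>
        (\<forall>i\<in>{1..<N}. measure lborel (U i \<inter> U (Suc i)) \<ge> \<rho> * diameter T ^ DIM('a)))"

definition regular_mesh_family ::
    "'a::euclidean_space set \<Rightarrow> real \<Rightarrow> real set \<Rightarrow> (real \<Rightarrow> 'a set set) \<Rightarrow> (real \<Rightarrow> 'a set set) \<Rightarrow> bool"
  where
  "regular_mesh_family \<Omega> \<rho> H Ts Fs \<longleftrightarrow>
     H \<subseteq> {0<..} \<and> countable H \<and> (\<forall>x. x islimpt H \<longleftrightarrow> x = 0) \<and>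
     (\<forall>h\<in>H. is_mesh \<Omega> (Ts h) (Fs h) \<and>
        (\<exists>T\<in>Ts h. diameter T = h) \<and> (\<forall>T\<in>Ts h. diameter T \<le> h) \<and>
        (\<forall>T\<in>Ts h. connected_by_star_shaped \<rho> T))"


section \<open>Diffusion tensor\<close>

definition elliptic_tensor :: "(real^'n) set \<Rightarrow> (real^'n \<Rightarrow> real^'n^'n) \<Rightarrow> bool" where
  "elliptic_tensor \<Omega> K \<longleftrightarrow>
     (\<forall>x\<in>\<Omega>. transpose (K x) = K x) \<and>
     (\<exists>l>0. \<exists>u. \<forall>x\<in>\<Omega>. \<forall>\<xi>. l * (\<xi> \<bullet> \<xi>) \<le> (K x *v \<xi>) \<bullet> \<xi> \<and> (K x *v \<xi>) \<bullet> \<xi> \<le> u * (\<xi> \<bullet> \<xi>))"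

definition constant_on_elements ::
    "real set \<Rightarrow> (real \<Rightarrow> (real^'n) set set) \<Rightarrow> (real^'n \<Rightarrow> real^'n^'n) \<Rightarrow> bool" where
  "constant_on_elements H Ts K \<longleftrightarrow> (\<forall>h\<in>H. \<forall>T\<in>Ts h. \<exists>M. \<forall>x\<in>T. K x = M)"

definition mat_sqrt :: "real^'n^'n \<Rightarrow> real^'n^'n" where
  "mat_sqrt A = (SOME B. transpose B = B \<and> (\<forall>x. 0 \<le> (B *v x) \<bullet> x) \<and> B ** B = A)"


section \<open>Polynomial spaces and \<open>L\<^sup>2\<close> products\<close>

text \<open>
  An element of \<open>P\<^sup>l(T)\<close> is represented by the polynomial on the whole space, which its restriction
  to the nonempty open set \<open>T\<close> determines.
\<close>

definition Poly :: "nat \<Rightarrow> (real^'n \<Rightarrow> real) set" where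
  "Poly l = {p. \<exists>c. \<forall>x. p x = (\<Sum>a\<in>{a :: 'n \<Rightarrow> nat. sum a UNIV \<le> l}. c a * (\<Prod>i\<in>UNIV. (x $ i) ^ a i))}"

definition VecPoly :: "nat \<Rightarrow> (real^'n \<Rightarrow> real^'n) set" where
  "VecPoly l = {q. \<forall>i. (\<lambda>x. q x $ i) \<in> Poly l}"

text \<open>Only the values on \<open>F\<close> matter for membership; \<open>n\<close> is the chosen unit normal field on \<open>F\<close>.\<close>

definition FacePoly :: "nat \<Rightarrow> (real^'n \<Rightarrow> real^'n) \<Rightarrow> (real^'n) set \<Rightarrow> (real^'n \<Rightarrow> real) set" where
  "FacePoly k n F = {v. \<exists>c. \<exists>q\<in>VecPoly k. \<forall>x\<in>F. v x = c + q x \<bullet> n x}"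

definition l2_inner :: "'a measure \<Rightarrow> 'a set \<Rightarrow> ('a \<Rightarrow> 'b::real_inner) \<Rightarrow> ('a \<Rightarrow> 'b) \<Rightarrow> real" where
  "l2_inner M X f g = (LINT x:X|M. f x \<bullet> g x)"

definition l2_norm :: "'a measure \<Rightarrow> 'a set \<Rightarrow> ('a \<Rightarrow> 'b::real_inner) \<Rightarrow> real" where
  "l2_norm M X f = sqrt (l2_inner M X f f)"

definition grad :: "(real^'n \<Rightarrow> real) \<Rightarrow> real^'n \<Rightarrow> real^'n" where
  "grad f x = (\<chi> i. frechet_derivative f (at x) (axis i 1))"

definition divergence :: "(real^'n \<Rightarrow> real^'n) \<Rightarrow> real^'n \<Rightarrow> real" where
  "divergence f x = (\<Sum>i\<in>UNIV. frechet_derivative f (at x) (axis i 1) $ i)"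


section \<open>Local space and operators\<close>

text \<open>
  Below, \<open>K\<close> is the constant value of the tensor on the element \<open>T\<close>, \<open>\<F>\<close> the set of faces of \<open>T\<close>, and
  \<open>\<nu> F\<close> the chosen unit normal on \<open>F\<close>. Integrals over the boundary of \<open>T\<close> are integrals over the
  disjoint union of the faces of \<open>T\<close>, i.e. over the boundary up to the relative boundaries of the
  faces, where the functions of the face spaces carry no information.
\<close>

definition local_space ::
    "nat \<Rightarrow> ((real^'n) set \<Rightarrow> real^'n \<Rightarrow> real^'n) \<Rightarrow> (real^'n) set set
      \<Rightarrow> ((real^'n \<Rightarrow> real) \<times> (real^'n \<Rightarrow> real)) set" where
  "local_space k \<nu> \<F> =
     Poly k \<times> {v. set_integrable surface (\<Union>\<F>) v \<and> (\<forall>F\<in>\<F>. v \<in> FacePoly k (\<nu> F) F)}"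

definition proj_elem :: "nat \<Rightarrow> (real^'n) set \<Rightarrow> (real^'n \<Rightarrow> real) \<Rightarrow> real^'n \<Rightarrow> real" where
  "proj_elem k T f =
     (SOME p. p \<in> Poly k \<and> (\<forall>q\<in>Poly k. l2_inner lborel T (\<lambda>x. f x - p x) q = 0))"

text \<open>The values on \<open>F\<close> of the projection are determined up to a null set.\<close>

definition proj_face ::
    "nat \<Rightarrow> (real^'n \<Rightarrow> real^'n) \<Rightarrow> (real^'n) set \<Rightarrow> (real^'n \<Rightarrow> real) \<Rightarrow> real^'n \<Rightarrow> real" where
  "proj_face k n F f =
     (SOME p. p \<in> FacePoly k n F \<and>
              (\<forall>q\<in>FacePoly k n F. l2_inner surface F (\<lambda>x. f x - p x) q = 0))"

definition proj_faces ::
    "nat \<Rightarrow> ((real^'n) set \<Rightarrow> real^'n \<Rightarrow> real^'n) \<Rightarrow> (real^'n) set set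
      \<Rightarrow> (real^'n \<Rightarrow> real) \<Rightarrow> real^'n \<Rightarrow> real" where
  "proj_faces k \<nu> \<F> f x = (\<Sum>F\<in>\<F>. indicator F x * proj_face k (\<nu> F) F f x)"

definition reconstruction ::
    "nat \<Rightarrow> real^'n^'n \<Rightarrow> (real^'n) set \<Rightarrow> (real^'n) set set
      \<Rightarrow> (real^'n \<Rightarrow> real) \<times> (real^'n \<Rightarrow> real) \<Rightarrow> real^'n \<Rightarrow> real" where
  "reconstruction k K T \<F> v =
     (SOME p. p \<in> Poly (k + 1) \<and>
        (\<forall>w\<in>Poly (k + 1).
           l2_inner lborel T (\<lambda>x. K *v grad p x) (grad w) =
           - l2_inner lborel T (fst v) (divergence (\<lambda>x. K *v grad w x))
           + l2_inner surface (\<Union>\<F>) (snd v) (\<lambda>x. (K *v grad w x) \<bullet> outer_normal T x)) \<and>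
        (LINT x:T|lborel. p x - fst v x) = 0)"

definition bd_inner ::
    "real^'n^'n \<Rightarrow> (real^'n) set \<Rightarrow> (real^'n) set set
      \<Rightarrow> (real^'n \<Rightarrow> real) \<Rightarrow> (real^'n \<Rightarrow> real) \<Rightarrow> real" where
  "bd_inner K T \<F> v w =
     l2_inner surface (\<Union>\<F>)
       (\<lambda>x. ((K *v outer_normal T x) \<bullet> outer_normal T x) * v x) w"

definition bd_norm ::
    "real^'n^'n \<Rightarrow> (real^'n) set \<Rightarrow> (real^'n) set set \<Rightarrow> (real^'n \<Rightarrow> real) \<Rightarrow> real" where
  "bd_norm K T \<F> v = sqrt (bd_inner K T \<F> v v)"

definition H1_seminorm :: "real^'n^'n \<Rightarrow> (real^'n) set \<Rightarrow> (real^'n \<Rightarrow> real) \<Rightarrow> real" where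
  "H1_seminorm K T v = l2_norm lborel T (\<lambda>x. mat_sqrt K *v grad v x)"

definition discrete_norm ::
    "real^'n^'n \<Rightarrow> (real^'n) set \<Rightarrow> (real^'n) set set
      \<Rightarrow> (real^'n \<Rightarrow> real) \<times> (real^'n \<Rightarrow> real) \<Rightarrow> real" where
  "discrete_norm K T \<F> v =
     sqrt ((H1_seminorm K T (fst v))\<^sup>2
           + inverse (diameter T) * (bd_norm K T \<F> (\<lambda>x. snd v x - fst v x))\<^sup>2)"

definition gradient_stabilisation ::
    "nat \<Rightarrow> real^'n^'n \<Rightarrow> (real^'n) set \<Rightarrow> ((real^'n) set \<Rightarrow> real^'n \<Rightarrow> real^'n) \<Rightarrow> (real^'n) set set
      \<Rightarrow> (real^'n \<Rightarrow> real) \<times> (real^'n \<Rightarrow> real) \<Rightarrow> (real^'n \<Rightarrow> real) \<times> (real^'n \<Rightarrow> real) \<Rightarrow> real" where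
  "gradient_stabilisation k K T \<nu> \<F> v w =
     (let pv = reconstruction k K T \<F> v; pw = reconstruction k K T \<F> w
      in l2_inner lborel T
           (\<lambda>x. K *v grad (\<lambda>y. fst v y - proj_elem k T pv y) x)
           (grad (\<lambda>y. fst w y - proj_elem k T pw y))
         + inverse (diameter T) *
           bd_inner K T \<F> (\<lambda>x. snd v x - proj_faces k \<nu> \<F> pv x)
                          (\<lambda>x. snd w x - proj_faces k \<nu> \<F> pw x))"

definition local_form ::
    "nat \<Rightarrow> real^'n^'n \<Rightarrow> (real^'n) set \<Rightarrow> (real^'n) set set
      \<Rightarrow> ((real^'n \<Rightarrow> real) \<times> (real^'n \<Rightarrow> real) \<Rightarrow> (real^'n \<Rightarrow> real) \<times> (real^'n \<Rightarrow> real) \<Rightarrow> real)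
      \<Rightarrow> (real^'n \<Rightarrow> real) \<times> (real^'n \<Rightarrow> real) \<Rightarrow> (real^'n \<Rightarrow> real) \<times> (real^'n \<Rightarrow> real) \<Rightarrow> real" where
  "local_form k K T \<F> s u v =
     l2_inner lborel T (\<lambda>x. K *v grad (reconstruction k K T \<F> u) x)
                       (grad (reconstruction k K T \<F> v))
     + s u v"

end

theory Submission
  imports Defs "HOL-Library.Function_Algebras"
begin

text \<open>
  Let \<open>p\<close> be the reconstruction of \<open>v\<close> and write \<open>v\<^sub>T = (v\<^sub>T - \<pi>\<^sub>T p) + p - (p - \<pi>\<^sub>T p)\<close> in the element and
  \<open>v\<^sub>F - v\<^sub>T = (v\<^sub>F - \<pi>\<^sub>F p) - (p - \<pi>\<^sub>F p) + (p - \<pi>\<^sub>T p) - (v\<^sub>T - \<pi>\<^sub>T p)\<close> on the faces. The form controls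
  \<open>p\<close>, \<open>v\<^sub>T - \<pi>\<^sub>T p\<close> and \<open>v\<^sub>F - \<pi>\<^sub>F p\<close>. The other terms are bounded pointwise: an element of diameter \<open>h\<close>
  contains a ball of radius \<open>\<rho> h\<close> and lies in the concentric ball of radius \<open>h\<close>, so that equivalence of
  norms on a space of polynomials, scaled to these two balls, yields inverse and Poincare type
  inequalities in the maximum norm. Since \<open>v\<^sub>T - \<pi>\<^sub>T p\<close> has mean value zero, it is bounded by its gradient,
  and each change between \<open>K\<close>-weighted and unweighted norms costs at most the anisotropy ratio.
  The boundary terms need no trace inequality, only the surface measure of the element boundary. It
  is \<open>O(h ^ (d - 1))\<close> because the boundary of a set star-shaped with respect to a ball is a Lipschitz
  image of a sphere. The defining property of \<open>p\<close> enters only through its degree and mean value, but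
  its existence requires solving the reconstruction problem.
\<close>

section \<open>Semi-inner products\<close>

text \<open>The operators are \<open>SOME\<close> choices, so each estimate first needs a witness.
  The witnesses come from Gram-Schmidt for forms that are only semidefinite: integrals do not see a
  face function off its face or on null sets, and the energy does not see constants. Bounded
  measurable functions are the common carrier: they contain polynomials, face functions and normal
  components, and their products are integrable on sets of finite measure. The obstacle is that the
  projections are orthogonal for the unweighted product and need not be stable in the norm weighted
  by \<open>K\<close>. Their errors are compared with the constant \<open>p z\<close>, where
  \<open>z\<close> is the centre of a ball contained in the element. This reduces them to the
  oscillation of \<open>p\<close>, hence to its unweighted Dirichlet energy. Going there costs
  \<open>Kmax\<close>, returning costs \<open>1 / Kmin\<close>; each term makes the trip once, so
  the ratio appears to the first power. Elements need not be convex, but polynomials live on the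
  whole space: the mean value theorem is applied in the ball of radius \<open>h\<close> around
  \<open>z\<close>.\<close>

instantiation "fun" :: (type, real_vector) real_vector
begin

definition "c *\<^sub>R f = (\<lambda>x. c *\<^sub>R f x)"

instance
  by standard (auto simp: scaleR_fun_def fun_eq_iff algebra_simps)

end

lemma scaleR_fun_apply [simp]: "(c *\<^sub>R f) x = c *\<^sub>R f x"
  by (simp add: scaleR_fun_def)

lemma sum_fun_apply: "(\<Sum>i\<in>A. f i) x = (\<Sum>i\<in>A. f i x)"
  by (induction A rule: infinite_finite_induct) auto

text \<open>Linearity is demanded on \<open>S\<close> only, because integrals are additive only for
  integrable functions. Functions form a \<open>real_vector\<close> type through the instance above,
  so that \<open>subspace\<close> and \<open>span\<close> apply to sets of functions.\<close>

locale semi_inner_product =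
  fixes S :: "'v::real_vector set" and B :: "'v \<Rightarrow> 'v \<Rightarrow> real"
  assumes subspace: "subspace S"
    and add_left: "\<lbrakk>x \<in> S; y \<in> S; z \<in> S\<rbrakk> \<Longrightarrow> B (x + y) z = B x z + B y z"
    and scale_left: "\<lbrakk>x \<in> S; z \<in> S\<rbrakk> \<Longrightarrow> B (c *\<^sub>R x) z = c * B x z"
    and sym: "\<lbrakk>x \<in> S; y \<in> S\<rbrakk> \<Longrightarrow> B x y = B y x"
    and nonneg: "x \<in> S \<Longrightarrow> 0 \<le> B x x"
begin

lemma add_mem: "\<lbrakk>x \<in> S; y \<in> S\<rbrakk> \<Longrightarrow> x + y \<in> S"
  by (rule subspace_add [OF subspace])

lemma scale_mem: "x \<in> S \<Longrightarrow> c *\<^sub>R x \<in> S"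
  by (rule subspace_scale [OF subspace])

lemma diff_mem: "\<lbrakk>x \<in> S; y \<in> S\<rbrakk> \<Longrightarrow> x - y \<in> S"
  by (rule subspace_diff [OF subspace])

lemma zero_mem: "0 \<in> S"
  by (rule subspace_0 [OF subspace])

lemma lincomb_mem: "(\<And>e. e \<in> E \<Longrightarrow> e \<in> S) \<Longrightarrow> (\<Sum>e\<in>E. c e *\<^sub>R e) \<in> S"
  by (intro subspace_sum [OF subspace] scale_mem)

lemma zero_left: "z \<in> S \<Longrightarrow> B 0 z = 0"
  using scale_left [of z z 0] by simp

lemma diff_left: "\<lbrakk>x \<in> S; y \<in> S; z \<in> S\<rbrakk> \<Longrightarrow> B (x - y) z = B x z - B y z"
  using add_left [of "x - y" y z] diff_mem by simp

lemma add_right: "\<lbrakk>x \<in> S; y \<in> S; z \<in> S\<rbrakk> \<Longrightarrow> B z (x + y) = B z x + B z y"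
  using add_left sym add_mem by metis

lemma scale_right: "\<lbrakk>x \<in> S; z \<in> S\<rbrakk> \<Longrightarrow> B z (c *\<^sub>R x) = c * B z x"
  using scale_left sym scale_mem by metis

lemma diff_right: "\<lbrakk>x \<in> S; y \<in> S; z \<in> S\<rbrakk> \<Longrightarrow> B z (x - y) = B z x - B z y"
  using diff_left sym diff_mem by metis

lemma lincomb_left:
  "\<lbrakk>\<And>e. e \<in> E \<Longrightarrow> e \<in> S; z \<in> S\<rbrakk> \<Longrightarrow> B (\<Sum>e\<in>E. c e *\<^sub>R e) z = (\<Sum>e\<in>E. c e * B e z)"
proof (induction E rule: infinite_finite_induct)
  case (insert a E)
  then show ?case
    by (simp add: add_left scale_left scale_mem lincomb_mem)
qed (auto simp: zero_left)

text \<open>The quadratic polynomial \<open>B (x + t *\<^sub>R y) (x + t *\<^sub>R y)\<close> in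
  \<open>t\<close> is nonnegative. If \<open>B y y = 0\<close>, which does not force
  \<open>y = 0\<close> here, it is affine in \<open>t\<close> and hence constant.\<close>

lemma Cauchy_Schwarz:
  assumes "x \<in> S" "y \<in> S"
  shows "(B x y)\<^sup>2 \<le> B x x * B y y"
proof -
  have *: "0 \<le> B x x + 2 * t * B x y + t\<^sup>2 * B y y" for t
  proof -
    have "B (x + t *\<^sub>R y) (x + t *\<^sub>R y) = B x x + 2 * t * B x y + t\<^sup>2 * B y y"
      using assms sym [of y x]
      by (simp add: add_left add_right scale_left scale_right scale_mem add_mem power2_eq_square
          algebra_simps)
    then show ?thesis
      using nonneg [of "x + t *\<^sub>R y"] assms by (simp add: add_mem scale_mem)
  qed
  show ?thesis
  proof (cases "B y y = 0")
    case True
    have "B x y = 0"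
    proof (rule ccontr)
      assume "B x y \<noteq> 0"
      \<comment> \<open>At this \<open>t\<close> the affine function takes the value -1.\<close>
      then show False
        using * [of "- (B x x + 1) / (2 * B x y)"] True by (simp add: field_simps)
    qed
    then show ?thesis
      using True by simp
  next
    case False
    then have "B y y > 0"
      using nonneg [OF assms(2)] by simp
    then show ?thesis
      using * [of "- B x y / B y y"] by (simp add: field_simps power2_eq_square)
  qed
qed

lemma null_left: "\<lbrakk>x \<in> S; y \<in> S; B x x = 0\<rbrakk> \<Longrightarrow> B x y = 0"
  using Cauchy_Schwarz [of x y] by simp

text \<open>For fixed \<open>E\<close> the Parseval identity is linear in \<open>w\<close>; it
  therefore extends from generators to their span.\<close>

lemma parseval_subspace:
  assumes "E \<subseteq> S"
  shows "subspace {w \<in> S. \<forall>y\<in>S. B w y = (\<Sum>e\<in>E. B w e * B e y)}"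
proof (rule subspaceI)
  show "0 \<in> {w \<in> S. \<forall>y\<in>S. B w y = (\<Sum>e\<in>E. B w e * B e y)}"
  proof -
    have "(\<Sum>e\<in>E. B 0 e * B e y) = 0" for y
      using assms by (intro sum.neutral) (auto simp: zero_left)
    then show ?thesis
      by (simp add: zero_mem zero_left)
  qed
next
  fix x y assume "x \<in> {w \<in> S. \<forall>y\<in>S. B w y = (\<Sum>e\<in>E. B w e * B e y)}"
    and "y \<in> {w \<in> S. \<forall>y\<in>S. B w y = (\<Sum>e\<in>E. B w e * B e y)}"
  moreover have "(\<Sum>e\<in>E. B (x + y) e * B e z) = (\<Sum>e\<in>E. B x e * B e z) + (\<Sum>e\<in>E. B y e * B e z)"
    if "x \<in> S" "y \<in> S" for z
    unfolding sum.distrib [symmetric] using that assms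
    by (intro sum.cong) (auto simp: add_left subset_iff algebra_simps)
  ultimately show "x + y \<in> {w \<in> S. \<forall>y\<in>S. B w y = (\<Sum>e\<in>E. B w e * B e y)}"
    by (simp add: add_left add_mem)
next
  fix c x assume "x \<in> {w \<in> S. \<forall>y\<in>S. B w y = (\<Sum>e\<in>E. B w e * B e y)}"
  moreover have "(\<Sum>e\<in>E. B (c *\<^sub>R x) e * B e z) = c * (\<Sum>e\<in>E. B x e * B e z)"
    if "x \<in> S" for z
    unfolding sum_distrib_left using that assms
    by (intro sum.cong) (auto simp: scale_left subset_iff algebra_simps)
  ultimately show "c *\<^sub>R x \<in> {w \<in> S. \<forall>y\<in>S. B w y = (\<Sum>e\<in>E. B w e * B e y)}"
    by (simp add: scale_left scale_mem)
qed

text \<open>Gram-Schmidt for a semidefinite form. A residual of norm zero is dropped, since it pairs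
  to zero with all of \<open>S\<close>; so \<open>E\<close> may fail to span \<open>span G\<close>,
  yet Parseval holds. Its second argument ranges over all of \<open>S\<close>, as projecting an
  arbitrary function onto \<open>span G\<close> requires.\<close>

lemma orthonormal_family_exists:
  assumes "finite G" "G \<subseteq> S"
  obtains E where "finite E" "E \<subseteq> span G" "\<And>e. e \<in> E \<Longrightarrow> B e e = 1"
    "\<And>e f. \<lbrakk>e \<in> E; f \<in> E; e \<noteq> f\<rbrakk> \<Longrightarrow> B e f = 0"
    "\<And>w y. \<lbrakk>w \<in> span G; y \<in> S\<rbrakk> \<Longrightarrow> B w y = (\<Sum>e\<in>E. B w e * B e y)"
proof -
  have "\<exists>E. finite E \<and> E \<subseteq> span G \<and> (\<forall>e\<in>E. B e e = 1) \<and> (\<forall>e\<in>E. \<forall>f\<in>E. e \<noteq> f \<longrightarrow> B e f = 0) \<and>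
      (\<forall>w\<in>G. \<forall>y\<in>S. B w y = (\<Sum>e\<in>E. B w e * B e y))"
    using assms
  proof (induction G rule: finite_induct)
    case empty
    show ?case
      by (intro exI [of _ "{}"]) auto
  next
    case (insert g G)
    have g: "g \<in> S" and GS: "G \<subseteq> S"
      using insert.prems by auto
    obtain E where E: "finite E" "E \<subseteq> span G" "\<forall>e\<in>E. B e e = 1"
        "\<forall>e\<in>E. \<forall>f\<in>E. e \<noteq> f \<longrightarrow> B e f = 0"
        and pars: "\<forall>w\<in>G. \<forall>y\<in>S. B w y = (\<Sum>e\<in>E. B w e * B e y)"
      using insert.IH [OF GS] by (elim exE conjE)
    have ES: "e \<in> S" if "e \<in> E" for e
      using that E(2) span_minimal [OF GS subspace] by auto
    define P where "P = (\<Sum>e\<in>E. B g e *\<^sub>R e)"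
    define u where "u = g - P"
    have P: "P \<in> S"
      unfolding P_def by (intro lincomb_mem ES)
    have u: "u \<in> S"
      unfolding u_def by (intro diff_mem g P)
    have Py: "B P y = (\<Sum>e\<in>E. B g e * B e y)" if "y \<in> S" for y
      unfolding P_def by (rule lincomb_left) (use ES that in auto)
    have gy: "B g y = B u y + (\<Sum>e\<in>E. B g e * B e y)" if "y \<in> S" for y
      using that Py [OF that] by (simp add: u_def diff_left g P)
    have ue: "B u e = 0" if "e \<in> E" for e
    proof -
      have "(\<Sum>f\<in>E. B g f * B f e) = (\<Sum>f\<in>E. if f = e then B g e else 0)"
        using E(3,4) that by (intro sum.cong) auto
      then show ?thesis
        using gy [of e] ES that E(1) by simp
    qed
    have spanE: "E \<subseteq> span (insert g G)"
      using E(2) span_mono [of G "insert g G"] by auto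
    show ?case
    proof (cases "B u u = 0")
      case True
      then have "\<forall>w\<in>insert g G. \<forall>y\<in>S. B w y = (\<Sum>e\<in>E. B w e * B e y)"
        using pars gy null_left [OF u] by auto
      then show ?thesis
        using E spanE by (intro exI [of _ E]) auto
    next
      case False
      define b where "b = sqrt (B u u)"
      have b: "b > 0" "b * b = B u u"
        using False nonneg [OF u] by (auto simp: b_def less_le)
      define n where "n = inverse b *\<^sub>R u"
      have n: "n \<in> S"
        unfolding n_def by (intro scale_mem u)
      have ny: "B n y = B u y / b" if "y \<in> S" for y
        using that u by (simp add: n_def scale_left field_simps)
      have nn: "B n n = 1"
        using ny [OF n] sym [OF u n] ny [OF u] b False by (simp add: field_simps)
      have ne: "B n e = 0" if "e \<in> E" for e
        using ny [of e] ES ue that by simp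
      have en: "B e n = 0" if "e \<in> E" for e
        using ne ES sym n that by metis
      have nE: "n \<notin> E"
        using ne nn by force
      have gn: "B g n = b"
        proof -
        have "B g n = B u u / b"
          using gy [OF n] en ny [OF u] sym [OF u n] by simp
        also have "\<dots> = b"
          using b by (metis less_irrefl nonzero_mult_div_cancel_right)
        finally show ?thesis .
      qed
      have uspan: "u \<in> span (insert g G)"
        unfolding u_def P_def using spanE
        by (intro span_diff span_sum span_scale) (auto simp: span_base)
      have "\<forall>w\<in>insert g G. \<forall>y\<in>S. B w y = (\<Sum>e\<in>insert n E. B w e * B e y)"
      proof (intro ballI)
        fix w y assume w: "w \<in> insert g G" and y: "y \<in> S"
        show "B w y = (\<Sum>e\<in>insert n E. B w e * B e y)"
        proof (cases "w = g")
          case True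
          then show ?thesis
            using gy [OF y] ny [OF y] gn b nE E(1) by simp
        next
          case False
          then have "w \<in> G"
            using w by simp
          then have "B w n = 0"
            using pars n en by simp
          then show ?thesis
            using pars \<open>w \<in> G\<close> y nE E(1) by simp
        qed
      qed
      then show ?thesis
        using E spanE nn ne en uspan
        by (intro exI [of _ "insert n E"]) (auto simp: n_def span_scale)
    qed
  qed
  then obtain E where E: "finite E" "E \<subseteq> span G" "\<forall>e\<in>E. B e e = 1"
    "\<forall>e\<in>E. \<forall>f\<in>E. e \<noteq> f \<longrightarrow> B e f = 0"
    and pars: "\<forall>w\<in>G. \<forall>y\<in>S. B w y = (\<Sum>e\<in>E. B w e * B e y)"
    by (elim exE conjE)
  have ES: "E \<subseteq> S"
    using E(2) span_minimal [OF assms(2) subspace] by auto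
  have "span G \<subseteq> {w \<in> S. \<forall>y\<in>S. B w y = (\<Sum>e\<in>E. B w e * B e y)}"
    using pars assms by (intro span_minimal parseval_subspace ES) auto
  then show thesis
    using E that [of E] by blast
qed

lemma orthogonal_projection_exists:
  assumes "finite G" "G \<subseteq> S" "f \<in> S"
  shows "\<exists>p\<in>span G. \<forall>q\<in>span G. B (f - p) q = 0"
proof -
  obtain E where E: "finite E" "E \<subseteq> span G"
    and pars: "\<And>w y. \<lbrakk>w \<in> span G; y \<in> S\<rbrakk> \<Longrightarrow> B w y = (\<Sum>e\<in>E. B w e * B e y)"
    using orthonormal_family_exists [OF assms(1,2)] by metis
  have GS: "span G \<subseteq> S"
    by (rule span_minimal [OF assms(2) subspace])
  define p where "p = (\<Sum>e\<in>E. B f e *\<^sub>R e)"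
  have "p \<in> span G"
    unfolding p_def using E by (intro span_sum span_scale) auto
  moreover have "B (f - p) q = 0" if "q \<in> span G" for q
  proof -
    have q: "q \<in> S"
      using that GS by auto
    have "B p q = (\<Sum>e\<in>E. B f e * B e q)"
      unfolding p_def using E GS q by (intro lincomb_left) auto
    also have "\<dots> = (\<Sum>e\<in>E. B q e * B e f)"
      using E GS q assms(3) by (intro sum.cong) (auto simp: sym [of f] sym [of q] subset_iff)
    also have "\<dots> = B f q"
      using pars [OF that assms(3)] sym [OF q assms(3)] by simp
    finally show ?thesis
      using \<open>p \<in> span G\<close> GS q assms(3) by (auto simp: diff_left)
  qed
  ultimately show ?thesis
    by blast
qed

text \<open>The coefficients of the representative are the values of \<open>L\<close> on an
  orthonormal family. As \<open>B\<close> may be degenerate, \<open>L\<close> has to vanish on null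
  vectors: this is the solvability condition of the problem.\<close>

lemma riesz_representation:
  fixes L :: "'v \<Rightarrow> real"
  assumes "finite G" "S = span G"
    and add: "\<And>x y. \<lbrakk>x \<in> S; y \<in> S\<rbrakk> \<Longrightarrow> L (x + y) = L x + L y"
    and scale: "\<And>x c. x \<in> S \<Longrightarrow> L (c *\<^sub>R x) = c * L x"
    and null: "\<And>w. \<lbrakk>w \<in> S; B w w = 0\<rbrakk> \<Longrightarrow> L w = 0"
  shows "\<exists>p\<in>S. \<forall>w\<in>S. B p w = L w"
proof -
  have GS: "G \<subseteq> S"
    using assms(2) span_superset by blast
  obtain E where E: "finite E" "E \<subseteq> S"
    and pars: "\<And>w y. \<lbrakk>w \<in> S; y \<in> S\<rbrakk> \<Longrightarrow> B w y = (\<Sum>e\<in>E. B w e * B e y)"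
    using orthonormal_family_exists [OF assms(1) GS] assms(2) by metis
  have L_sum: "L (\<Sum>e\<in>F. c e *\<^sub>R e) = (\<Sum>e\<in>F. c e * L e)" if "F \<subseteq> S" for F c
    using that
  proof (induction F rule: infinite_finite_induct)
    case (insert a F)
    then show ?case
      using add [of "c a *\<^sub>R a" "\<Sum>e\<in>F. c e *\<^sub>R e"] scale [of a "c a"]
      by (auto simp: scale_mem lincomb_mem subset_iff)
  qed (use scale [of 0 0] zero_mem in auto)
  define p where "p = (\<Sum>e\<in>E. L e *\<^sub>R e)"
  have "B p w = L w" if w: "w \<in> S" for w
  proof -
    define P where "P = (\<Sum>e\<in>E. B w e *\<^sub>R e)"
    have P: "P \<in> S"
      unfolding P_def using E by (intro lincomb_mem) auto
    have "B P y = B w y" if "y \<in> S" for y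
      unfolding P_def using E that pars [OF w that] by (subst lincomb_left) auto
    \<comment> \<open>Up to a null vector, \<open>w\<close> equals its expansion in
      \<open>E\<close>.\<close>
    then have "B (w - P) (w - P) = 0"
      using diff_left [OF w P] diff_mem [OF w P] by simp
    then have "L (w - P) = 0"
      by (rule null [OF diff_mem [OF w P]])
    then have "L w = L P"
      using add [OF diff_mem [OF w P] P] by simp
    also have "\<dots> = (\<Sum>e\<in>E. B w e * L e)"
      unfolding P_def by (rule L_sum [OF E(2)])
    also have "\<dots> = (\<Sum>e\<in>E. L e * B e w)"
      using E w by (intro sum.cong) (auto simp: sym [of w])
    also have "\<dots> = B p w"
      unfolding p_def using E w by (subst lincomb_left) auto
    finally show ?thesis ..
  qed
  moreover have "p \<in> S"
    unfolding p_def using E by (intro lincomb_mem) auto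
  ultimately show ?thesis
    by blast
qed

text \<open>Pythagoras. Orthogonality is asked against \<open>p\<close> and the competitor
  \<open>c\<close> only, so that a constant can be inserted for \<open>c\<close> whatever space is
  projected onto.\<close>

lemma projection_minimal:
  assumes "f \<in> S" "p \<in> S" "c \<in> S" "B (f - p) p = 0" "B (f - p) c = 0"
  shows "B (f - p) (f - p) \<le> B (f - c) (f - c)"
proof -
  have d: "f - p \<in> S" "p - c \<in> S"
    by (intro diff_mem assms)+
  have 0: "B (f - p) (p - c) = 0"
    using assms d by (simp add: diff_right)
  have "B (f - c) (f - c) = B ((f - p) + (p - c)) ((f - p) + (p - c))"
    by simp
  also have "\<dots> = B (f - p) (f - p) + B (p - c) (p - c)"
    using d 0 sym [OF d] by (simp only: add_left add_right add_mem)
  finally show ?thesis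
    using nonneg [OF d(2)] by simp
qed

lemma norm_add_le:
  assumes "x \<in> S" "y \<in> S"
  shows "B (x + y) (x + y) \<le> 2 * B x x + 2 * B y y"
proof -
  have "0 \<le> B (x - y) (x - y)"
    by (intro nonneg diff_mem assms)
  then show ?thesis
    using assms sym [OF assms] by (simp add: diff_left diff_right add_left add_right add_mem diff_mem)
qed

lemma norm_diff_le:
  assumes "x \<in> S" "y \<in> S"
  shows "B (x - y) (x - y) \<le> 2 * B x x + 2 * B y y"
proof -
  have "0 \<le> B (x + y) (x + y)"
    by (intro nonneg add_mem assms)
  then show ?thesis
    using assms sym [OF assms] by (simp add: diff_left diff_right add_left add_right add_mem diff_mem)
qed

end

section \<open>Polynomials\<close>

abbreviation monomial :: "('n::finite \<Rightarrow> nat) \<Rightarrow> real^'n \<Rightarrow> real" where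
  "monomial a \<equiv> \<lambda>x. \<Prod>i\<in>UNIV. (x $ i) ^ a i"

lemma finite_multi_indices: "finite {a :: 'n::finite \<Rightarrow> nat. sum a UNIV \<le> l}"
proof (rule finite_subset)
  show "{a :: 'n \<Rightarrow> nat. sum a UNIV \<le> l} \<subseteq> PiE UNIV (\<lambda>_. {..l})"
    by (auto simp: PiE_iff) (meson finite member_le_sum order_trans zero_le UNIV_I)
qed (auto intro: finite_PiE)

text \<open>Provides the finite set of generators for Gram-Schmidt and reduces closure properties to
  those of \<open>span\<close>.\<close>

lemma Poly_eq_span: "Poly l = span (monomial ` {a :: 'n::finite \<Rightarrow> nat. sum a UNIV \<le> l})"
proof (intro set_eqI iffI)
  fix p :: "real^'n \<Rightarrow> real" assume "p \<in> Poly l"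
  then obtain c where "\<And>x. p x = (\<Sum>a\<in>{a. sum a UNIV \<le> l}. c a * monomial a x)"
    by (auto simp: Poly_def)
  then have "p = (\<Sum>a\<in>{a. sum a UNIV \<le> l}. c a *\<^sub>R monomial a)"
    by (auto simp: fun_eq_iff sum_fun_apply)
  also have "\<dots> \<in> span (monomial ` {a. sum a UNIV \<le> l})"
    by (intro span_sum span_scale span_base imageI)
  finally show "p \<in> span (monomial ` {a. sum a UNIV \<le> l})" .
next
  have "subspace (Poly l :: (real^'n \<Rightarrow> real) set)"
  proof (rule subspaceI)
    show "(0 :: real^'n \<Rightarrow> real) \<in> Poly l"
      by (auto simp: Poly_def intro!: exI [of _ "\<lambda>_. 0"])
  next
    fix p q :: "real^'n \<Rightarrow> real" assume "p \<in> Poly l" "q \<in> Poly l"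
    then obtain c c' where "\<And>x. p x = (\<Sum>a\<in>{a. sum a UNIV \<le> l}. c a * monomial a x)"
      "\<And>x. q x = (\<Sum>a\<in>{a. sum a UNIV \<le> l}. c' a * monomial a x)"
      by (auto simp: Poly_def)
    then show "p + q \<in> Poly l"
      by (auto simp: Poly_def sum.distrib algebra_simps intro!: exI [of _ "\<lambda>a. c a + c' a"])
  next
    fix b and p :: "real^'n \<Rightarrow> real" assume "p \<in> Poly l"
    then obtain c where "\<And>x. p x = (\<Sum>a\<in>{a. sum a UNIV \<le> l}. c a * monomial a x)"
      by (auto simp: Poly_def)
    then show "b *\<^sub>R p \<in> Poly l"
      by (auto simp: Poly_def sum_distrib_left algebra_simps intro!: exI [of _ "\<lambda>a. b * c a"])
  qed
  moreover have "monomial ` {a. sum a UNIV \<le> l} \<subseteq> (Poly l :: (real^'n \<Rightarrow> real) set)"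
  proof clarsimp
    fix a :: "'n \<Rightarrow> nat" assume "sum a UNIV \<le> l"
    then have "monomial a x = (\<Sum>b\<in>{b. sum b UNIV \<le> l}. of_bool (b = a) * monomial b x)" for x
      using finite_multi_indices [of l]
      by (subst sum.remove [of _ a]) (auto intro!: sum.neutral)
    then show "monomial a \<in> Poly l"
      by (auto simp: Poly_def intro!: exI [of _ "\<lambda>b. of_bool (b = a)"])
  qed
  ultimately show "p \<in> Poly l" if "p \<in> span (monomial ` {a. sum a UNIV \<le> l})" for p :: "real^'n \<Rightarrow> real"
    using that span_minimal by blast
qed

lemma subspace_Poly: "subspace (Poly l)"
  by (simp add: Poly_eq_span)

lemma Poly_add: "\<lbrakk>p \<in> Poly l; q \<in> Poly l\<rbrakk> \<Longrightarrow> (\<lambda>x. p x + q x) \<in> Poly l"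
  using subspace_add [OF subspace_Poly, of p l q] by (simp add: plus_fun_def)

lemma Poly_scale: "p \<in> Poly l \<Longrightarrow> (\<lambda>x. c * p x) \<in> Poly l"
  using subspace_scale [OF subspace_Poly, of p l c] by (simp add: scaleR_fun_def)

lemma Poly_diff: "\<lbrakk>p \<in> Poly l; q \<in> Poly l\<rbrakk> \<Longrightarrow> (\<lambda>x. p x - q x) \<in> Poly l"
  using subspace_diff [OF subspace_Poly, of p l q] by (simp add: fun_diff_def)

lemma Poly_sum: "(\<And>i. i \<in> I \<Longrightarrow> p i \<in> Poly l) \<Longrightarrow> (\<lambda>x. \<Sum>i\<in>I. p i x) \<in> Poly l"
  using subspace_sum [OF subspace_Poly, of I p l] sum_fun_apply [of p I]
  by (simp add: fun_eq_iff [symmetric] flip: sum_fun_apply)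

lemma Poly_mono: "l \<le> m \<Longrightarrow> Poly l \<subseteq> Poly m"
  unfolding Poly_eq_span by (intro span_mono) auto

lemma monomial_mem: "sum a UNIV \<le> l \<Longrightarrow> monomial a \<in> Poly l"
  unfolding Poly_eq_span by (intro span_base) auto

lemma Poly_const: "(\<lambda>x. c) \<in> Poly l"
  using Poly_scale [OF monomial_mem [of "\<lambda>_. 0" l], of c] by simp

lemma monomial_upd:
  fixes a :: "'n::finite \<Rightarrow> nat"
  shows "monomial (a(j := Suc (a j))) x = x $ j * monomial a x"
  and "sum (a(j := Suc (a j))) UNIV = Suc (sum a UNIV)"
proof -
  have "monomial (a(j := Suc (a j))) x = (x $ j) ^ Suc (a j) * (\<Prod>i\<in>UNIV - {j}. (x $ i) ^ a i)"
    by (subst prod.remove [of _ j]) auto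
  also have "\<dots> = x $ j * monomial a x"
    by (subst (2) prod.remove [of _ j]) auto
  finally show "monomial (a(j := Suc (a j))) x = x $ j * monomial a x" .
  have "sum (a(j := Suc (a j))) UNIV = Suc (a j) + sum a (UNIV - {j})"
    by (subst sum.remove [of _ j]) auto
  also have "\<dots> = Suc (sum a UNIV)"
    by (subst (2) sum.remove [of _ j]) auto
  finally show "sum (a(j := Suc (a j))) UNIV = Suc (sum a UNIV)" .
qed

lemma Poly_coord_mult:
  assumes "p \<in> Poly l"
  shows "(\<lambda>x. x $ j * p x) \<in> Poly (Suc l)"
proof -
  obtain c where c: "\<And>x. p x = (\<Sum>a\<in>{a. sum a UNIV \<le> l}. c a * monomial a x)"
    using assms by (auto simp: Poly_def)
  have "(\<lambda>x. x $ j * p x) = (\<lambda>x. \<Sum>a\<in>{a. sum a UNIV \<le> l}. c a * monomial (a(j := Suc (a j))) x)"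
    unfolding c monomial_upd by (simp add: sum_distrib_left mult_ac)
  also have "\<dots> \<in> Poly (Suc l)"
    by (intro Poly_sum Poly_scale monomial_mem) (simp only: monomial_upd mem_Collect_eq Suc_le_mono)
  finally show ?thesis .
qed

text \<open>Reduces a claim on polynomials to multiplication by one coordinate at a time, so that
  derivatives, affine substitutions and restrictions to lines are obtained without computing with
  multi-indices. The degree bound is an argument of \<open>P\<close> because multiplication raises
  it.\<close>

lemma Poly_induct [consumes 1, case_names one coord_mult add scale]:
  fixes P :: "nat \<Rightarrow> (real^'n \<Rightarrow> real) \<Rightarrow> bool"
  assumes "p \<in> Poly l"
    and one: "\<And>l. P l (\<lambda>x. 1)"
    and coord_mult: "\<And>l q j. \<lbrakk>q \<in> Poly l; P l q\<rbrakk> \<Longrightarrow> P (Suc l) (\<lambda>x. x $ j * q x)"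
    and add: "\<And>l p q. \<lbrakk>p \<in> Poly l; q \<in> Poly l; P l p; P l q\<rbrakk> \<Longrightarrow> P l (\<lambda>x. p x + q x)"
    and scale: "\<And>l p c. \<lbrakk>p \<in> Poly l; P l p\<rbrakk> \<Longrightarrow> P l (\<lambda>x. c * p x)"
  shows "P l p"
proof -
  have mono: "P l (monomial a)" if "sum a UNIV \<le> l" for a :: "'n \<Rightarrow> nat" and l
    using that
  proof (induction "sum a UNIV" arbitrary: a l)
    case 0
    then show ?case
      using one by simp
  next
    case (Suc m)
    then obtain j where j: "a j \<noteq> 0"
      by (metis nat.distinct(1) sum.neutral)
    \<comment> \<open>Lowering a positive exponent exhibits the monomial as a coordinate times a
      monomial of smaller degree.\<close>
    define b where "b = a(j := a j - 1)"
    have ab: "a = b(j := Suc (b j))"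
      using j by (auto simp: b_def)
    then have b: "m = sum b UNIV"
      using Suc.hyps(2) monomial_upd(2) [of b j] by simp
    obtain l' where l': "l = Suc l'" "sum b UNIV \<le> l'"
      using Suc.prems Suc.hyps(2) b by (cases l) auto
    have "P (Suc l') (\<lambda>x. x $ j * monomial b x)"
      using Suc.hyps(1) [OF b l'(2)] l'(2) by (intro coord_mult monomial_mem)
    then show ?case
      unfolding l' by (subst ab) (simp only: monomial_upd)
  qed
  obtain c where c: "\<And>x. p x = (\<Sum>a\<in>{a. sum a UNIV \<le> l}. c a * monomial a x)"
    using assms(1) by (auto simp: Poly_def)
  have "P l (\<lambda>x. \<Sum>a\<in>A. c a * monomial a x)" if "A \<subseteq> {a. sum a UNIV \<le> l}" for A
    using finite_subset [OF that finite_multi_indices] that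
  proof (induction A rule: finite_induct)
    case empty
    show ?case
      using scale [OF Poly_const one, of _ 0] by simp
  next
    case (insert a A)
    then have "P l (\<lambda>x. c a * monomial a x + (\<Sum>a\<in>A. c a * monomial a x))"
      by (intro add scale mono Poly_sum Poly_scale monomial_mem) auto
    then show ?case
      using insert by simp
  qed
  from this [OF order_refl] show ?thesis
    by (simp add: c [abs_def, symmetric] fun_eq_iff c)
qed

text \<open>The partial derivatives are recorded with the same bound \<open>l\<close>: an estimate
  valid on \<open>Poly l\<close> then applies to a polynomial and to its partial derivatives
  alike.\<close>

lemma Poly_differentiable:
  assumes "p \<in> Poly l"
  shows "\<exists>D. (\<forall>i. D i \<in> Poly l) \<and> (\<forall>x. (p has_derivative (\<lambda>v. \<Sum>i\<in>UNIV. v $ i * D i x)) (at x))"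
  using assms
proof (induction rule: Poly_induct)
  case (one l)
  show ?case
    by (rule exI [of _ "\<lambda>_ _. 0"]) (auto simp: Poly_const)
next
  case (coord_mult l q j)
  then obtain D where D: "\<And>i. D i \<in> Poly l"
    "\<And>x. (q has_derivative (\<lambda>v. \<Sum>i\<in>UNIV. v $ i * D i x)) (at x)"
    by auto
  define D' where "D' i x = of_bool (i = j) * q x + x $ j * D i x" for i x
  have "D' i \<in> Poly (Suc l)" for i
    unfolding D'_def [abs_def] using Poly_mono [of l "Suc l"] coord_mult(1)
    by (intro Poly_add Poly_scale Poly_coord_mult D) auto
  moreover have "((\<lambda>x. x $ j * q x) has_derivative (\<lambda>v. \<Sum>i\<in>UNIV. v $ i * D' i x)) (at x)" for x
  proof -
    have nth: "((\<lambda>x. x $ j) has_derivative (\<lambda>v. v $ j)) (at x)"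
      by (rule bounded_linear_imp_has_derivative) (rule bounded_linear_vec_nth)
    have "((\<lambda>x. x $ j * q x) has_derivative
        (\<lambda>v. x $ j * (\<Sum>i\<in>UNIV. v $ i * D i x) + v $ j * q x)) (at x)"
      by (rule has_derivative_mult [OF nth D(2)])
    moreover have "x $ j * (\<Sum>i\<in>UNIV. v $ i * D i x) + v $ j * q x = (\<Sum>i\<in>UNIV. v $ i * D' i x)" for v
    proof -
      have "(\<Sum>i\<in>UNIV. v $ i * D' i x)
          = (\<Sum>i\<in>UNIV. (if i = j then v $ j * q x else 0)) + (\<Sum>i\<in>UNIV. x $ j * (v $ i * D i x))"
        unfolding sum.distrib [symmetric] by (intro sum.cong) (auto simp: D'_def algebra_simps)
      then show ?thesis
        by (simp add: sum_distrib_left)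
    qed
    ultimately show ?thesis
      by simp
  qed
  ultimately show ?case
    by blast
next
  case (add l p q)
  then obtain D E where D: "\<And>i. D i \<in> Poly l"
    "\<And>x. (p has_derivative (\<lambda>v. \<Sum>i\<in>UNIV. v $ i * D i x)) (at x)"
    and E: "\<And>i. E i \<in> Poly l"
    "\<And>x. (q has_derivative (\<lambda>v. \<Sum>i\<in>UNIV. v $ i * E i x)) (at x)"
    by auto
  show ?case
    using has_derivative_add [OF D(2) E(2)] D(1) E(1)
    by (intro exI [of _ "\<lambda>i x. D i x + E i x"]) (auto simp: sum.distrib algebra_simps intro!: Poly_add)
next
  case (scale l p c)
  then obtain D where D: "\<And>i. D i \<in> Poly l"
    "\<And>x. (p has_derivative (\<lambda>v. \<Sum>i\<in>UNIV. v $ i * D i x)) (at x)"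
    by auto
  show ?case
    using has_derivative_mult_right [OF D(2), of c] D(1)
    by (intro exI [of _ "\<lambda>i x. c * D i x"]) (auto simp: sum_distrib_left algebra_simps intro!: Poly_scale)
qed

lemma grad_eqI:
  assumes "(f has_derivative (\<lambda>v. \<Sum>i\<in>UNIV. v $ i * D i)) (at x)"
  shows "grad f x = (\<chi> i. D i)"
proof -
  have "(\<Sum>i\<in>UNIV. axis j 1 $ i * D i) = D j" for j
  proof -
    have "(\<Sum>i\<in>UNIV. axis j 1 $ i * D i) = (\<Sum>i\<in>UNIV. if i = j then D j else 0)"
      by (intro sum.cong) (auto simp: axis_def)
    then show ?thesis
      by simp
  qed
  then show ?thesis
    by (simp add: grad_def frechet_derivative_at [OF assms, symmetric])
qed

lemma Poly_has_derivative:
  assumes "p \<in> Poly l"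
  shows "(p has_derivative (\<lambda>v. v \<bullet> grad p x)) (at x)"
proof -
  obtain D where D: "(p has_derivative (\<lambda>v. \<Sum>i\<in>UNIV. v $ i * D i x)) (at x)"
    using Poly_differentiable [OF assms] by blast
  then show ?thesis
    by (simp add: grad_eqI [OF D] inner_vec_def)
qed

lemma Poly_partial:
  assumes "p \<in> Poly l"
  shows "(\<lambda>x. grad p x $ i) \<in> Poly l"
proof -
  obtain D where D: "\<And>i. D i \<in> Poly l"
      "\<And>x. (p has_derivative (\<lambda>v. \<Sum>i\<in>UNIV. v $ i * D i x)) (at x)"
    using Poly_differentiable [OF assms] by blast
  have "(\<lambda>x. grad p x $ i) = D i"
    by (simp add: fun_eq_iff grad_eqI [OF D(2)])
  then show ?thesis
    using D(1) by simp
qed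

lemma grad_eq_inner:
  assumes "(f has_derivative (\<lambda>v. v \<bullet> g)) (at x)"
  shows "grad f x = g"
proof -
  have "(f has_derivative (\<lambda>v. \<Sum>i\<in>UNIV. v $ i * (g $ i))) (at x)"
    using assms by (simp add: inner_vec_def)
  from grad_eqI [OF this] show ?thesis
    by simp
qed

lemma grad_add:
  assumes "p \<in> Poly l" "q \<in> Poly m"
  shows "grad (\<lambda>x. p x + q x) x = grad p x + grad q x"
  using has_derivative_add [OF Poly_has_derivative [OF assms(1)] Poly_has_derivative [OF assms(2)]]
  by (intro grad_eq_inner) (simp add: inner_add_right)

lemma grad_scale:
  assumes "p \<in> Poly l"
  shows "grad (\<lambda>x. c * p x) x = c *\<^sub>R grad p x"
  using has_derivative_mult_right [OF Poly_has_derivative [OF assms], of c]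
  by (intro grad_eq_inner) simp

lemma continuous_on_Poly: "p \<in> Poly l \<Longrightarrow> continuous_on A p"
  by (meson Poly_has_derivative continuous_at_imp_continuous_on has_derivative_continuous)

lemma Poly_affine:
  assumes "p \<in> Poly l"
  shows "(\<lambda>x. p (z + h *\<^sub>R x)) \<in> Poly l"
  using assms
proof (induction rule: Poly_induct)
  case (coord_mult l q j)
  have "(\<lambda>x. z $ j * q (z + h *\<^sub>R x) + h * (x $ j * q (z + h *\<^sub>R x))) \<in> Poly (Suc l)"
    using coord_mult Poly_mono [of l "Suc l"]
    by (intro Poly_add Poly_scale Poly_coord_mult) auto
  then show ?case
    by (simp add: algebra_simps)
qed (auto intro: Poly_add Poly_scale Poly_const)

lemma grad_affine:
  assumes "p \<in> Poly l"
  shows "grad (\<lambda>x. p (z + h *\<^sub>R x)) x = h *\<^sub>R grad p (z + h *\<^sub>R x)"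
proof (rule grad_eq_inner)
  have "((\<lambda>x. z + h *\<^sub>R x) has_derivative (\<lambda>v. h *\<^sub>R v)) (at x)"
    by (auto intro!: derivative_eq_intros)
  from has_derivative_compose [OF this Poly_has_derivative [OF assms]]
  show "((\<lambda>x. p (z + h *\<^sub>R x)) has_derivative (\<lambda>v. v \<bullet> h *\<^sub>R grad p (z + h *\<^sub>R x))) (at x)"
    by simp
qed

lemma Poly_on_line:
  assumes "p \<in> Poly l"
  shows "\<exists>q. \<forall>t. p (z + t *\<^sub>R v) = poly q t"
  using assms
proof (induction rule: Poly_induct)
  case (one l)
  show ?case
    by (rule exI [of _ 1]) simp
next
  case (coord_mult l q j)
  then obtain r where "\<And>t. q (z + t *\<^sub>R v) = poly r t"
    by auto
  then show ?case
    by (intro exI [of _ "[:z $ j, v $ j:] * r"]) (simp add: algebra_simps)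
next
  case (add l p q)
  then obtain r s where "\<And>t. p (z + t *\<^sub>R v) = poly r t" "\<And>t. q (z + t *\<^sub>R v) = poly s t"
    by auto
  then show ?case
    by (intro exI [of _ "r + s"]) simp
next
  case (scale l p c)
  then obtain r where "\<And>t. p (z + t *\<^sub>R v) = poly r t"
    by auto
  then show ?case
    by (intro exI [of _ "smult c r"]) simp
qed

text \<open>On the line from a point of \<open>A\<close> through \<open>x\<close> the polynomial has
  infinitely many zeros, hence it vanishes on the whole line.\<close>

lemma Poly_zero_on_open:
  assumes "p \<in> Poly l" "open A" "A \<noteq> {}" "\<And>x. x \<in> A \<Longrightarrow> p x = 0"
  shows "p x = 0"
proof -
  obtain z e where z: "z \<in> A" "e > 0" "ball z e \<subseteq> A"
    using assms(2,3) open_contains_ball by blast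
  obtain q where q: "\<And>t. p (z + t *\<^sub>R (x - z)) = poly q t"
    using Poly_on_line [OF assms(1)] by blast
  \<comment> \<open>The summand 1 keeps the denominator positive when \<open>x = z\<close>.\<close>
  define d where "d = e / (norm (x - z) + 1)"
  have d: "d > 0"
    using z by (auto simp: d_def intro!: divide_pos_pos add_nonneg_pos)
  have "poly q t = 0" if t: "t \<in> {0<..<d}" for t
  proof -
    have "t * norm (x - z) \<le> t * (norm (x - z) + 1)"
      using t by (intro mult_left_mono) auto
    also have "\<dots> < e"
      using t by (simp add: d_def pos_less_divide_eq add_nonneg_pos)
    finally have "z + t *\<^sub>R (x - z) \<in> ball z e"
      using t by (simp add: dist_norm)
    then show ?thesis
      using z assms(4) q by (metis subsetD)
  qed
  then have "infinite {t. poly q t = 0}"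
    using d by (intro infinite_super [OF _ infinite_Ioo [of 0 d]]) auto
  then have "q = 0"
    using poly_roots_finite by blast
  then show ?thesis
    using q [of 1] by simp
qed

section \<open>Square roots of matrices\<close>

text \<open>For small \<open>t\<close> of the sign of \<open>a\<close> the linear term would win.
  This is the first-order condition at a maximum.\<close>

lemma linear_perturbation_zero:
  fixes a b :: real
  assumes "\<And>t. 2 * t * a \<le> t\<^sup>2 * b"
  shows "a = 0"
proof (rule ccontr)
  assume a: "a \<noteq> 0"
  define t where "t = a / (\<bar>b\<bar> + 1)"
  have "2 * a\<^sup>2 / (\<bar>b\<bar> + 1) \<le> a\<^sup>2 / (\<bar>b\<bar> + 1) * (b / (\<bar>b\<bar> + 1))"
    using assms [of t] by (simp add: t_def power2_eq_square)
  also have "\<dots> \<le> a\<^sup>2 / (\<bar>b\<bar> + 1) * 1"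
    by (intro mult_left_mono) auto
  finally have "2 * a\<^sup>2 / (\<bar>b\<bar> + 1) \<le> a\<^sup>2 / (\<bar>b\<bar> + 1)"
    by simp
  moreover have "a\<^sup>2 / (\<bar>b\<bar> + 1) > 0"
    using a by (intro divide_pos_pos) auto
  ultimately show False
    by simp
qed

text \<open>The maximiser of the Rayleigh quotient on an invariant subspace is an eigenvector, and its
  orthogonal complement is again invariant.\<close>

lemma symmetric_eigenbasis:
  fixes f :: "'a::euclidean_space \<Rightarrow> 'a"
  assumes f: "linear f" and sym: "\<And>x y. f x \<bullet> y = x \<bullet> f y"
    and "subspace V" "f ` V \<subseteq> V"
  shows "\<exists>E ev. finite E \<and> E \<subseteq> V \<and> V \<subseteq> span E \<and> pairwise orthogonal E \<and>
    (\<forall>e\<in>E. norm e = 1 \<and> f e = ev e *\<^sub>R e)"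
  using assms(3,4)
proof (induction "dim V" arbitrary: V rule: less_induct)
  case less
  show ?case
  proof (cases "V = {0}")
    case True
    then show ?thesis
      by (intro exI [of _ "{}"]) auto
  next
    case False
    then obtain v where v: "v \<in> V" "v \<noteq> 0"
      using subspace_0 [OF less.prems(1)] by auto
    have "sgn v \<in> sphere 0 1 \<inter> V"
      using v subspace_scale [OF less.prems(1)] by (auto simp: norm_sgn sgn_div_norm)
    moreover have "compact (sphere 0 1 \<inter> V)"
      by (intro compact_Int_closed compact_sphere closed_subspace less.prems)
    moreover have "continuous_on (sphere 0 1 \<inter> V) (\<lambda>x. x \<bullet> f x)"
      by (intro continuous_intros linear_continuous_on f [THEN linear_conv_bounded_linear [THEN iffD1]])
    ultimately obtain e where e: "e \<in> sphere 0 1 \<inter> V"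
      and max: "\<And>x. x \<in> sphere 0 1 \<inter> V \<Longrightarrow> x \<bullet> f x \<le> e \<bullet> f e"
      using continuous_attains_sup [of "sphere 0 1 \<inter> V" "\<lambda>x. x \<bullet> f x"] by blast
    define M where "M = e \<bullet> f e"
    have eV: "e \<in> V" and e1: "norm e = 1" and ee: "e \<bullet> e = 1"
      using e by (auto simp: dot_square_norm)
    have ray: "x \<bullet> f x \<le> M * (x \<bullet> x)" if "x \<in> V" for x
    proof (cases "x = 0")
      case False
      have "sgn x \<in> sphere 0 1 \<inter> V"
        using that False subspace_scale [OF less.prems(1)] by (auto simp: norm_sgn sgn_div_norm)
      from max [OF this] have "(x \<bullet> f x) / (norm x)\<^sup>2 \<le> M"
        by (simp add: M_def sgn_div_norm linear_scale [OF f] power2_eq_square divide_inverse mult_ac)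
      then show ?thesis
        using False by (simp add: divide_le_eq dot_square_norm)
    qed (simp add: linear_0 [OF f])
    have fe: "f e = M *\<^sub>R e"
    proof -
      define y where "y = f e - M *\<^sub>R e"
      have yV: "y \<in> V"
        unfolding y_def using less.prems eV by (intro subspace_diff subspace_scale) auto
      \<comment> \<open>Compares the quadratic form at \<open>e + t *\<^sub>R y\<close> with its
        bound. The first-order coefficient is \<open>a - M * b\<close>, which for the residual
        \<open>y\<close> of the eigenvalue equation equals \<open>y \<bullet> y\<close>, and it has
        to vanish.\<close>
      have "2 * t * (y \<bullet> y) \<le> t\<^sup>2 * (M * (y \<bullet> y) - y \<bullet> f y)" for t
      proof -
        define a b c d where "a = y \<bullet> f e" "b = y \<bullet> e" "c = y \<bullet> f y" "d = y \<bullet> y"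
        note abcd = this
        have "(e + t *\<^sub>R y) \<bullet> f (e + t *\<^sub>R y) \<le> M * ((e + t *\<^sub>R y) \<bullet> (e + t *\<^sub>R y))"
          using less.prems eV yV by (intro ray subspace_add subspace_scale) auto
        moreover have "(e + t *\<^sub>R y) \<bullet> f (e + t *\<^sub>R y) = M + 2 * t * a + t\<^sup>2 * c"
          using sym [of e y]
          by (simp add: abcd linear_add [OF f] linear_scale [OF f] inner_add_left inner_add_right M_def
              power2_eq_square inner_commute algebra_simps)
        moreover have "(e + t *\<^sub>R y) \<bullet> (e + t *\<^sub>R y) = 1 + 2 * t * b + t\<^sup>2 * d"
          using ee by (simp add: abcd inner_add_left inner_add_right power2_eq_square inner_commute algebra_simps)
        moreover have d: "d = a - M * b"
          unfolding abcd by (subst (2) y_def) (simp add: inner_diff_right)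
        ultimately have "M + 2 * t * a + t\<^sup>2 * c \<le> M * (1 + 2 * t * b + t\<^sup>2 * d)"
          by simp
        moreover have "2 * t * d = 2 * t * a - M * (2 * t * b)"
          by (simp add: d algebra_simps)
        ultimately show ?thesis
          unfolding abcd(3,4) [symmetric] by (simp add: algebra_simps)
      qed
      from linear_perturbation_zero [OF this] show ?thesis
        by (simp add: y_def)
    qed
    define W where "W = V \<inter> {x. e \<bullet> x = 0}"
    have W: "subspace W"
      unfolding W_def by (intro subspace_inter less.prems subspace_hyperplane)
    have "e \<notin> W"
      using ee by (simp add: W_def)
    then have "W \<subset> V"
      using eV unfolding W_def by blast
    then have "dim W < dim V"
      using W less.prems(1) by (intro dim_psubset) (metis span_eq_iff)
    moreover have "f ` W \<subseteq> W"
      using less.prems(2) sym [of e] fe by (auto simp: W_def image_subset_iff) (metis inner_scaleR_left mult_zero_right)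
    ultimately obtain E ev where E: "finite E" "E \<subseteq> W" "W \<subseteq> span E" "pairwise orthogonal E"
      "\<forall>e\<in>E. norm e = 1 \<and> f e = ev e *\<^sub>R e"
      using less.hyps W by meson
    have "V \<subseteq> span (insert e E)"
    proof
      fix x assume x: "x \<in> V"
      have "x - (e \<bullet> x) *\<^sub>R e \<in> W"
        using less.prems(1) x eV ee
        by (auto simp: W_def inner_diff_right intro!: subspace_diff subspace_scale)
      then show "x \<in> span (insert e E)"
        using E(3) unfolding span_insert by blast
    qed
    moreover have "pairwise orthogonal (insert e E)"
      using E(2,4) by (auto simp: pairwise_insert orthogonal_def W_def inner_commute)
    ultimately show ?thesis
      using E \<open>e \<notin> W\<close> eV e1 fe
      by (intro exI [of _ "insert e E"] exI [of _ "\<lambda>e. if e \<in> E then ev e else M"])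
        (auto simp: W_def)
  qed
qed

text \<open>Diagonalise \<open>A\<close> and take square roots of its eigenvalues, which are
  nonnegative. The existence gives \<open>mat_sqrt\<close>, defined by choice, its meaning.\<close>

lemma psd_square_root_exists:
  fixes A :: "real^'n^'n"
  assumes "transpose A = A" and psd: "\<And>x. 0 \<le> (A *v x) \<bullet> x"
  shows "\<exists>B. transpose B = B \<and> (\<forall>x. 0 \<le> (B *v x) \<bullet> x) \<and> B ** B = A"
proof -
  have sym: "(A *v x) \<bullet> y = x \<bullet> (A *v y)" for x y
    using assms(1) by (metis dot_lmul_matrix vector_transpose_matrix)
  obtain E ev where E: "finite E" "UNIV \<subseteq> span E" "pairwise orthogonal E"
    and eig: "\<forall>e\<in>E. norm e = 1 \<and> A *v e = ev e *\<^sub>R e"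
    using symmetric_eigenbasis [OF matrix_vector_mul_linear sym subspace_UNIV] by auto
  have expand: "(\<Sum>e\<in>E. (x \<bullet> e) *\<^sub>R e) = x" for x
    using E eig by (intro orthonormal_basis_expand) auto
  have ee: "e \<bullet> e' = of_bool (e = e')" if "e \<in> E" "e' \<in> E" for e e'
    using that E(3) eig by (auto simp: pairwise_def orthogonal_def dot_square_norm)
  have pos: "0 \<le> ev e" if "e \<in> E" for e
    using psd [of e] eig that by (simp add: dot_square_norm)
  define g where "g x = (\<Sum>e\<in>E. (sqrt (ev e) * (x \<bullet> e)) *\<^sub>R e)" for x
  have lin: "linear g"
    unfolding g_def
    by (intro linear_compose_sum ballI) (auto intro!: linearI simp: inner_add_left algebra_simps)
  define B where "B = matrix g"
  have B: "B *v x = g x" for x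
    unfolding B_def using lin by (simp add: matrix_works)
  have g_inner: "g x \<bullet> y = (\<Sum>e\<in>E. sqrt (ev e) * (x \<bullet> e) * (y \<bullet> e))" for x y
    unfolding g_def inner_sum_left inner_scaleR_left by (simp add: inner_commute)
  have "transpose B = B"
  proof -
    have "(transpose B *v x) \<bullet> y = (B *v x) \<bullet> y" for x y
    proof -
      have "(transpose B *v x) \<bullet> y = x \<bullet> (B *v y)"
        by (metis dot_lmul_matrix vector_transpose_matrix transpose_transpose)
      also have "\<dots> = g y \<bullet> x"
        by (simp add: B inner_commute)
      also have "\<dots> = (B *v x) \<bullet> y"
        by (simp add: B g_inner mult_ac)
      finally show ?thesis .
    qed
    then show ?thesis
      by (metis matrix_eq vector_eq_rdot)
  qed
  moreover have "0 \<le> (B *v x) \<bullet> x" for x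
    using pos by (auto simp: B g_inner mult.assoc intro!: sum_nonneg)
  moreover have "B ** B = A"
  proof -
    have "g e = sqrt (ev e) *\<^sub>R e" if "e \<in> E" for e
    proof -
      have "g e = (\<Sum>f\<in>E. if f = e then sqrt (ev e) *\<^sub>R e else 0)"
        unfolding g_def using ee that by (intro sum.cong) auto
      then show ?thesis
        using that E(1) by simp
    qed
    then have gg: "g (g e) = A *v e" if "e \<in> E" for e
      using that pos [OF that] eig by (simp add: linear_scale [OF lin])
    have "(B ** B) *v x = A *v x" for x
    proof -
      have "(B ** B) *v x = g (g (\<Sum>e\<in>E. (x \<bullet> e) *\<^sub>R e))"
        unfolding expand by (simp add: B flip: matrix_vector_mul_assoc)
      also have "\<dots> = (\<Sum>e\<in>E. (x \<bullet> e) *\<^sub>R g (g e))"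
        by (simp add: linear_sum [OF lin] linear_scale [OF lin])
      also have "\<dots> = A *v (\<Sum>e\<in>E. (x \<bullet> e) *\<^sub>R e)"
        by (simp add: gg linear_sum [OF matrix_vector_mul_linear]
            linear_scale [OF matrix_vector_mul_linear])
      finally show ?thesis
        unfolding expand .
    qed
    then show ?thesis
      by (simp add: matrix_eq)
  qed
  ultimately show ?thesis
    by blast
qed

text \<open>Removes the root from the weighted seminorm and leaves the form given by
  \<open>A\<close> itself.\<close>

lemma mat_sqrt_inner:
  assumes "transpose A = A" "\<And>x. 0 \<le> (A *v x) \<bullet> x"
  shows "(mat_sqrt A *v x) \<bullet> (mat_sqrt A *v y) = (A *v x) \<bullet> y"
proof -
  have "transpose (mat_sqrt A) = mat_sqrt A \<and> (\<forall>x. 0 \<le> (mat_sqrt A *v x) \<bullet> x) \<and>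
    mat_sqrt A ** mat_sqrt A = A"
    unfolding mat_sqrt_def by (rule someI_ex) (rule psd_square_root_exists [OF assms])
  then show ?thesis
    by (metis dot_lmul_matrix vector_transpose_matrix matrix_vector_mul_assoc inner_commute)
qed

section \<open>Surface measure of element boundaries\<close>

lemma sets_surface [simp, measurable_cong]: "sets surface = sets borel"
  unfolding surface_def using sets.sigma_sets_eq [of borel] by (simp add: sets_measure_of_conv)

lemma space_surface [simp]: "space surface = UNIV"
  by (simp add: surface_def space_measure_of_conv)

text \<open>\<open>measure_of\<close> gives a measurable set its value under the given set function
  if that function is a measure on the sigma algebra, and 0 in all other cases; both lie below
  \<open>hausdorff_outer\<close>.\<close>

lemma emeasure_surface_le:
  "emeasure surface A \<le> hausdorff_outer (DIM('a) - 1) (A :: 'a::euclidean_space set)"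
  unfolding surface_def emeasure_measure_of_conv by auto

text \<open>Covers by grid cells arise in this shape: finitely many sets with a common diameter
  bound \<open>D\<close>, and a total that does not grow as the scale shrinks.\<close>

lemma hausdorff_outer_le:
  fixes A :: "'a::metric_space set"
  assumes "m > 0" "M \<ge> 0"
    and cover: "\<And>\<delta>::real. \<delta> > 0 \<Longrightarrow> \<exists>(I :: 'i set) C D. finite I \<and> A \<subseteq> (\<Union>i\<in>I. C i) \<and> D \<le> \<delta> \<and>
      (\<forall>i\<in>I. bounded (C i) \<and> diameter (C i) \<le> D) \<and>
      real (card I) * (unit_ball_vol (real m) * (D / 2) ^ m) \<le> M"
  shows "hausdorff_outer m A \<le> ennreal M"
  unfolding hausdorff_outer_def
proof (rule SUP_least)
  fix \<delta> :: real assume "\<delta> \<in> {0<..}"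
  then obtain I :: "'i set" and C D where I: "finite I" "A \<subseteq> (\<Union>i\<in>I. C i)" "D \<le> \<delta>"
    "\<And>i. i \<in> I \<Longrightarrow> bounded (C i)" "\<And>i. i \<in> I \<Longrightarrow> diameter (C i) \<le> D"
    "real (card I) * (unit_ball_vol (real m) * (D / 2) ^ m) \<le> M"
    using cover [of \<delta>] by auto
  obtain e where e: "bij_betw e {0..<card I} I"
    using ex_bij_betw_nat_finite [OF I(1)] by blast
  \<comment> \<open>The definition asks for sequences, so empty sets fill up the finite cover. Their
    terms vanish because \<open>m > 0\<close>.\<close>
  define C' where "C' n = (if n < card I then C (e n) else {})" for n
  have eI: "e n \<in> I" if "n < card I" for n
    using bij_betwE [OF e] that by auto
  have C': "A \<subseteq> (\<Union>n. C' n)"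
  proof
    fix x assume "x \<in> A"
    then obtain i where "i \<in> I" "x \<in> C i"
      using I(2) by auto
    moreover then obtain n where "n < card I" "e n = i"
      using e by (metis atLeastLessThan_iff bij_betw_iff_bijections)
    ultimately have "x \<in> C' n"
      by (simp add: C'_def)
    then show "x \<in> (\<Union>n. C' n)"
      by blast
  qed
  have mem: "C' \<in> {C. A \<subseteq> (\<Union>i. C i) \<and> (\<forall>i. bounded (C i) \<and> diameter (C i) \<le> \<delta>)}"
  proof (intro CollectI conjI allI)
    fix i
    show "bounded (C' i)" "diameter (C' i) \<le> \<delta>"
      using I(4) eI order_trans [OF I(5) I(3)] \<open>\<delta> \<in> {0<..}\<close> by (auto simp: C'_def)
  qed (rule C')
  have pos: "0 \<le> diameter (C (e n))" if "n < card I" for n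
    using I(4) eI that by (intro diameter_ge_0) auto
  have "(\<Sum>n. ennreal (unit_ball_vol (real m) * (diameter (C' n) / 2) ^ m))
      = (\<Sum>n<card I. ennreal (unit_ball_vol (real m) * (diameter (C' n) / 2) ^ m))"
    using assms(1) by (intro suminf_finite) (auto simp: C'_def diameter_def)
  also have "\<dots> \<le> (\<Sum>n<card I. ennreal (unit_ball_vol (real m) * (D / 2) ^ m))"
    using I(5) eI pos by (intro sum_mono ennreal_leI mult_left_mono power_mono divide_right_mono)
      (auto simp: C'_def)
  also have "\<dots> = ennreal (real (card I) * (unit_ball_vol (real m) * (D / 2) ^ m))"
  \<comment> \<open>An empty index set would leave the sign of \<open>D\<close> open.\<close>
  proof (cases "card I = 0")
    case False
    then have "0 \<le> D"
      using pos [of 0] I(5) eI [of 0] order_trans by blast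
    then show ?thesis
      by (simp add: ennreal_mult ennreal_of_nat_eq_real_of_nat)
  qed simp
  also have "\<dots> \<le> ennreal M"
    using I(6) by (rule ennreal_leI)
  finally show "(INF C\<in>{C. A \<subseteq> (\<Union>i. C i) \<and> (\<forall>i. bounded (C i) \<and> diameter (C i) \<le> \<delta>)}.
      \<Sum>i. ennreal (unit_ball_vol (real m) * (diameter (C i) / 2) ^ m)) \<le> ennreal M"
    by (rule INF_lower2 [OF mem])
qed

section \<open>Geometry of sets that are star-shaped with respect to a ball\<close>

lemma norm_scaleR_sgn: "norm x *\<^sub>R sgn x = x"
  for x :: "'a::real_normed_vector"
  by (cases "x = 0") (simp_all add: sgn_div_norm)

locale star_shaped_ball =
  fixes U :: "'a::euclidean_space set" and z :: 'a and r :: real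
  assumes op: "open U" and r: "r > 0"
    and star: "\<And>x y. \<lbrakk>x \<in> ball z r; y \<in> U\<rbrakk> \<Longrightarrow> closed_segment x y \<subseteq> U"
    and ball_sub: "ball z r \<subseteq> U"
begin

text \<open>The ball of radius \<open>(1 - t) * r\<close> around
  \<open>z + t *\<^sub>R (x - z)\<close> lies in the cone with apex \<open>x\<close> over the ball
  around \<open>z\<close>. An apex on the boundary is replaced by a nearby point of
  \<open>U\<close>; the strict inequality leaves room for this.\<close>

lemma cone_subset:
  assumes x: "x \<in> closure U" and t: "0 \<le> t" "t < 1"
    and w: "norm (w - z - t *\<^sub>R (x - z)) < (1 - t) * r"
  shows "w \<in> U"
proof -
  obtain x' where x': "x' \<in> U" "dist x' x < (1 - t) * r - norm (w - z - t *\<^sub>R (x - z))"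
    using x w by (metis closure_approachable diff_gt_0_iff_gt)
  \<comment> \<open>Chosen so that \<open>w\<close> is the point with parameter \<open>t\<close> on
    the segment from \<open>b\<close> to \<open>x'\<close>.\<close>
  define b where "b = (1 / (1 - t)) *\<^sub>R (w - t *\<^sub>R x')"
  have b: "(1 - t) *\<^sub>R b = w - t *\<^sub>R x'"
    using t by (simp add: b_def)
  have "(1 - t) *\<^sub>R (b - z) = (w - z - t *\<^sub>R (x - z)) + t *\<^sub>R (x - x')"
    unfolding scaleR_diff_right [of "1 - t"] b by (simp add: algebra_simps)
  then have "(1 - t) * norm (b - z) = norm ((w - z - t *\<^sub>R (x - z)) + t *\<^sub>R (x - x'))"
    using t by (metis abs_of_pos diff_gt_0_iff_gt norm_scaleR)
  also have "\<dots> \<le> norm (w - z - t *\<^sub>R (x - z)) + t * norm (x - x')"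
    using t norm_triangle_ineq [of "w - z - t *\<^sub>R (x - z)" "t *\<^sub>R (x - x')"] by simp
  also have "\<dots> \<le> norm (w - z - t *\<^sub>R (x - z)) + 1 * norm (x - x')"
    using t by (intro add_left_mono mult_right_mono) auto
  also have "\<dots> < (1 - t) * r"
    using x'(2) by (simp add: dist_norm norm_minus_commute)
  finally have "norm (b - z) < r"
    using t by simp
  then have "b \<in> ball z r"
    by (simp add: dist_norm norm_minus_commute)
  then have "closed_segment b x' \<subseteq> U"
    using star x' by blast
  moreover have "w = (1 - t) *\<^sub>R b + t *\<^sub>R x'"
    by (simp add: b)
  then have "w \<in> closed_segment b x'"
    using t by (auto simp: closed_segment_def intro!: exI [of _ t])
  ultimately show ?thesis
    by blast
qed

lemma frontier_dist_centre: "x \<in> frontier U \<Longrightarrow> r \<le> norm (x - z)"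
  using ball_sub op by (force simp: frontier_def interior_open dist_norm norm_minus_commute)

text \<open>The boundary point nearer to \<open>z\<close> is not in \<open>U\<close>, hence not in
  the cone over the farther one. This bounds the variation of the radial distance by that of the
  direction.\<close>

lemma radial_gap:
  assumes x: "x \<in> frontier U" and y: "y \<in> frontier U" and le: "norm (y - z) \<le> norm (x - z)"
  shows "norm (x - z) - norm (y - z)
    \<le> norm (x - z) * norm (y - z) / r * norm (sgn (x - z) - sgn (y - z))"
proof (cases "norm (y - z) = norm (x - z)")
  case True
  then show ?thesis
    using r by simp
next
  case False
  define a b where "a = norm (x - z)" and "b = norm (y - z)"
  have ab: "0 < b" "b < a"
    using frontier_dist_centre [OF y] r le False by (auto simp: a_def b_def)
  have "y \<notin> U"
    using y op by (simp add: frontier_def interior_open)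
  \<comment> \<open>With \<open>t = b / a\<close> the point on the axis of the cone is as far from
    \<open>z\<close> as \<open>y\<close> is, so that their difference is \<open>b\<close> times a
    difference of directions.\<close>
  then have "\<not> norm (y - z - (b / a) *\<^sub>R (x - z)) < (1 - b / a) * r"
    using cone_subset [of x "b / a" y] x ab by (auto simp: frontier_def)
  moreover have "y - z - (b / a) *\<^sub>R (x - z) = b *\<^sub>R (sgn (y - z) - sgn (x - z))"
    using ab by (auto simp: sgn_div_norm a_def b_def algebra_simps divide_inverse)
  ultimately have "(1 - b / a) * r \<le> b * norm (sgn (x - z) - sgn (y - z))"
    using ab by (simp add: norm_minus_commute)
  then have "a * ((1 - b / a) * r) \<le> a * (b * norm (sgn (x - z) - sgn (y - z)))"
    using ab by (intro mult_left_mono) auto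
  moreover have "a * ((1 - b / a) * r) = (a - b) * r"
    using ab by (simp add: field_simps)
  ultimately show ?thesis
    using r by (simp add: field_simps flip: a_def b_def)
qed

text \<open>Splits \<open>x - y\<close> into a radial part, which gives \<open>h * h / r\<close>,
  and a part along a sphere, which gives \<open>h\<close>. The boundary is thus a Lipschitz image of
  its set of directions.\<close>

lemma frontier_dist_le_directions:
  assumes h: "\<And>x. x \<in> frontier U \<Longrightarrow> norm (x - z) \<le> h"
    and x: "x \<in> frontier U" and y: "y \<in> frontier U"
  shows "norm (x - y) \<le> (h * h / r + h) * norm (sgn (x - z) - sgn (y - z))"
proof -
  have *: "norm (x - y) \<le> (h * h / r + h) * norm (sgn (x - z) - sgn (y - z))"
    if x: "x \<in> frontier U" and y: "y \<in> frontier U" and le: "norm (y - z) \<le> norm (x - z)" for x y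
  proof -
    have h0: "0 \<le> h"
      using h [OF x] norm_ge_zero order_trans by blast
    have "x - y = (norm (x - z) - norm (y - z)) *\<^sub>R sgn (x - z)
        + norm (y - z) *\<^sub>R (sgn (x - z) - sgn (y - z))"
      by (simp add: scaleR_diff_left scaleR_diff_right norm_scaleR_sgn)
    then have "norm (x - y) \<le> norm ((norm (x - z) - norm (y - z)) *\<^sub>R sgn (x - z))
        + norm (norm (y - z) *\<^sub>R (sgn (x - z) - sgn (y - z)))"
      by (metis norm_triangle_ineq)
    also have "\<dots> \<le> (norm (x - z) - norm (y - z))
        + norm (y - z) * norm (sgn (x - z) - sgn (y - z))"
      using le by (auto simp: norm_sgn)
    also have "\<dots> \<le> norm (x - z) * norm (y - z) / r * norm (sgn (x - z) - sgn (y - z))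
        + norm (y - z) * norm (sgn (x - z) - sgn (y - z))"
      using radial_gap [OF x y le] by simp
    also have "\<dots> = (norm (x - z) * norm (y - z) / r + norm (y - z))
        * norm (sgn (x - z) - sgn (y - z))"
      by (simp add: algebra_simps)
    also have "\<dots> \<le> (h * h / r + h) * norm (sgn (x - z) - sgn (y - z))"
      using h [OF x] h [OF y] h0 r
      by (intro mult_right_mono add_mono divide_right_mono mult_mono) auto
    finally show ?thesis .
  qed
  show ?thesis
  proof (cases "norm (y - z) \<le> norm (x - z)")
    case False
    then show ?thesis
      using * [OF y x] by (simp add: norm_minus_commute)
  qed (use * x y in auto)
qed

end

text \<open>Points on the surface of the cube \<open>infnorm = 1\<close> have norm at least 1, so
  directions may be compared there, where counting cells is elementary.\<close>

lemma norm_sgn_diff_le: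
  fixes p q :: "'a::real_normed_vector"
  assumes "1 \<le> norm p" "1 \<le> norm q"
  shows "norm (sgn p - sgn q) \<le> 2 * norm (p - q)"
proof -
  have "norm p *\<^sub>R (sgn p - sgn q) = (p - q) + (norm q - norm p) *\<^sub>R sgn q"
    using norm_scaleR_sgn [of p] norm_scaleR_sgn [of q] by (simp add: algebra_simps)
  then have "norm p * norm (sgn p - sgn q) = norm ((p - q) + (norm q - norm p) *\<^sub>R sgn q)"
    by (metis abs_norm_cancel norm_scaleR)
  also have "\<dots> \<le> norm (p - q) + norm ((norm q - norm p) *\<^sub>R sgn q)"
    by (rule norm_triangle_ineq)
  also have "\<dots> \<le> norm (p - q) + norm (p - q)"
    using norm_triangle_ineq3 [of p q] by (simp add: norm_sgn abs_minus_commute)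
  finally have "norm p * norm (sgn p - sgn q) \<le> 2 * norm (p - q)"
    by simp
  moreover have "1 * norm (sgn p - sgn q) \<le> norm p * norm (sgn p - sgn q)"
    using assms by (intro mult_right_mono) auto
  ultimately show ?thesis
    by simp
qed

context star_shaped_ball
begin

text \<open>Directions are parametrised by the surface of the cube \<open>infnorm = 1\<close>, on which cells with
  \<open>m\<close> subdivisions per coordinate give covers with about \<open>m ^ (d - 1)\<close> sets of diameter \<open>O(1 / m)\<close>.\<close>

lemma hausdorff_outer_frontier:
  assumes h: "\<And>x. x \<in> frontier U \<Longrightarrow> norm (x - z) \<le> h" and h0: "0 \<le> h" and "DIM('a) \<ge> 2"
  defines "n \<equiv> DIM('a)" and "L \<equiv> h * h / r + h"
  shows "hausdorff_outer (n - 1) (frontier U)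
    \<le> ennreal (2 * real n * unit_ball_vol (real (n - 1)) * (4 * real n * L) ^ (n - 1))"
proof (rule hausdorff_outer_le)
  have L0: "0 \<le> L"
    using h0 r by (simp add: L_def)
  show "0 < n - 1"
    using assms(3) by (simp add: n_def)
  show "0 \<le> 2 * real n * unit_ball_vol (real (n - 1)) * (4 * real n * L) ^ (n - 1)"
    using L0 by simp
  \<comment> \<open>Central projection of the boundary to the surface of the cube.\<close>
  define q where "q x = (1 / infnorm (x - z)) *\<^sub>R (x - z)" for x
  have pos: "infnorm (x - z) > 0" if "x \<in> frontier U" for x
    using frontier_dist_centre [OF that] r by (auto simp: infnorm_pos_lt)
  have infq: "infnorm (q x) = 1" if "x \<in> frontier U" for x
    using pos [OF that] by (simp add: q_def infnorm_mul)
  have sgnq: "sgn (q x) = sgn (x - z)" if "x \<in> frontier U" for x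
    using pos [OF that] by (simp add: q_def sgn_scaleR)
  have q_le: "\<bar>q x \<bullet> j\<bar> \<le> 1" if "x \<in> frontier U" "j \<in> Basis" for x j
    using Basis_le_infnorm [OF that(2), of "q x"] infq [OF that(1)] by simp
  have q_lip: "norm (x - y) \<le> 2 * L * norm (q x - q y)" if "x \<in> frontier U" "y \<in> frontier U" for x y
  proof -
    have "1 \<le> norm (q x)" "1 \<le> norm (q y)"
      using infq that infnorm_le_norm by metis+
    from norm_sgn_diff_le [OF this]
    have "norm (sgn (x - z) - sgn (y - z)) \<le> 2 * norm (q x - q y)"
      using sgnq that by simp
    then have "L * norm (sgn (x - z) - sgn (y - z)) \<le> L * (2 * norm (q x - q y))"
      using L0 by (intro mult_left_mono)
    moreover have "norm (x - y) \<le> L * norm (sgn (x - z) - sgn (y - z))"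
      unfolding L_def by (rule frontier_dist_le_directions [OF h that])
    moreover have "L * (2 * norm (q x - q y)) = 2 * L * norm (q x - q y)"
      by simp
    ultimately show ?thesis
      by linarith
  qed
  fix \<delta> :: real assume \<delta>: "\<delta> > 0"
  obtain m :: nat where m: "m > 0" "4 * real n * L / real m \<le> \<delta>"
  proof -
    obtain m :: nat where "4 * real n * L / \<delta> < real m"
      using reals_Archimedean2 by blast
    moreover have "0 \<le> 4 * real n * L / \<delta>"
      using L0 \<delta> by simp
    ultimately have "0 < real m" "4 * real n * L < real m * \<delta>"
      using \<delta> by (linarith, simp add: pos_divide_less_eq)
    then show thesis
      by (intro that [of m]) (auto simp: pos_divide_le_eq mult.commute)
  qed
  \<comment> \<open>A face of the cube, given by an axis and a sign, together with a grid cell in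
    it. The cell numbers include \<open>m\<close> because the coordinate value 1 is rounded down to
    \<open>m\<close>.\<close>
  define I where "I = (SIGMA p:(Basis :: 'a set) \<times> {1, -1 :: real}. PiE (Basis - {fst p}) (\<lambda>_. {..m}))"
  define C where "C = (\<lambda>((i, s), c). {x \<in> frontier U. q x \<bullet> i = s \<and>
      (\<forall>j\<in>Basis - {i}. real (c j) \<le> (q x \<bullet> j + 1) / 2 * m \<and> (q x \<bullet> j + 1) / 2 * m \<le> real (c j) + 1)})"
  \<comment> \<open>Projections of two points of one cell differ by at most \<open>2 / m\<close> in
    each coordinate, thus by \<open>2 * n / m\<close> in norm; \<open>2 * L\<close> is the Lipschitz
    constant \<open>q_lip\<close>.\<close>
  define D where "D = 4 * real n * L / real m"
  have "finite I"
    unfolding I_def by (intro finite_SigmaI finite_PiE) auto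
  have cardI: "card I = 2 * n * (m + 1) ^ (n - 1)"
  proof -
    have "card I = (\<Sum>p\<in>(Basis :: 'a set) \<times> {1, -1 :: real}. card (PiE (Basis - {fst p}) (\<lambda>_. {..m})))"
      unfolding I_def by (intro card_SigmaI) (auto intro: finite_PiE)
    also have "\<dots> = (\<Sum>p\<in>(Basis :: 'a set) \<times> {1, -1 :: real}. (m + 1) ^ (n - 1))"
      by (intro sum.cong) (auto simp: card_PiE n_def card_Diff_singleton)
    also have "\<dots> = 2 * n * (m + 1) ^ (n - 1)"
      by (simp add: card_cartesian_product n_def)
    finally show ?thesis .
  qed
  have cover: "frontier U \<subseteq> (\<Union>i\<in>I. C i)"
  proof
    fix x assume x: "x \<in> frontier U"
    obtain i where i: "i \<in> Basis" "\<bar>q x \<bullet> i\<bar> = 1"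
      using infnorm_Max [of "q x"] infq [OF x] Max_in [of "(\<lambda>i. \<bar>q x \<bullet> i\<bar>) ` Basis"] by auto
    define c where "c = restrict (\<lambda>j. nat \<lfloor>(q x \<bullet> j + 1) / 2 * m\<rfloor>) (Basis - {i})"
    have c: "real (nat \<lfloor>(q x \<bullet> j + 1) / 2 * m\<rfloor>) \<le> (q x \<bullet> j + 1) / 2 * m"
      "(q x \<bullet> j + 1) / 2 * m \<le> real (nat \<lfloor>(q x \<bullet> j + 1) / 2 * m\<rfloor>) + 1"
      "nat \<lfloor>(q x \<bullet> j + 1) / 2 * m\<rfloor> \<le> m" if "j \<in> Basis" for j
    proof -
      have b: "-1 \<le> q x \<bullet> j" "q x \<bullet> j \<le> 1"
        using q_le [OF x that] by auto
      then have "0 \<le> (q x \<bullet> j + 1) / 2 * m"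
        by simp
      then show "real (nat \<lfloor>(q x \<bullet> j + 1) / 2 * m\<rfloor>) \<le> (q x \<bullet> j + 1) / 2 * m"
        "(q x \<bullet> j + 1) / 2 * m \<le> real (nat \<lfloor>(q x \<bullet> j + 1) / 2 * m\<rfloor>) + 1"
        by linarith+
      have "(q x \<bullet> j + 1) / 2 * m \<le> 1 * real m"
        using b by (intro mult_right_mono) auto
      then show "nat \<lfloor>(q x \<bullet> j + 1) / 2 * m\<rfloor> \<le> m"
        by linarith
    qed
    have "((i, q x \<bullet> i), c) \<in> I"
      using i c by (auto simp: I_def c_def abs_if split: if_splits)
    moreover have "x \<in> C ((i, q x \<bullet> i), c)"
      using x c by (auto simp: C_def c_def)
    ultimately show "x \<in> (\<Union>i\<in>I. C i)"
      by blast
  qed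
  have dist_C: "norm (x - y) \<le> D" if "k \<in> I" "x \<in> C k" "y \<in> C k" for k x y
  proof -
    obtain i s c where k: "k = ((i, s), c)"
      by (metis prod.exhaust)
    have xy: "x \<in> frontier U" "y \<in> frontier U"
      using that by (auto simp: C_def k)
    have comp: "\<bar>(q x - q y) \<bullet> j\<bar> \<le> 2 / m" if j: "j \<in> Basis" for j
    proof (cases "j = i")
      case True
      then show ?thesis
        using \<open>x \<in> C k\<close> \<open>y \<in> C k\<close> by (auto simp: C_def k inner_diff_left)
    next
      case False
      then have "real (c j) \<le> (q x \<bullet> j + 1) / 2 * m" "(q x \<bullet> j + 1) / 2 * m \<le> real (c j) + 1"
        "real (c j) \<le> (q y \<bullet> j + 1) / 2 * m" "(q y \<bullet> j + 1) / 2 * m \<le> real (c j) + 1"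
        using \<open>x \<in> C k\<close> \<open>y \<in> C k\<close> j by (auto simp: C_def k)
      then have "\<bar>(q x \<bullet> j + 1) / 2 * m - (q y \<bullet> j + 1) / 2 * m\<bar> \<le> 1"
        by linarith
      moreover have "(q x \<bullet> j + 1) / 2 * m - (q y \<bullet> j + 1) / 2 * m = ((q x - q y) \<bullet> j) * m / 2"
        by (simp add: inner_diff_left field_simps)
      ultimately have "\<bar>(q x - q y) \<bullet> j\<bar> * m \<le> 2"
        by (simp add: abs_mult)
      then show ?thesis
        using m by (simp add: field_simps)
    qed
    have "norm (q x - q y) \<le> (\<Sum>j\<in>Basis. \<bar>(q x - q y) \<bullet> j\<bar>)"
      by (rule norm_le_l1)
    also have "\<dots> \<le> (\<Sum>j\<in>(Basis :: 'a set). 2 / m)"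
      by (intro sum_mono comp)
    finally have "norm (q x - q y) \<le> 2 * n / m"
      by (simp add: n_def field_simps)
    then have "2 * L * norm (q x - q y) \<le> 2 * L * (2 * n / m)"
      using L0 by (intro mult_left_mono) auto
    also have "\<dots> = D"
      by (simp add: D_def)
    finally show ?thesis
      using q_lip [OF xy] by linarith
  qed
  have D0: "0 \<le> D"
    using L0 by (simp add: D_def)
  have bdd: "bounded (C k) \<and> diameter (C k) \<le> D" if "k \<in> I" for k
  proof
    show "bounded (C k)"
      using dist_C [OF that] by (auto simp: bounded_def dist_norm) blast
    show "diameter (C k) \<le> D"
      using dist_C [OF that] D0 by (intro diameter_le) auto
  qed
  \<comment> \<open>The number of cells grows like \<open>(m + 1) ^ (n - 1)\<close> while
    \<open>D\<close> decays like \<open>1 / m\<close>; the inequality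
    \<open>m + 1 \<le> 2 * m\<close> bounds the product independently of \<open>m\<close>.\<close>
  have "real (card I) * (unit_ball_vol (real (n - 1)) * (D / 2) ^ (n - 1))
      = 2 * n * unit_ball_vol (real (n - 1)) * (((1 + m) * (D / 2)) ^ (n - 1))"
    unfolding power_mult_distrib cardI by (simp add: add.commute)
  also have "\<dots> \<le> 2 * n * unit_ball_vol (real (n - 1)) * (4 * real n * L) ^ (n - 1)"
  proof (intro mult_left_mono power_mono)
    have "(1 + m) * (D / 2) \<le> (2 * m) * (D / 2)"
      using m D0 by (intro mult_right_mono) auto
    also have "\<dots> = 4 * real n * L"
      using m by (simp add: D_def)
    finally show "real (1 + m) * (D / 2) \<le> 4 * real n * L"
      by simp
  qed (use D0 in auto)
  finally show "\<exists>(I :: (('a \<times> real) \<times> ('a \<Rightarrow> nat)) set) C D. finite I \<and> frontier U \<subseteq> (\<Union>i\<in>I. C i) \<and> D \<le> \<delta> \<and>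
      (\<forall>i\<in>I. bounded (C i) \<and> diameter (C i) \<le> D) \<and>
      real (card I) * (unit_ball_vol (real (n - 1)) * (D / 2) ^ (n - 1))
        \<le> 2 * real n * unit_ball_vol (real (n - 1)) * (4 * real n * L) ^ (n - 1)"
    using \<open>finite I\<close> cover bdd m by (intro exI [of _ I] exI [of _ C] exI [of _ D]) (auto simp: D_def)
qed

end

section \<open>Elements as unions of star-shaped pieces\<close>

lemma domain_diameter_pos:
  assumes "domain (T :: 'a::euclidean_space set)" "bounded T"
  shows "diameter T > 0"
proof -
  obtain z e where z: "e > 0" "ball z e \<subseteq> T"
    using assms(1) open_contains_ball unfolding domain_def by blast
  obtain b :: 'a where b: "b \<in> Basis"
    using nonempty_Basis by blast
  have "z \<in> T" "z + (e / 2) *\<^sub>R b \<in> T"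
    using z b by (auto intro!: subsetD [OF z(2)] simp: dist_norm)
  from diameter_bounded_bound [OF assms(2) this] show ?thesis
    using z b by (simp add: dist_norm)
qed

text \<open>The boundary of a finite union of open sets is covered by their boundaries. Each of the
  at most \<open>1 / \<rho>\<close> pieces is star-shaped with respect to a ball of radius
  \<open>\<rho> * h\<close>, for which the Lipschitz constant \<open>h * h / r + h\<close> is the
  multiple \<open>1 / \<rho> + 1\<close> of \<open>h\<close>.\<close>

lemma connected_by_star_shaped_frontier:
  fixes T :: "'a::euclidean_space set"
  assumes T: "domain T" "bounded T" and conn: "connected_by_star_shaped \<rho> T" and "\<rho> > 0"
    and "DIM('a) \<ge> 2"
  defines "n \<equiv> DIM('a)"
  shows "\<exists>z. ball z (\<rho> * diameter T) \<subseteq> T"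
    and "emeasure surface (frontier T) \<le> ennreal (2 * real n * unit_ball_vol (real (n - 1)) / \<rho>
           * (4 * real n * (1 / \<rho> + 1)) ^ (n - 1) * diameter T ^ (n - 1))"
proof -
  define h where "h = diameter T"
  have h: "h > 0"
    unfolding h_def by (rule domain_diameter_pos [OF T])
  obtain N U where NU: "real N \<le> 1 / \<rho>" "T = (\<Union>i\<in>{1..N}. U i)"
      "\<forall>i\<in>{1..N}. open (U i) \<and> star_shaped_wrt_ball (U i) (\<rho> * h)"
    using conn unfolding connected_by_star_shaped_def h_def by blast
  have "\<exists>z. star_shaped_ball (U i) z (\<rho> * h)" if "i \<in> {1..N}" for i
    using NU(3) that h \<open>\<rho> > 0\<close>
    unfolding star_shaped_wrt_ball_def star_shaped_ball_def by (meson mult_pos_pos subsetI)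
  then obtain z where z: "\<And>i. i \<in> {1..N} \<Longrightarrow> star_shaped_ball (U i) (z i) (\<rho> * h)"
    by metis
  have "T \<noteq> {}"
    using T by (simp add: domain_def)
  then obtain i where "i \<in> {1..N}"
    using NU(2) by blast
  then have "ball (z i) (\<rho> * h) \<subseteq> T"
    using star_shaped_ball.ball_sub [OF z] NU(2) by blast
  then show "\<exists>z. ball z (\<rho> * diameter T) \<subseteq> T"
    unfolding h_def by blast
  define M where "M = 2 * real n * unit_ball_vol (real (n - 1)) * (4 * real n * (h * h / (\<rho> * h) + h)) ^ (n - 1)"
  have M0: "0 \<le> M"
    unfolding M_def using h \<open>\<rho> > 0\<close> by (intro mult_nonneg_nonneg) auto
  have front: "emeasure surface (frontier (U i)) \<le> ennreal M" if i: "i \<in> {1..N}" for i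
  proof -
    interpret star_shaped_ball "U i" "z i" "\<rho> * h"
      by (rule z [OF i])
    \<comment> \<open>The centre and the boundary of the piece both lie in the closure of
      \<open>T\<close>, whose diameter is \<open>h\<close>.\<close>
    have "norm (x - z i) \<le> h" if "x \<in> frontier (U i)" for x
    proof -
      have "z i \<in> U i"
        using ball_sub r by auto
      moreover have "U i \<subseteq> T"
        using NU(2) i by blast
      ultimately have "x \<in> closure T" "z i \<in> closure T"
        using that closure_mono [of "U i" T] closure_subset [of T] by (auto simp: frontier_def)
      then show ?thesis
        using diameter_bounded_bound [of "closure T" x "z i"] T(2)
        by (simp add: h_def dist_norm diameter_closure bounded_closure)
    qed
    from hausdorff_outer_frontier [OF this] h assms(5)
    show ?thesis
      unfolding M_def n_def using emeasure_surface_le [of "frontier (U i)"] order_trans by auto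
  qed
  have "frontier T \<subseteq> (\<Union>i\<in>{1..N}. frontier (U i))"
  proof
    fix x assume x: "x \<in> frontier T"
    have "open T"
      using T by (simp add: domain_def)
    then have "x \<notin> T" "x \<in> closure T"
      using x by (auto simp: frontier_def interior_open)
    moreover have "closure T = (\<Union>i\<in>{1..N}. closure (U i))"
      unfolding NU(2) by (induction N) (auto simp: atLeastAtMostSuc_conv)
    ultimately show "x \<in> (\<Union>i\<in>{1..N}. frontier (U i))"
      using NU(2,3) by (auto simp: frontier_def interior_open)
  qed
  then have "emeasure surface (frontier T) \<le> emeasure surface (\<Union>i\<in>{1..N}. frontier (U i))"
    by (intro emeasure_mono) (auto intro!: borel_closed closed_UN)
  also have "\<dots> \<le> (\<Sum>i\<in>{1..N}. emeasure surface (frontier (U i)))"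
    by (intro emeasure_subadditive_finite) (auto intro!: borel_closed)
  also have "\<dots> \<le> (\<Sum>i\<in>{1..N}. ennreal M)"
    by (intro sum_mono front)
  also have "\<dots> = ennreal (N * M)"
    using M0 by (simp add: ennreal_mult ennreal_of_nat_eq_real_of_nat)
  also have "\<dots> \<le> ennreal (1 / \<rho> * M)"
    using NU(1) M0 by (intro ennreal_leI mult_right_mono)
  also have "1 / \<rho> * M = 2 * real n * unit_ball_vol (real (n - 1)) / \<rho>
           * (4 * real n * (1 / \<rho> + 1)) ^ (n - 1) * h ^ (n - 1)"
  proof -
    have eq: "4 * real n * (h * h / (\<rho> * h) + h) = 4 * real n * (1 / \<rho> + 1) * h"
      using h \<open>\<rho> > 0\<close> by (simp add: field_simps)
    then show ?thesis
      unfolding M_def eq power_mult_distrib [of _ h] by simp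
  qed
  finally show "emeasure surface (frontier T) \<le> ennreal (2 * real n * unit_ball_vol (real (n - 1)) / \<rho>
           * (4 * real n * (1 / \<rho> + 1)) ^ (n - 1) * diameter T ^ (n - 1))"
    unfolding h_def .
qed

section \<open>Bounded measurable functions\<close>

text \<open>Conditions are imposed on \<open>X\<close> only, through the indicator, as face
  functions are arbitrary elsewhere. Boundedness makes the set closed under products.\<close>

definition bdd_measurable :: "'a measure \<Rightarrow> 'a set \<Rightarrow> ('a \<Rightarrow> real) set" where
  "bdd_measurable M X = {f. set_borel_measurable M X f \<and> bounded (f ` X)}"

lemma bdd_measurable_integrable:
  assumes "f \<in> bdd_measurable M X" "X \<in> sets M" "emeasure M X < \<infinity>"
  shows "set_integrable M X f"
proof -
  obtain B where B: "\<And>x. x \<in> X \<Longrightarrow> norm (f x) \<le> B"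
    using assms(1) by (auto simp: bdd_measurable_def bounded_iff)
  show ?thesis
    unfolding set_integrable_def
  proof (rule Bochner_Integration.integrable_bound)
    show "integrable M (\<lambda>x. B * indicator X x)"
      using assms by (intro integrable_mult_right integrable_real_indicator) auto
    show "(\<lambda>x. indicator X x *\<^sub>R f x) \<in> borel_measurable M"
      using assms(1) by (simp add: bdd_measurable_def set_borel_measurable_def)
    show "AE x in M. norm (indicator X x *\<^sub>R f x) \<le> norm (B * indicator X x)"
      using order_trans [OF B abs_ge_self] by (intro AE_I2) (auto simp: indicator_def)
  qed
qed

lemma bdd_measurable_const: "X \<in> sets M \<Longrightarrow> (\<lambda>x. c) \<in> bdd_measurable M X"
  by (auto simp: bdd_measurable_def set_borel_measurable_def bounded_iff)

lemma bdd_measurable_mult: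
  assumes "f \<in> bdd_measurable M X" "g \<in> bdd_measurable M X"
  shows "(\<lambda>x. f x * g x) \<in> bdd_measurable M X"
proof -
  have "(\<lambda>x. (indicator X x *\<^sub>R f x) * (indicator X x *\<^sub>R g x)) \<in> borel_measurable M"
    using assms by (intro borel_measurable_times) (auto simp: bdd_measurable_def set_borel_measurable_def)
  moreover have "(\<lambda>x. (indicator X x *\<^sub>R f x) * (indicator X x *\<^sub>R g x))
      = (\<lambda>x. indicator X x *\<^sub>R (f x * g x))"
    by (auto simp: indicator_def)
  moreover obtain B C where B: "\<And>x. x \<in> X \<Longrightarrow> norm (f x) \<le> B" and C: "\<And>x. x \<in> X \<Longrightarrow> norm (g x) \<le> C"
    using assms by (auto simp: bdd_measurable_def bounded_iff)
  have "norm (f x * g x) \<le> B * C" if "x \<in> X" for x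
    using B [OF that] C [OF that] norm_ge_zero [of "f x"] norm_ge_zero [of "g x"]
    by (simp only: norm_mult) (intro mult_mono, auto)
  ultimately show ?thesis
    by (auto simp: bdd_measurable_def set_borel_measurable_def bounded_iff)
qed

lemma bdd_measurable_add:
  assumes "f \<in> bdd_measurable M X" "g \<in> bdd_measurable M X"
  shows "(\<lambda>x. f x + g x) \<in> bdd_measurable M X"
proof -
  have "(\<lambda>x. (indicator X x *\<^sub>R f x) + (indicator X x *\<^sub>R g x)) \<in> borel_measurable M"
    using assms by (intro borel_measurable_add) (auto simp: bdd_measurable_def set_borel_measurable_def)
  then show ?thesis
    using assms bounded_plus_comp [of f X g]
    by (auto simp: bdd_measurable_def set_borel_measurable_def distrib_left)
qed

lemma bdd_measurable_scale:
  "\<lbrakk>f \<in> bdd_measurable M X; X \<in> sets M\<rbrakk> \<Longrightarrow> (\<lambda>x. c * f x) \<in> bdd_measurable M X"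
  by (intro bdd_measurable_mult bdd_measurable_const)

lemma bdd_measurable_diff:
  "\<lbrakk>f \<in> bdd_measurable M X; g \<in> bdd_measurable M X; X \<in> sets M\<rbrakk> \<Longrightarrow> (\<lambda>x. f x - g x) \<in> bdd_measurable M X"
  using bdd_measurable_add [of f M X "\<lambda>x. (-1) * g x"] bdd_measurable_scale [of g M X "-1"] by simp

lemma bdd_measurable_sum:
  "\<lbrakk>\<And>i. i \<in> I \<Longrightarrow> f i \<in> bdd_measurable M X; X \<in> sets M\<rbrakk> \<Longrightarrow> (\<lambda>x. \<Sum>i\<in>I. f i x) \<in> bdd_measurable M X"
  by (induction I rule: infinite_finite_induct) (auto intro: bdd_measurable_const bdd_measurable_add)

lemma bdd_measurable_continuous:
  fixes f :: "'a::euclidean_space \<Rightarrow> real"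
  assumes "continuous_on X f" "bounded (f ` X)" "X \<in> sets borel" "sets M = sets borel"
  shows "f \<in> bdd_measurable M X"
  using assms borel_measurable_continuous_on_indicator [of X f]
  by (simp add: bdd_measurable_def set_borel_measurable_def measurable_cong_sets [OF assms(4) refl])

lemma bdd_measurable_continuous_UNIV:
  fixes f :: "'a::euclidean_space \<Rightarrow> real"
  assumes "continuous_on UNIV f" "bounded X" "X \<in> sets borel" "sets M = sets borel"
  shows "f \<in> bdd_measurable M X"
proof (rule bdd_measurable_continuous)
  have "bounded (f ` closure X)"
    using assms(1,2) by (intro compact_imp_bounded compact_continuous_image)
      (auto intro: continuous_on_subset simp: compact_closure)
  then show "bounded (f ` X)"
    by (rule bounded_subset) (auto intro: closure_subset [THEN subsetD])
qed (use assms in \<open>auto intro: continuous_on_subset\<close>)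

lemma subspace_bdd_measurable: "X \<in> sets M \<Longrightarrow> subspace (bdd_measurable M X)"
  unfolding subspace_def
  by (simp add: zero_fun_def plus_fun_def scaleR_fun_def
      bdd_measurable_const bdd_measurable_add bdd_measurable_scale)

lemma l2_inner_semi_inner_product:
  assumes "X \<in> sets M" "emeasure M X < \<infinity>"
  shows "semi_inner_product (bdd_measurable M X) (l2_inner M X)"
proof -
  have int: "set_integrable M X (\<lambda>x. f x * g x)"
    if "f \<in> bdd_measurable M X" "g \<in> bdd_measurable M X" for f g
    by (intro bdd_measurable_integrable bdd_measurable_mult that assms)
  show ?thesis
  proof
    show "subspace (bdd_measurable M X)"
      by (rule subspace_bdd_measurable [OF assms(1)])
    show "l2_inner M X (f + g) u = l2_inner M X f u + l2_inner M X g u"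
      if "f \<in> bdd_measurable M X" "g \<in> bdd_measurable M X" "u \<in> bdd_measurable M X" for f g u
      using set_integral_add(2) [OF int [of f u] int [of g u]] that
      by (simp add: l2_inner_def distrib_right)
    show "l2_inner M X (c *\<^sub>R f) u = c * l2_inner M X f u" for c f u
      by (simp add: l2_inner_def mult.assoc)
    show "l2_inner M X f u = l2_inner M X u f" for f u
      by (simp add: l2_inner_def inner_commute)
    show "0 \<le> l2_inner M X f f" for f
      unfolding l2_inner_def set_lebesgue_integral_def
      by (rule Bochner_Integration.integral_nonneg) (simp add: indicator_def)
  qed
qed

lemma l2_inner_mono_set:
  assumes "X \<subseteq> Y" "X \<in> sets M" "Y \<in> sets M" "emeasure M Y < \<infinity>" "f \<in> bdd_measurable M Y"
  shows "l2_inner M X f f \<le> l2_inner M Y f f"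
proof -
  have "set_integrable M Y (\<lambda>x. f x * f x)"
    by (intro bdd_measurable_integrable bdd_measurable_mult assms)
  moreover from this have "set_integrable M X (\<lambda>x. f x * f x)"
    by (rule set_integrable_subset) (use assms in auto)
  ultimately show ?thesis
    using assms(1) unfolding l2_inner_def set_lebesgue_integral_def set_integrable_def inner_real_def
    by (intro integral_mono) (auto simp: indicator_def)
qed

text \<open>A closed set containing almost every point of an open set contains all of it; here the
  closed set is the zero set of \<open>f\<close>.\<close>

lemma set_integral_continuous_zero:
  fixes f :: "'a::euclidean_space \<Rightarrow> real"
  assumes "continuous_on UNIV f" "open A" "bounded A" "\<And>x. 0 \<le> f x"
    and "(LINT x:A|lborel. f x) = 0" "x \<in> A"
  shows "f x = 0"
proof -
  have "set_integrable lborel A f"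
    using assms by (intro bdd_measurable_integrable bdd_measurable_continuous_UNIV emeasure_bounded_finite) auto
  then have "AE x in lborel. indicator A x *\<^sub>R f x = 0"
    using assms(4,5) unfolding set_integrable_def set_lebesgue_integral_def
    by (subst integral_nonneg_eq_0_iff_AE [symmetric]) auto
  then have "AE x\<in>A in lebesgue. x \<in> {x. f x = 0}"
    by (intro AE_completion) (auto simp: indicator_def elim!: eventually_mono)
  moreover have "closed {x. f x = 0}"
    using continuous_closed_preimage_constant [OF assms(1) closed_UNIV, of 0] by simp
  ultimately show ?thesis
    using mem_closed_if_AE_lebesgue_open [OF assms(2)] assms(6) by blast
qed


lemma Poly_bdd_measurable:
  "\<lbrakk>p \<in> Poly l; bounded X; X \<in> sets borel; sets M = sets borel\<rbrakk> \<Longrightarrow> p \<in> bdd_measurable M X"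
  by (intro bdd_measurable_continuous_UNIV continuous_on_Poly)

section \<open>Normals and faces\<close>

lemma C1_submersion_continuous:
  assumes "C1_submersion U \<phi> g"
  shows "open U" "continuous_on U \<phi>" "continuous_on U g"
  using assms unfolding C1_submersion_def
  by (auto intro!: continuous_at_imp_continuous_on intro: has_derivative_continuous)

text \<open>The directional derivative is negative, so the ray enters the sublevel set at once. As
  an eventual property, this can be combined for two descriptions of the same boundary.\<close>

lemma C1_submersion_decrease:
  assumes "C1_submersion U \<phi> g" "x \<in> U" "g x \<bullet> v < 0"
  shows "eventually (\<lambda>t. x + t *\<^sub>R v \<in> U \<and> \<phi> (x + t *\<^sub>R v) < \<phi> x) (at_right 0)"
proof (rule eventually_conj)
  have "((\<lambda>t. x + t *\<^sub>R v) \<longlongrightarrow> x + 0 *\<^sub>R v) (at_right 0)"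
    by (intro tendsto_intros)
  then show "eventually (\<lambda>t. x + t *\<^sub>R v \<in> U) (at_right 0)"
    using assms C1_submersion_continuous(1) by (auto elim!: topological_tendstoD)
  have "(\<phi> has_derivative (\<lambda>w. g x \<bullet> w)) (at (x + 0 *\<^sub>R v))"
    using assms by (simp add: C1_submersion_def)
  moreover have "((\<lambda>t. x + t *\<^sub>R v) has_derivative (\<lambda>t. t *\<^sub>R v)) (at 0)"
    by (auto intro!: derivative_eq_intros)
  ultimately have "((\<lambda>t. \<phi> (x + t *\<^sub>R v)) has_derivative (\<lambda>t. g x \<bullet> (t *\<^sub>R v))) (at 0)"
    by (rule has_derivative_compose [rotated])
  then have "((\<lambda>t. \<phi> (x + t *\<^sub>R v)) has_real_derivative (g x \<bullet> v)) (at 0)"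
    by (simp add: has_field_derivative_def mult_commute_abs)
  from DERIV_neg_dec_right [OF this assms(3)]
  obtain d where d: "d > 0" "\<And>t. \<lbrakk>0 < t; t < d\<rbrakk> \<Longrightarrow> \<phi> (x + t *\<^sub>R v) < \<phi> x"
    by auto
  then show "eventually (\<lambda>t. \<phi> (x + t *\<^sub>R v) < \<phi> x) (at_right 0)"
    unfolding eventually_at_right_field by blast
qed

lemma outer_normal_at_unique:
  assumes "outer_normal_at T x n" "outer_normal_at T x n'"
  shows "n = n'"
proof -
  obtain U \<phi> g where 1: "C1_submersion U \<phi> g" "x \<in> U" "\<phi> x = 0" "T \<inter> U = {y\<in>U. \<phi> y < 0}" "n = sgn (g x)"
    using assms(1) unfolding outer_normal_at_def by blast
  obtain U' \<phi>' g' where 2: "C1_submersion U' \<phi>' g'" "x \<in> U'" "\<phi>' x = 0" "T \<inter> U' = {y\<in>U'. \<phi>' y < 0}" "n' = sgn (g' x)"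
    using assms(2) unfolding outer_normal_at_def by blast
  have nz: "g x \<noteq> 0" "g' x \<noteq> 0"
    using 1 2 by (auto simp: C1_submersion_def)
  \<comment> \<open>The sign change turns leaving \<open>T\<close> into a decrease.\<close>
  have neg: "C1_submersion U' (\<lambda>y. - \<phi>' y) (\<lambda>y. - g' y)"
    using 2(1) by (auto simp: C1_submersion_def intro!: continuous_intros derivative_eq_intros)
  show ?thesis
  proof (rule ccontr)
    assume "n \<noteq> n'"
    \<comment> \<open>This direction makes an obtuse angle with \<open>n\<close> and an acute one
      with \<open>n'\<close>: by the first description the ray enters \<open>T\<close>, by the
      second it leaves \<open>T\<close>.\<close>
    define v where "v = n' - n"
    have unit: "norm n = 1" "norm n' = 1"
      using nz 1 2 by (auto simp: norm_sgn)
    have "n \<bullet> n' < 1"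
    proof -
      have "0 < (n - n') \<bullet> (n - n')"
        using \<open>n \<noteq> n'\<close> by simp
      also have "\<dots> = 2 - 2 * (n \<bullet> n')"
        using unit unfolding norm_eq_1 by (simp add: inner_diff_left inner_diff_right inner_commute)
      finally show ?thesis
        by simp
    qed
    then have "n \<bullet> v < 0" "n' \<bullet> v > 0"
      using unit by (auto simp: v_def inner_diff_right dot_square_norm inner_commute)
    moreover have "g x = norm (g x) *\<^sub>R n" "g' x = norm (g' x) *\<^sub>R n'"
      by (simp_all add: 1 2 norm_scaleR_sgn)
    ultimately have v: "g x \<bullet> v < 0" "- g' x \<bullet> v < 0"
      using nz by (metis inner_scaleR_left mult_pos_neg zero_less_norm_iff,
          metis inner_minus_left inner_scaleR_left mult_pos_pos neg_less_0_iff_less zero_less_norm_iff)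
    have "eventually (\<lambda>t. False) (at_right (0::real))"
      using C1_submersion_decrease [OF 1(1,2) v(1)] C1_submersion_decrease [OF neg 2(2) v(2)]
    proof eventually_elim
      case (elim t)
      then have "x + t *\<^sub>R v \<in> T \<inter> U'"
        using 1(3,4) by auto
      then show ?case
        using 2(3,4) elim by auto
    qed
    then show False
      by simp
  qed
qed

lemma outer_normal_eq: "outer_normal_at T x n \<Longrightarrow> outer_normal T x = n"
  unfolding outer_normal_def using outer_normal_at_unique by blast

lemma norm_outer_normal_at: "outer_normal_at T x n \<Longrightarrow> norm n = 1"
  by (auto simp: outer_normal_at_def C1_submersion_def norm_sgn)

text \<open>One local description serves at all boundary points near \<open>x\<close>, since its
  defining function vanishes there. Hence the normal is continuous along the boundary where it
  exists, which gives measurability below.\<close>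

lemma outer_normal_eq_near:
  assumes "open T" "outer_normal_at T x n"
  obtains U g where "open U" "x \<in> U" "continuous_on U g"
    "\<And>y. y \<in> U \<inter> frontier T \<Longrightarrow> outer_normal_at T y (g y)"
proof -
  obtain U \<phi> g where 1: "C1_submersion U \<phi> g" "x \<in> U" "\<phi> x = 0" "T \<inter> U = {y\<in>U. \<phi> y < 0}" "n = sgn (g x)"
    using assms(2) unfolding outer_normal_at_def by blast
  note c = C1_submersion_continuous [OF 1(1)]
  have "outer_normal_at T y (sgn (g y))" if y: "y \<in> U \<inter> frontier T" for y
  proof -
    have "y \<notin> T" "y \<in> closure T"
      using y assms(1) by (auto simp: frontier_def interior_open)
    then have "\<phi> y \<ge> 0"
      using 1(4) y by force
    moreover have "\<not> \<phi> y > 0"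
    proof
      assume "\<phi> y > 0"
      have "open (U \<inter> \<phi> -` {0<..})"
        by (rule continuous_open_preimage [OF c(2,1)]) simp
      then have "(U \<inter> \<phi> -` {0<..}) \<inter> T \<noteq> {}"
        using \<open>y \<in> closure T\<close> \<open>\<phi> y > 0\<close> y by (subst (asm) closure_iff_nhds_not_empty) blast
      then show False
        using 1(4) by force
    qed
    ultimately have "\<phi> y = 0"
      by simp
    then show ?thesis
      using 1 y unfolding outer_normal_at_def by blast
  qed
  moreover have "continuous_on U (\<lambda>y. sgn (g y))"
    using 1(1) by (intro continuous_on_sgn c(3)) (auto simp: C1_submersion_def)
  ultimately show thesis
    using c(1) 1(2) by (intro that [of U "\<lambda>y. sgn (g y)"])
qed

text \<open>Where there is no outer normal, \<open>outer_normal\<close> takes the same junk value everywhere.\<close>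

lemma outer_normal_measurable_bounded:
  fixes T :: "'a::euclidean_space set"
  assumes "open T" "X \<subseteq> frontier T" "X \<in> sets borel"
  shows "(\<lambda>x. outer_normal T x \<bullet> b) \<in> bdd_measurable surface X"
proof -
  define G where "G = {x. \<exists>n. outer_normal_at T x n}"
  define c :: 'a where "c = (THE n. False)"
  have off: "outer_normal T x = c" if "x \<notin> G" for x
    using that by (simp add: G_def outer_normal_def c_def)
  have "\<exists>U. open U \<and> x \<in> U \<and> U \<inter> frontier T \<subseteq> G \<and> continuous_on (U \<inter> frontier T) (outer_normal T)"
    if "x \<in> G" for x
  proof -
    obtain n where "outer_normal_at T x n"
      using \<open>x \<in> G\<close> by (auto simp: G_def)
    from outer_normal_eq_near [OF assms(1) this] obtain U g where U: "open U" "x \<in> U" "continuous_on U g"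
      and g: "\<And>y. y \<in> U \<inter> frontier T \<Longrightarrow> outer_normal_at T y (g y)"
      by metis
    have "continuous_on (U \<inter> frontier T) g"
      using U(3) by (rule continuous_on_subset) auto
    then have "continuous_on (U \<inter> frontier T) (outer_normal T)"
      by (rule continuous_on_eq) (simp add: outer_normal_eq [OF g])
    then show ?thesis
      using U g by (intro exI [of _ U]) (auto simp: G_def)
  qed
  then obtain W where W: "\<And>x. x \<in> G \<Longrightarrow> open (W x) \<and> x \<in> W x \<and> W x \<inter> frontier T \<subseteq> G \<and>
      continuous_on (W x \<inter> frontier T) (outer_normal T)"
    by metis
  \<comment> \<open>The points with a normal are relatively open in the boundary. This splits
    \<open>X\<close> into two Borel parts, with a continuous normal on one and the constant
    \<open>c\<close> on the other.\<close>
  define V where "V = \<Union>(W ` G)"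
  have V: "open V" "V \<inter> frontier T = G \<inter> frontier T"
    using W by (auto simp: V_def)
  have "continuous_on (V \<inter> frontier T) (outer_normal T)"
    unfolding continuous_on_eq_continuous_within
  proof
    fix x assume x: "x \<in> V \<inter> frontier T"
    then obtain y where y: "y \<in> G" "x \<in> W y"
      by (auto simp: V_def)
    then have "continuous (at x within W y \<inter> frontier T) (outer_normal T)"
      using W x by (auto simp: continuous_on_eq_continuous_within)
    moreover have "at x within W y \<inter> frontier T = at x within V \<inter> frontier T"
      using W y by (intro at_within_nhd [of _ "W y"]) (auto simp: V_def)
    ultimately show "continuous (at x within V \<inter> frontier T) (outer_normal T)"
      by simp
  qed
  then have "continuous_on (V \<inter> X) (\<lambda>x. outer_normal T x \<bullet> b)"
    using assms(2) by (intro continuous_on_inner continuous_on_const) (auto intro: continuous_on_subset)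
  moreover have "V \<inter> X \<in> sets borel"
    using V(1) assms(3) by auto
  ultimately have 1: "(\<lambda>x. indicator (V \<inter> X) x *\<^sub>R (outer_normal T x \<bullet> b)) \<in> borel_measurable borel"
    by (intro borel_measurable_continuous_on_indicator)
  have 2: "(\<lambda>x. indicator (X - V) x *\<^sub>R (c \<bullet> b)) \<in> borel_measurable borel"
    using V(1) assms(3)
    by (intro borel_measurable_scaleR borel_measurable_indicator borel_measurable_const) auto
  have "(\<lambda>x. indicator (V \<inter> X) x *\<^sub>R (outer_normal T x \<bullet> b) + indicator (X - V) x *\<^sub>R (c \<bullet> b))
      \<in> borel_measurable borel"
    by (rule borel_measurable_add [OF 1 2])
  moreover have "indicator (V \<inter> X) x *\<^sub>R (outer_normal T x \<bullet> b) + indicator (X - V) x *\<^sub>R (c \<bullet> b)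
      = indicator X x *\<^sub>R (outer_normal T x \<bullet> b)" for x
    using V(2) assms(2) off by (cases "x \<in> V"; cases "x \<in> X") (auto simp: indicator_def)
  ultimately have "set_borel_measurable surface X (\<lambda>x. outer_normal T x \<bullet> b)"
    by (simp add: set_borel_measurable_def measurable_cong_sets [OF sets_surface refl])
  moreover have "\<bar>outer_normal T x \<bullet> b\<bar> \<le> (1 + norm c) * norm b" for x
  proof -
    have "norm (outer_normal T x) \<le> 1 + norm c"
      using off [of x] norm_outer_normal_at outer_normal_eq by (cases "x \<in> G") (fastforce simp: G_def)+
    then have "norm (outer_normal T x) * norm b \<le> (1 + norm c) * norm b"
      by (intro mult_right_mono) auto
    then show ?thesis
      using Cauchy_Schwarz_ineq2 [of "outer_normal T x" b] by linarith
  qed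
  ultimately show ?thesis
    by (auto simp: bdd_measurable_def bounded_iff)
qed

text \<open>Zero sets of continuous functions are relatively closed, so \<open>F\<close> is closed
  in an open neighbourhood of itself: it is the intersection of an open and a closed set.\<close>

lemma C1_hypersurface_borel:
  assumes "C1_hypersurface F"
  shows "F \<in> sets borel"
proof -
  obtain U \<phi> g where U: "\<And>x. x \<in> F \<Longrightarrow> C1_submersion (U x) (\<phi> x) (g x) \<and> x \<in> U x \<and> F \<inter> U x = {y\<in>U x. \<phi> x y = 0}"
    using assms unfolding C1_hypersurface_def by metis
  define V where "V = \<Union>(U ` F)"
  have "open V"
    using U by (auto simp: V_def C1_submersion_def)
  moreover have "F = V \<inter> closure F"
  proof
    show "F \<subseteq> V \<inter> closure F"
      using U closure_subset by (auto simp: V_def)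
    show "V \<inter> closure F \<subseteq> F"
    proof
      fix y assume y: "y \<in> V \<inter> closure F"
      then obtain x where x: "x \<in> F" "y \<in> U x"
        by (auto simp: V_def)
      have c: "open (U x)" "continuous_on (U x) (\<phi> x)"
        using U [OF x(1)] C1_submersion_continuous by blast+
      have "\<phi> x y = 0"
      proof (rule ccontr)
        assume "\<phi> x y \<noteq> 0"
        have "open (U x \<inter> \<phi> x -` (- {0}))"
          by (rule continuous_open_preimage [OF c(2,1)]) (simp add: open_Compl)
        then have "(U x \<inter> \<phi> x -` (- {0})) \<inter> F \<noteq> {}"
          using y x \<open>\<phi> x y \<noteq> 0\<close> by (auto simp: closure_iff_nhds_not_empty)
        then show False
          using U [OF x(1)] by auto
      qed
      then show "y \<in> F"
        using U [OF x(1)] x by auto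
    qed
  qed
  ultimately show ?thesis
    by (metis borel_closed borel_open closed_closure sets.Int)
qed

lemma unit_normal_field_norm:
  assumes "unit_normal_field F n" "x \<in> F"
  shows "norm (n x) = 1"
  using assms unfolding unit_normal_field_def C1_submersion_def by (fastforce simp: norm_sgn)

lemma FacePoly_bdd_measurable:
  assumes n: "unit_normal_field F n" and F: "F \<in> sets borel" "bounded F" and v: "v \<in> FacePoly k n F"
  shows "v \<in> bdd_measurable surface F"
proof -
  obtain c q where q: "q \<in> VecPoly k" and v: "\<And>x. x \<in> F \<Longrightarrow> v x = c + q x \<bullet> n x"
    using v by (auto simp: FacePoly_def)
  have "(\<lambda>x. n x $ i) \<in> bdd_measurable surface F" for i
  proof (rule bdd_measurable_continuous)
    show "continuous_on F (\<lambda>x. n x $ i)"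
      using n by (auto simp: unit_normal_field_def intro: continuous_on_component)
    have "\<bar>n x $ i\<bar> \<le> 1" if "x \<in> F" for x
      using component_le_norm_cart [of "n x" i] unit_normal_field_norm [OF n that] by simp
    then show "bounded ((\<lambda>x. n x $ i) ` F)"
      by (auto simp: bounded_iff)
  qed (use F in auto)
  then have "(\<lambda>x. c + (\<Sum>i\<in>UNIV. q x $ i * n x $ i)) \<in> bdd_measurable surface F"
    using q F unfolding VecPoly_def
    by (intro bdd_measurable_add bdd_measurable_const bdd_measurable_sum bdd_measurable_mult)
      (auto intro: Poly_bdd_measurable)
  moreover have "(\<lambda>x. indicator F x *\<^sub>R v x)
      = (\<lambda>x. indicator F x *\<^sub>R (c + (\<Sum>i\<in>UNIV. q x $ i * n x $ i)))"
    using v by (auto simp: indicator_def inner_vec_def)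
  moreover have "v ` F = (\<lambda>x. c + (\<Sum>i\<in>UNIV. q x $ i * n x $ i)) ` F"
    using v by (auto simp: inner_vec_def image_iff)
  ultimately show ?thesis
    unfolding bdd_measurable_def set_borel_measurable_def mem_Collect_eq by (simp only:)
qed

section \<open>Norm equivalence for polynomials\<close>

lemma grad_sum:
  "(\<And>e. e \<in> E \<Longrightarrow> e \<in> Poly l) \<Longrightarrow> grad (\<lambda>x. \<Sum>e\<in>E. c e * e x) x = (\<Sum>e\<in>E. c e *\<^sub>R grad e x)"
proof (induction E rule: infinite_finite_induct)
  case (insert a E)
  then have "grad (\<lambda>x. c a * a x + (\<Sum>e\<in>E. c e * e x)) x
      = grad (\<lambda>x. c a * a x) x + grad (\<lambda>x. \<Sum>e\<in>E. c e * e x) x"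
    by (intro grad_add Poly_scale Poly_sum) auto
  then show ?case
    using insert by (simp add: grad_scale [of _ l])
qed (auto intro!: grad_eq_inner)

lemma continuous_on_grad:
  assumes "p \<in> Poly l"
  shows "continuous_on A (grad p)"
proof -
  have "continuous_on A (\<lambda>x. \<chi> i. grad p x $ i)"
    by (intro continuous_on_vec_lambda continuous_on_Poly [OF Poly_partial [OF assms]])
  then show ?thesis
    by simp
qed

text \<open>On polynomials the product is definite, so that expansions in an orthonormal family hold
  pointwise.\<close>

lemma Poly_l2_inner_zero:
  assumes "p \<in> Poly l" "open A" "bounded A" "A \<noteq> {}" "l2_inner lborel A p p = 0"
  shows "p x = 0"
proof (rule Poly_zero_on_open [OF assms(1,2,4)])
  fix y assume "y \<in> A"
  have "p y * p y = 0"
  proof (rule set_integral_continuous_zero [OF _ assms(2,3)])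
    show "continuous_on UNIV (\<lambda>y. p y * p y)"
      by (intro continuous_on_mult continuous_on_Poly [OF assms(1)])
    show "(LINT y:A|lborel. p y * p y) = 0"
      using assms(5) by (simp add: l2_inner_def)
  qed (use \<open>y \<in> A\<close> in auto)
  then show "p y = 0"
    by simp
qed

text \<open>Equivalence of norms in finite dimension, made explicit: the coefficients in an
  orthonormal family are at most the norm, and its finitely many members and their gradients are
  bounded on the unit ball.\<close>

lemma Poly_reference_bound:
  assumes "\<rho> > 0"
  shows "\<exists>C>0. \<forall>p \<in> Poly l. \<forall>x :: real^'n. norm x \<le> 1 \<longrightarrow>
    (p x)\<^sup>2 \<le> C * l2_inner lborel (ball 0 \<rho>) p p \<and>
    (norm (grad p x))\<^sup>2 \<le> C * l2_inner lborel (ball 0 \<rho>) p p"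
proof -
  let ?X = "ball (0 :: real^'n) \<rho>"
  let ?G = "monomial ` {a :: 'n \<Rightarrow> nat. sum a UNIV \<le> l}"
  interpret semi_inner_product "bdd_measurable lborel ?X" "l2_inner lborel ?X"
    by (rule l2_inner_semi_inner_product) (use emeasure_lborel_ball_finite in auto)
  have PS: "p \<in> bdd_measurable lborel ?X" if "p \<in> Poly l" for p
    using that by (rule Poly_bdd_measurable) auto
  have G: "finite ?G" "?G \<subseteq> bdd_measurable lborel ?X"
    by (auto intro!: finite_imageI finite_multi_indices PS monomial_mem)
  obtain E where E: "finite E" "E \<subseteq> span ?G" and unit: "\<And>e. e \<in> E \<Longrightarrow> l2_inner lborel ?X e e = 1"
    and "\<And>e f. \<lbrakk>e \<in> E; f \<in> E; e \<noteq> f\<rbrakk> \<Longrightarrow> l2_inner lborel ?X e f = 0"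
    and pars: "\<And>w y. \<lbrakk>w \<in> span ?G; y \<in> bdd_measurable lborel ?X\<rbrakk> \<Longrightarrow>
      l2_inner lborel ?X w y = (\<Sum>e\<in>E. l2_inner lborel ?X w e * l2_inner lborel ?X e y)"
    by (rule orthonormal_family_exists [OF G], rule that)
  have EP: "e \<in> Poly l" if "e \<in> E" for e
    using E(2) that by (auto simp: Poly_eq_span)
  \<comment> \<open>By Parseval the remainder of the expansion is a null vector, thus the zero
    polynomial.\<close>
  have expand: "p x = (\<Sum>e\<in>E. l2_inner lborel ?X p e * e x)" if p: "p \<in> Poly l" for p and x
  proof -
    define P where "P = (\<Sum>e\<in>E. l2_inner lborel ?X p e *\<^sub>R e)"
    have P: "P \<in> Poly l"
      unfolding P_def by (intro subspace_sum subspace_scale subspace_Poly EP)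
    have d: "p - P \<in> Poly l"
      by (intro subspace_diff subspace_Poly p P)
    have "l2_inner lborel ?X P (p - P) = (\<Sum>e\<in>E. l2_inner lborel ?X p e * l2_inner lborel ?X e (p - P))"
      unfolding P_def by (intro lincomb_left PS EP d [unfolded P_def])
    also have "\<dots> = l2_inner lborel ?X p (p - P)"
      using p PS [OF d] by (intro pars [symmetric]) (auto simp: Poly_eq_span)
    finally have "l2_inner lborel ?X (p - P) (p - P) = 0"
      by (subst diff_left) (auto intro: PS p P d)
    then have "(p - P) x = 0"
      using assms by (intro Poly_l2_inner_zero [OF d open_ball bounded_ball]) auto
    then show ?thesis
      by (simp add: P_def sum_fun_apply)
  qed
  have "\<forall>e\<in>E. \<exists>M. \<forall>x\<in>cball 0 1. \<bar>e x\<bar> \<le> M \<and> norm (grad e x) \<le> M"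
  proof
    fix e assume e: "e \<in> E"
    have "bounded (e ` cball 0 1)" "bounded (grad e ` cball 0 1)"
      by (intro compact_imp_bounded compact_continuous_image compact_cball
          continuous_on_Poly [OF EP [OF e]] continuous_on_grad [OF EP [OF e]])+
    then obtain a b where "\<forall>y\<in>e ` cball 0 1. norm y \<le> a" "\<forall>y\<in>grad e ` cball 0 1. norm y \<le> b"
      unfolding bounded_iff by (elim exE)
    then show "\<exists>M. \<forall>x\<in>cball 0 1. \<bar>e x\<bar> \<le> M \<and> norm (grad e x) \<le> M"
      by (intro exI [of _ "max a b"]) (simp add: le_max_iff_disj)
  qed
  from bchoice [OF this] obtain M
    where "\<forall>e\<in>E. \<forall>x\<in>cball 0 1. \<bar>e x\<bar> \<le> M e \<and> norm (grad e x) \<le> M e"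
    by (elim exE)
  then have M: "\<bar>e x\<bar> \<le> M e \<and> norm (grad e x) \<le> M e" if "e \<in> E" "norm x \<le> 1" for e x
    using that by simp
  define S where "S = sum M E"
  \<comment> \<open>The summand 1 makes the constant positive even when
    \<open>S = 0\<close>.\<close>
  have bnd: "a\<^sup>2 \<le> (S\<^sup>2 + 1) * l2_inner lborel ?X p p"
    if p: "p \<in> Poly l" and a: "0 \<le> a" "a \<le> (\<Sum>e\<in>E. \<bar>l2_inner lborel ?X p e\<bar> * M e)" for p a
  proof -
    have "M e \<ge> 0" if "e \<in> E" for e
    proof -
      have "\<bar>e 0\<bar> \<le> M e"
        using M [OF that, of 0] by simp
      then show ?thesis
        by linarith
    qed
    moreover have "\<bar>l2_inner lborel ?X p e\<bar> \<le> sqrt (l2_inner lborel ?X p p)" if "e \<in> E" for e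
      using Cauchy_Schwarz [OF PS [OF p] PS [OF EP [OF that]]] unit [OF that]
      by (intro real_le_rsqrt) simp
    ultimately have "(\<Sum>e\<in>E. \<bar>l2_inner lborel ?X p e\<bar> * M e) \<le> (\<Sum>e\<in>E. sqrt (l2_inner lborel ?X p p) * M e)"
      by (intro sum_mono mult_right_mono) auto
    then have "a \<le> sqrt (l2_inner lborel ?X p p) * S"
      using a by (simp add: S_def sum_distrib_left)
    then have "a\<^sup>2 \<le> (sqrt (l2_inner lborel ?X p p) * S)\<^sup>2"
      using a by (intro power_mono)
    also have "\<dots> = S\<^sup>2 * l2_inner lborel ?X p p"
      using nonneg [OF PS [OF p]] by (simp add: power_mult_distrib)
    also have "\<dots> \<le> (S\<^sup>2 + 1) * l2_inner lborel ?X p p"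
      using nonneg [OF PS [OF p]] by (intro mult_right_mono) auto
    finally show ?thesis .
  qed
  have "\<forall>p\<in>Poly l. \<forall>x. norm x \<le> 1 \<longrightarrow>
    (p x)\<^sup>2 \<le> (S\<^sup>2 + 1) * l2_inner lborel ?X p p \<and> (norm (grad p x))\<^sup>2 \<le> (S\<^sup>2 + 1) * l2_inner lborel ?X p p"
  proof (intro ballI allI impI conjI)
    fix p :: "real^'n \<Rightarrow> real" and x :: "real^'n" assume p: "p \<in> Poly l" and x: "norm x \<le> 1"
    have "\<bar>p x\<bar> \<le> (\<Sum>e\<in>E. \<bar>l2_inner lborel ?X p e * e x\<bar>)"
      by (subst expand [OF p]) (rule sum_abs)
    also have "\<dots> \<le> (\<Sum>e\<in>E. \<bar>l2_inner lborel ?X p e\<bar> * M e)"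
      unfolding abs_mult using M x by (intro sum_mono mult_left_mono) auto
    finally show "(p x)\<^sup>2 \<le> (S\<^sup>2 + 1) * l2_inner lborel ?X p p"
      using bnd [OF p, of "\<bar>p x\<bar>"] by simp
    have "grad p x = grad (\<lambda>x. \<Sum>e\<in>E. l2_inner lborel ?X p e * e x) x"
      by (intro arg_cong [where f = "\<lambda>f. grad f x"] ext expand p)
    also have "\<dots> = (\<Sum>e\<in>E. l2_inner lborel ?X p e *\<^sub>R grad e x)"
      by (rule grad_sum [OF EP])
    finally have "norm (grad p x) \<le> (\<Sum>e\<in>E. norm (l2_inner lborel ?X p e *\<^sub>R grad e x))"
      by (simp only: norm_sum)
    also have "\<dots> \<le> (\<Sum>e\<in>E. \<bar>l2_inner lborel ?X p e\<bar> * M e)"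
      unfolding norm_scaleR using M x by (intro sum_mono mult_left_mono) auto
    finally show "(norm (grad p x))\<^sup>2 \<le> (S\<^sup>2 + 1) * l2_inner lborel ?X p p"
      using bnd [OF p, of "norm (grad p x)"] by simp
  qed
  moreover have "S\<^sup>2 + 1 > 0"
    by (simp add: add_nonneg_pos)
  ultimately show ?thesis
    by blast
qed

lemma l2_inner_ball_scale:
  fixes f :: "'a::euclidean_space \<Rightarrow> real"
  assumes "continuous_on UNIV f" "h > 0"
  shows "l2_inner lborel (ball z (r * h)) f f
    = h ^ DIM('a) * l2_inner lborel (ball 0 r) (\<lambda>x. f (z + h *\<^sub>R x)) (\<lambda>x. f (z + h *\<^sub>R x))"
proof -
  define g where "g x = indicator (ball z (r * h)) x *\<^sub>R (f x * f x)" for x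
  have [measurable]: "g \<in> borel_measurable borel"
    unfolding g_def using assms(1)
    by (intro borel_measurable_continuous_on_indicator) (auto intro!: continuous_on_mult intro: continuous_on_subset)
  have "integral\<^sup>L lborel g = integral\<^sup>L (density (distr lborel borel (\<lambda>x. z + h *\<^sub>R x)) (\<lambda>_. ennreal (\<bar>h\<bar> ^ DIM('a)))) g"
    using lborel_affine [of h z] assms(2) by simp
  also have "\<dots> = (LINT x|distr lborel borel (\<lambda>x. z + h *\<^sub>R x). \<bar>h\<bar> ^ DIM('a) *\<^sub>R g x)"
    by (subst integral_density) auto
  also have "\<dots> = (LINT x|lborel. \<bar>h\<bar> ^ DIM('a) *\<^sub>R g (z + h *\<^sub>R x))"
    by (subst integral_distr) auto
  also have "\<dots> = h ^ DIM('a) * (LINT x|lborel. g (z + h *\<^sub>R x))"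
    using assms(2) by simp
  also have "(\<lambda>x. g (z + h *\<^sub>R x)) = (\<lambda>x. indicator (ball 0 r) x *\<^sub>R (f (z + h *\<^sub>R x) * f (z + h *\<^sub>R x)))"
    using assms(2) by (auto simp: g_def indicator_def dist_norm mult.commute [of r])
  finally show ?thesis
    by (simp add: l2_inner_def set_lebesgue_integral_def g_def)
qed

text \<open>The substitution \<open>z + h *\<^sub>R y\<close> maps the reference balls to the two
  concentric balls; the volume contributes \<open>h ^ CARD('n)\<close> and the gradient a factor
  \<open>h\<close>. The integral over the smaller ball is at most that over \<open>T\<close>, so one
  constant serves all elements.\<close>

lemma Poly_local_bound:
  assumes "\<rho> > 0"
  shows "\<exists>C>0. \<forall>p \<in> Poly l. \<forall>z h. \<forall>T :: (real^'n) set. \<forall>x.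
    h > 0 \<longrightarrow> ball z (\<rho> * h) \<subseteq> T \<longrightarrow> bounded T \<longrightarrow> T \<in> sets borel \<longrightarrow> norm (x - z) \<le> h \<longrightarrow>
    (p x)\<^sup>2 \<le> C / h ^ CARD('n) * l2_inner lborel T p p \<and>
    h\<^sup>2 * (norm (grad p x))\<^sup>2 \<le> C / h ^ CARD('n) * l2_inner lborel T p p"
proof -
  obtain C where C: "C > 0" "\<And>p x :: real^'n. \<lbrakk>p \<in> Poly l; norm x \<le> 1\<rbrakk> \<Longrightarrow>
    (p x)\<^sup>2 \<le> C * l2_inner lborel (ball 0 \<rho>) p p \<and>
    (norm (grad p x))\<^sup>2 \<le> C * l2_inner lborel (ball 0 \<rho>) p p"
    using Poly_reference_bound [OF assms, of l] by blast
  show ?thesis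
  proof (intro exI [of _ C] conjI ballI allI impI)
    fix p :: "real^'n \<Rightarrow> real" and z x h and T :: "(real^'n) set"
    assume p: "p \<in> Poly l" and h: "h > 0" and T: "ball z (\<rho> * h) \<subseteq> T" "bounded T" "T \<in> sets borel"
      and x: "norm (x - z) \<le> h"
    define y where "y = (1 / h) *\<^sub>R (x - z)"
    have y: "norm y \<le> 1" "z + h *\<^sub>R y = x"
      using h x by (auto simp: y_def)
    have "C * l2_inner lborel (ball 0 \<rho>) (\<lambda>x. p (z + h *\<^sub>R x)) (\<lambda>x. p (z + h *\<^sub>R x))
        = C / h ^ CARD('n) * l2_inner lborel (ball z (\<rho> * h)) p p"
      using h l2_inner_ball_scale [OF continuous_on_Poly [OF p] h, of z \<rho>] by simp
    also have "\<dots> \<le> C / h ^ CARD('n) * l2_inner lborel T p p"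
      using C(1) h T p
      by (intro mult_left_mono l2_inner_mono_set Poly_bdd_measurable emeasure_bounded_finite) auto
    finally have le: "C * l2_inner lborel (ball 0 \<rho>) (\<lambda>x. p (z + h *\<^sub>R x)) (\<lambda>x. p (z + h *\<^sub>R x))
      \<le> C / h ^ CARD('n) * l2_inner lborel T p p" .
    from C(2) [OF Poly_affine [OF p] y(1), of z h] le
    show "(p x)\<^sup>2 \<le> C / h ^ CARD('n) * l2_inner lborel T p p"
      "h\<^sup>2 * (norm (grad p x))\<^sup>2 \<le> C / h ^ CARD('n) * l2_inner lborel T p p"
      using h by (auto simp: y(2) grad_affine [OF p] power_mult_distrib)
  qed (rule C(1))
qed

section \<open>Projections\<close>

lemma proj_elem_properties:
  fixes T :: "(real^'n) set"
  assumes T: "T \<in> sets borel" "bounded T" and f: "f \<in> bdd_measurable lborel T"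
  shows "proj_elem k T f \<in> Poly k"
    and "\<And>q. q \<in> Poly k \<Longrightarrow> l2_inner lborel T (\<lambda>x. f x - proj_elem k T f x) q = 0"
proof -
  interpret semi_inner_product "bdd_measurable lborel T" "l2_inner lborel T"
    by (rule l2_inner_semi_inner_product) (use T emeasure_bounded_finite in auto)
  have "\<exists>p\<in>span (monomial ` {a. sum a UNIV \<le> k}). \<forall>q\<in>span (monomial ` {a. sum a UNIV \<le> k}).
      l2_inner lborel T (f - p) q = 0"
    by (intro orthogonal_projection_exists f finite_imageI finite_multi_indices)
      (use T in \<open>auto intro!: Poly_bdd_measurable monomial_mem\<close>)
  then have "\<exists>p. p \<in> Poly k \<and> (\<forall>q\<in>Poly k. l2_inner lborel T (\<lambda>x. f x - p x) q = 0)"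
    unfolding Poly_eq_span by (auto simp: fun_diff_def)
  from someI_ex [OF this]
  have "proj_elem k T f \<in> Poly k \<and> (\<forall>q\<in>Poly k. l2_inner lborel T (\<lambda>x. f x - proj_elem k T f x) q = 0)"
    unfolding proj_elem_def .
  then show "proj_elem k T f \<in> Poly k"
    and "\<And>q. q \<in> Poly k \<Longrightarrow> l2_inner lborel T (\<lambda>x. f x - proj_elem k T f x) q = 0"
    by auto
qed

lemma subspace_FacePoly: "subspace (FacePoly k n F)"
  unfolding subspace_def
proof (intro conjI ballI allI)
  show "0 \<in> FacePoly k n F"
    by (auto simp: FacePoly_def VecPoly_def Poly_const intro!: exI [of _ 0] bexI [of _ "\<lambda>_. 0"])
next
  fix f g assume "f \<in> FacePoly k n F" "g \<in> FacePoly k n F"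
  then obtain c q d r where q: "q \<in> VecPoly k" "r \<in> VecPoly k"
    and fg: "\<And>x. x \<in> F \<Longrightarrow> f x = c + q x \<bullet> n x" "\<And>x. x \<in> F \<Longrightarrow> g x = d + r x \<bullet> n x"
    unfolding FacePoly_def by blast
  have "(\<lambda>x. q x + r x) \<in> VecPoly k"
    using q by (auto simp: VecPoly_def intro: Poly_add)
  then show "f + g \<in> FacePoly k n F"
    using fg unfolding FacePoly_def
    by (intro CollectI exI [of _ "c + d"] bexI [of _ "\<lambda>x. q x + r x"]) (auto simp: inner_add_left)
next
  fix b f assume "f \<in> FacePoly k n F"
  then obtain c q where q: "q \<in> VecPoly k" and f: "\<And>x. x \<in> F \<Longrightarrow> f x = c + q x \<bullet> n x"
    unfolding FacePoly_def by blast
  have "(\<lambda>x. b *\<^sub>R q x) \<in> VecPoly k"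
    using q by (auto simp: VecPoly_def intro: Poly_scale)
  then show "b *\<^sub>R f \<in> FacePoly k n F"
    using f unfolding FacePoly_def
    by (intro CollectI exI [of _ "b * c"] bexI [of _ "\<lambda>x. b *\<^sub>R q x"]) (auto simp: distrib_left)
qed

lemma FacePoly_cong:
  assumes "v \<in> FacePoly k n F" "\<And>x. x \<in> F \<Longrightarrow> u x = v x"
  shows "u \<in> FacePoly k n F"
  using assms unfolding FacePoly_def by auto

lemma FacePoly_const: "(\<lambda>x. c) \<in> FacePoly k n F"
  unfolding FacePoly_def
  by (intro CollectI exI [of _ c] bexI [of _ "\<lambda>_. 0"]) (auto simp: VecPoly_def Poly_const)

lemma FacePoly_component:
  assumes "p \<in> Poly k"
  shows "(\<lambda>x. p x * n x $ i) \<in> FacePoly k n F"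
proof -
  have "(\<lambda>x. p x *\<^sub>R axis i 1) \<in> VecPoly k"
    unfolding VecPoly_def
  proof (intro CollectI allI)
    fix j
    have "(\<lambda>x. (p x *\<^sub>R axis i 1) $ j) = (if j = i then p else (\<lambda>x. 0))"
      by (auto simp: axis_def)
    then show "(\<lambda>x. (p x *\<^sub>R axis i 1) $ j) \<in> Poly k"
      using assms by (simp add: Poly_const)
  qed
  then show ?thesis
    unfolding FacePoly_def
    by (intro CollectI exI [of _ 0] bexI [of _ "\<lambda>x. p x *\<^sub>R axis i 1"]) (auto simp: inner_axis')
qed

text \<open>Elements of \<open>FacePoly\<close> are arbitrary off \<open>F\<close>, so as functions
  on the whole space they are not spanned by a finite set in general. The constant 1 and the
  products of monomials with normal components generate them up to values off \<open>F\<close>,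
  which no integral over \<open>F\<close> sees.\<close>

lemma FacePoly_finite_generators:
  obtains G where "finite G" "G \<subseteq> FacePoly k n F"
    "\<And>q. q \<in> FacePoly k n F \<Longrightarrow> \<exists>q'\<in>span G. \<forall>x\<in>F. q x = q' x"
proof
  define g where "g = (\<lambda>(a, i) x. monomial a x * n x $ i)"
  define G where "G = insert (\<lambda>x. 1) (g ` ({a. sum a UNIV \<le> k} \<times> UNIV))"
  show "finite G"
    unfolding G_def by (intro finite.insertI finite_imageI finite_cartesian_product finite_multi_indices) simp
  show "G \<subseteq> FacePoly k n F"
    by (auto simp: G_def g_def intro!: FacePoly_const FacePoly_component monomial_mem)
  show "\<exists>q'\<in>span G. \<forall>x\<in>F. q x = q' x" if q: "q \<in> FacePoly k n F" for q
  proof -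
    obtain c v where v: "v \<in> VecPoly k" and qv: "\<And>x. x \<in> F \<Longrightarrow> q x = c + v x \<bullet> n x"
      using q unfolding FacePoly_def by blast
    have comp: "(\<lambda>x. p x * n x $ i) \<in> span G" if "p \<in> Poly k" for p i
    proof -
      have "subspace {p. (\<lambda>x. p x * n x $ i) \<in> span G}"
        unfolding subspace_def
      proof (intro conjI ballI allI)
        show "0 \<in> {p. (\<lambda>x. p x * n x $ i) \<in> span G}"
          using span_zero [of G] by (simp add: zero_fun_def)
        fix f assume f: "f \<in> {p. (\<lambda>x. p x * n x $ i) \<in> span G}"
        show "f + g \<in> {p. (\<lambda>x. p x * n x $ i) \<in> span G}"
          if "g \<in> {p. (\<lambda>x. p x * n x $ i) \<in> span G}" for g
          using span_add [of "\<lambda>x. f x * n x $ i" G "\<lambda>x. g x * n x $ i"] f that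
          by (simp add: plus_fun_def distrib_right)
        show "b *\<^sub>R f \<in> {p. (\<lambda>x. p x * n x $ i) \<in> span G}" for b
          using span_scale [of "\<lambda>x. f x * n x $ i" G b] f
          by (simp add: scaleR_fun_def mult.assoc)
      qed
      moreover have "monomial ` {a. sum a UNIV \<le> k} \<subseteq> {p. (\<lambda>x. p x * n x $ i) \<in> span G}"
        by (auto simp: G_def g_def intro!: span_base image_eqI [of _ _ "(a, i)" for a])
      ultimately have "span (monomial ` {a. sum a UNIV \<le> k}) \<subseteq> {p. (\<lambda>x. p x * n x $ i) \<in> span G}"
        by (intro span_minimal)
      then show ?thesis
        using that by (auto simp: Poly_eq_span)
    qed
    define q' where "q' = c *\<^sub>R (\<lambda>x. 1) + (\<Sum>i\<in>UNIV. (\<lambda>x. v x $ i * n x $ i))"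
    have "q' \<in> span G"
      unfolding q'_def using v
      by (intro span_add span_scale span_sum comp) (auto simp: VecPoly_def G_def intro: span_base)
    moreover have "\<forall>x\<in>F. q x = q' x"
      by (simp add: qv q'_def sum_fun_apply inner_vec_def)
    ultimately show ?thesis
      by blast
  qed
qed

lemma proj_face_properties:
  assumes n: "unit_normal_field F n" and F: "F \<in> sets borel" "bounded F" "emeasure surface F < \<infinity>"
    and f: "f \<in> bdd_measurable surface F"
  shows "proj_face k n F f \<in> FacePoly k n F"
    and "\<And>q. q \<in> FacePoly k n F \<Longrightarrow> l2_inner surface F (\<lambda>x. f x - proj_face k n F f x) q = 0"
proof -
  interpret semi_inner_product "bdd_measurable surface F" "l2_inner surface F"
    by (rule l2_inner_semi_inner_product) (use F in auto)
  obtain G where G: "finite G" "G \<subseteq> FacePoly k n F"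
    and gen: "\<And>q. q \<in> FacePoly k n F \<Longrightarrow> \<exists>q'\<in>span G. \<forall>x\<in>F. q x = q' x"
    by (rule FacePoly_finite_generators [of k n F], rule that)
  have "G \<subseteq> bdd_measurable surface F"
    using G(2) FacePoly_bdd_measurable [OF n F(1,2)] by blast
  then obtain p where p: "p \<in> span G" "\<forall>q\<in>span G. l2_inner surface F (f - p) q = 0"
    using orthogonal_projection_exists [OF G(1) _ f] by blast
  have "p \<in> FacePoly k n F"
    using p(1) span_minimal [OF G(2) subspace_FacePoly] by blast
  moreover have "l2_inner surface F (\<lambda>x. f x - p x) q = 0" if q: "q \<in> FacePoly k n F" for q
  proof -
    obtain q' where q': "q' \<in> span G" "\<forall>x\<in>F. q x = q' x"
      using gen [OF q] by blast
    have "l2_inner surface F (\<lambda>x. f x - p x) q = l2_inner surface F (f - p) q'"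
      unfolding l2_inner_def using q'(2) F(1) by (intro set_lebesgue_integral_cong) auto
    then show ?thesis
      using p(2) q'(1) by simp
  qed
  ultimately have "\<exists>p. p \<in> FacePoly k n F \<and> (\<forall>q\<in>FacePoly k n F. l2_inner surface F (\<lambda>x. f x - p x) q = 0)"
    by blast
  from someI_ex [OF this]
  have "proj_face k n F f \<in> FacePoly k n F \<and>
      (\<forall>q\<in>FacePoly k n F. l2_inner surface F (\<lambda>x. f x - proj_face k n F f x) q = 0)"
    unfolding proj_face_def .
  then show "proj_face k n F f \<in> FacePoly k n F"
    and "\<And>q. q \<in> FacePoly k n F \<Longrightarrow> l2_inner surface F (\<lambda>x. f x - proj_face k n F f x) q = 0"
    by auto
qed

section \<open>Reconstruction on a mesh element\<close>

lemma has_derivative_mult_grad: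
  fixes w :: "real^'n \<Rightarrow> real"
  assumes "w \<in> Poly l"
  shows "((\<lambda>x. K *v grad w x) has_derivative (\<lambda>v. K *v (\<chi> j. v \<bullet> grad (\<lambda>x. grad w x $ j) x))) (at x)"
proof -
  have "(grad w has_derivative (\<lambda>v. \<chi> j. v \<bullet> grad (\<lambda>x. grad w x $ j) x)) (at x)"
  proof (subst has_derivative_componentwise_within, rule ballI)
    fix b :: "real^'n" assume "b \<in> Basis"
    then obtain j where "b = axis j 1"
      by (auto simp: Basis_vec_def)
    then show "((\<lambda>x. grad w x \<bullet> b) has_derivative
        (\<lambda>v. (\<chi> j. v \<bullet> grad (\<lambda>x. grad w x $ j) x) \<bullet> b)) (at x)"
      using Poly_has_derivative [OF Poly_partial [OF assms], of j x] by (simp add: inner_axis)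
  qed
  from has_derivative_compose [OF this bounded_linear_imp_has_derivative [OF matrix_vector_mul_bounded_linear]]
  show ?thesis .
qed

text \<open>As \<open>K\<close> is constant, the divergence is a combination of second derivatives
  of \<open>w\<close>. It is therefore a polynomial and linear in \<open>w\<close>, as the
  reconstruction problem requires of its right-hand side.\<close>

lemma divergence_mult_grad:
  assumes "w \<in> Poly l"
  shows "divergence (\<lambda>x. K *v grad w x) x = (\<Sum>i\<in>UNIV. \<Sum>j\<in>UNIV. K $ i $ j * grad (\<lambda>x. grad w x $ j) x $ i)"
proof -
  have "frechet_derivative (\<lambda>x. K *v grad w x) (at x) = (\<lambda>v. K *v (\<chi> j. v \<bullet> grad (\<lambda>x. grad w x $ j) x))"
    by (rule frechet_derivative_at [OF has_derivative_mult_grad [OF assms], symmetric])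
  then show ?thesis
    by (simp add: divergence_def matrix_vector_mult_def inner_axis')
qed

lemma divergence_mult_grad_Poly:
  assumes "w \<in> Poly l"
  shows "divergence (\<lambda>x. K *v grad w x) \<in> Poly l"
proof -
  have "divergence (\<lambda>x. K *v grad w x)
      = (\<lambda>x. \<Sum>i\<in>UNIV. \<Sum>j\<in>UNIV. K $ i $ j * grad (\<lambda>x. grad w x $ j) x $ i)"
    by (intro ext divergence_mult_grad [OF assms])
  also have "\<dots> \<in> Poly l"
    by (intro Poly_sum Poly_scale Poly_partial assms)
  finally show ?thesis .
qed

lemma divergence_mult_grad_add:
  assumes "w \<in> Poly l" "u \<in> Poly l"
  shows "divergence (\<lambda>x. K *v grad (\<lambda>x. w x + u x) x) x
    = divergence (\<lambda>x. K *v grad w x) x + divergence (\<lambda>x. K *v grad u x) x"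
proof -
  have "grad (\<lambda>x. grad (\<lambda>x. w x + u x) x $ j) x
      = grad (\<lambda>x. grad w x $ j) x + grad (\<lambda>x. grad u x $ j) x" for j
    using grad_add [OF Poly_partial [OF assms(1)] Poly_partial [OF assms(2)]]
    by (simp add: grad_add [OF assms])
  then show ?thesis
    by (simp add: divergence_mult_grad [OF Poly_add [OF assms]] divergence_mult_grad [OF assms(1)]
        divergence_mult_grad [OF assms(2)] distrib_left sum.distrib)
qed

lemma divergence_mult_grad_scale:
  assumes "w \<in> Poly l"
  shows "divergence (\<lambda>x. K *v grad (\<lambda>x. c * w x) x) x = c * divergence (\<lambda>x. K *v grad w x) x"
proof -
  have "grad (\<lambda>x. grad (\<lambda>x. c * w x) x $ j) x = c *\<^sub>R grad (\<lambda>x. grad w x $ j) x" for j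
    using grad_scale [OF Poly_partial [OF assms]] by (simp add: grad_scale [OF assms])
  then show ?thesis
    by (simp add: divergence_mult_grad [OF Poly_scale [OF assms]] divergence_mult_grad [OF assms]
        sum_distrib_left mult_ac)
qed

lemma grad_const: "grad (\<lambda>x. c) x = 0"
  by (rule grad_eq_inner) simp

text \<open>Hypotheses under which the local operators exist. Finite area of the boundary is assumed
  here and derived from the star-shaped pieces in the final theorem.\<close>

locale mesh_element =
  fixes T :: "(real^'n) set" and K :: "real^'n^'n" and \<nu> and \<F> :: "(real^'n) set set"
    and Kmin Kmax :: real
  assumes T_domain: "domain T" and T_bounded: "bounded T" and T_boundary: "piecewise_C1_boundary T"
    and finite_faces: "finite \<F>" and disjoint_faces: "disjoint \<F>"
    and face: "\<And>F. F \<in> \<F> \<Longrightarrow> F \<subseteq> frontier T \<and> C1_hypersurface F \<and> unit_normal_field F (\<nu> F)"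
    and finite_area: "emeasure surface (frontier T) < \<infinity>"
    and K_sym: "transpose K = K" and Kmin: "0 < Kmin"
    and K_lower: "\<And>x. Kmin * (x \<bullet> x) \<le> (K *v x) \<bullet> x"
    and K_upper: "\<And>x. (K *v x) \<bullet> x \<le> Kmax * (x \<bullet> x)"
begin

lemma open_T: "open T" and T_nonempty: "T \<noteq> {}"
  using T_domain by (auto simp: domain_def)

lemma T_borel: "T \<in> sets borel"
  using open_T by simp

lemma finite_volume: "emeasure lborel T < \<infinity>"
  by (rule emeasure_bounded_finite [OF T_bounded])

lemma K_inner_commute: "(K *v x) \<bullet> y = (K *v y) \<bullet> x"
  using K_sym by (metis dot_lmul_matrix inner_commute vector_transpose_matrix)

lemma K_nonneg: "0 \<le> (K *v x) \<bullet> x"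
  using K_lower [of x] Kmin by (meson inner_ge_zero mult_nonneg_nonneg less_imp_le order_trans)

lemma frontier_bounded: "bounded (frontier T)"
  by (intro compact_imp_bounded compact_frontier_bounded T_bounded)

lemma face_borel: "F \<in> \<F> \<Longrightarrow> F \<in> sets borel"
  using face C1_hypersurface_borel by blast

lemma face_bounded: "F \<in> \<F> \<Longrightarrow> bounded F"
  using face frontier_bounded bounded_subset by blast

lemma faces_borel: "\<Union>\<F> \<in> sets borel"
  using finite_faces face_borel by (intro sets.finite_Union) auto

lemma faces_subset: "\<Union>\<F> \<subseteq> frontier T"
  using face by blast

lemma faces_bounded: "bounded (\<Union>\<F>)"
  using faces_subset frontier_bounded bounded_subset by blast

lemma faces_area: "emeasure surface (\<Union>\<F>) \<le> emeasure surface (frontier T)"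
  by (intro emeasure_mono faces_subset) (simp add: borel_closed)

lemma faces_finite_area: "emeasure surface (\<Union>\<F>) < \<infinity>"
  using faces_area finite_area by (rule le_less_trans)

lemma face_finite_area: "F \<in> \<F> \<Longrightarrow> emeasure surface F < \<infinity>"
  by (rule le_less_trans [OF emeasure_mono faces_finite_area]) (auto simp: faces_borel)

text \<open>The faces are finitely many and disjoint, so the indicator of their union is a sum and
  measurability is inherited face by face.\<close>

lemma faces_bdd_measurable:
  assumes "\<And>F. F \<in> \<F> \<Longrightarrow> v \<in> FacePoly k (\<nu> F) F"
  shows "v \<in> bdd_measurable surface (\<Union>\<F>)"
proof -
  have m: "v \<in> bdd_measurable surface F" if "F \<in> \<F>" for F
    using that face face_borel face_bounded assms by (intro FacePoly_bdd_measurable) auto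
  have ind: "indicator (\<Union>\<F>) x *\<^sub>R v x = (\<Sum>F\<in>\<F>. indicator F x *\<^sub>R v x)" for x
  proof -
    have "disjoint_family_on (\<lambda>F. F) \<F>"
      using disjoint_faces by (auto simp: disjoint_def disjoint_family_on_def)
    from indicator_UN_disjoint [OF finite_faces this, of x]
    have "indicator (\<Union>\<F>) x = (\<Sum>F\<in>\<F>. indicator F x :: real)"
      by (simp only: image_ident)
    then show ?thesis
      by (simp only: scaleR_sum_left)
  qed
  have "(\<lambda>x. \<Sum>F\<in>\<F>. indicator F x *\<^sub>R v x) \<in> borel_measurable surface"
    using m by (intro borel_measurable_sum) (auto simp: bdd_measurable_def set_borel_measurable_def)
  moreover have "bounded (v ` \<Union>\<F>)"
    unfolding image_Union using m finite_faces by (intro bounded_Union) (auto simp: bdd_measurable_def)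
  ultimately show ?thesis
    by (simp add: bdd_measurable_def set_borel_measurable_def ind [abs_def] del: real_scaleR_def)
qed

lemma outer_normal_component: "(\<lambda>x. b \<bullet> outer_normal T x) \<in> bdd_measurable surface (\<Union>\<F>)"
  using outer_normal_measurable_bounded [OF open_T faces_subset faces_borel]
  by (simp add: inner_commute)

lemma flux_bdd_measurable:
  assumes "w \<in> Poly l"
  shows "(\<lambda>x. (K *v grad w x) \<bullet> outer_normal T x) \<in> bdd_measurable surface (\<Union>\<F>)"
proof -
  have "(\<lambda>x. (K *v grad w x) \<bullet> outer_normal T x)
      = (\<lambda>x. \<Sum>i\<in>UNIV. (\<Sum>j\<in>UNIV. K $ i $ j * grad w x $ j) * (axis i 1 \<bullet> outer_normal T x))"
    by (intro ext, subst inner_vec_def) (simp add: matrix_vector_mult_def inner_axis')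
  also have "\<dots> \<in> bdd_measurable surface (\<Union>\<F>)"
    by (intro bdd_measurable_sum bdd_measurable_mult bdd_measurable_const outer_normal_component
        Poly_bdd_measurable [OF Poly_partial [OF assms]]) (auto simp: faces_borel faces_bounded)
  finally show ?thesis .
qed

lemma normal_weight_bdd_measurable:
  "(\<lambda>x. (K *v outer_normal T x) \<bullet> outer_normal T x) \<in> bdd_measurable surface (\<Union>\<F>)"
proof -
  have "(\<lambda>x. (K *v outer_normal T x) \<bullet> outer_normal T x)
      = (\<lambda>x. \<Sum>i\<in>UNIV. (\<Sum>j\<in>UNIV. K $ i $ j * (axis j 1 \<bullet> outer_normal T x)) * (axis i 1 \<bullet> outer_normal T x))"
    by (intro ext, subst inner_vec_def) (simp add: matrix_vector_mult_def inner_axis')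
  also have "\<dots> \<in> bdd_measurable surface (\<Union>\<F>)"
    by (intro bdd_measurable_sum bdd_measurable_mult bdd_measurable_const outer_normal_component)
      (auto simp: faces_borel)
  finally show ?thesis .
qed

text \<open>Only almost everywhere: at edges and corners \<open>outer_normal\<close> is an
  unspecified vector, possibly not of unit length. Such points form a null set by
  \<open>piecewise_C1_boundary\<close>.\<close>

lemma normal_weight_le: "AE x\<in>\<Union>\<F> in surface. (K *v outer_normal T x) \<bullet> outer_normal T x \<le> Kmax"
proof (rule AE_I')
  show "{x \<in> frontier T. \<nexists>n. outer_normal_at T x n} \<in> null_sets surface"
    using T_boundary by (simp add: piecewise_C1_boundary_def)
  show "{x \<in> space surface. \<not> (x \<in> \<Union>\<F> \<longrightarrow> (K *v outer_normal T x) \<bullet> outer_normal T x \<le> Kmax)}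
      \<subseteq> {x \<in> frontier T. \<nexists>n. outer_normal_at T x n}"
  proof (intro subsetI CollectI conjI notI)
    fix x assume x: "x \<in> {x \<in> space surface. \<not> (x \<in> \<Union>\<F> \<longrightarrow> (K *v outer_normal T x) \<bullet> outer_normal T x \<le> Kmax)}"
    then show "x \<in> frontier T"
      using faces_subset by blast
    assume "\<exists>n. outer_normal_at T x n"
    then have "norm (outer_normal T x) = 1"
      using norm_outer_normal_at outer_normal_eq by metis
    then show False
      using x K_upper [of "outer_normal T x"] by (simp add: dot_square_norm)
  qed
qed

section \<open>The energy form and the reconstruction problem\<close>

definition energy :: "(real^'n \<Rightarrow> real) \<Rightarrow> (real^'n \<Rightarrow> real) \<Rightarrow> real" where
  "energy p w = l2_inner lborel T (\<lambda>x. K *v grad p x) (grad w)"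

definition dirichlet :: "(real^'n \<Rightarrow> real) \<Rightarrow> real" where
  "dirichlet w = l2_inner lborel T (grad w) (grad w)"

lemma energy_integrable:
  assumes "p \<in> Poly l" "w \<in> Poly m"
  shows "set_integrable lborel T (\<lambda>x. (K *v grad p x) \<bullet> grad w x)"
proof (intro bdd_measurable_integrable bdd_measurable_continuous_UNIV)
  show "continuous_on UNIV (\<lambda>x. (K *v grad p x) \<bullet> grad w x)"
    by (intro continuous_on_inner continuous_on_grad [OF assms(2)]
        bounded_linear.continuous_on [OF matrix_vector_mul_bounded_linear] continuous_on_grad [OF assms(1)])
qed (use T_bounded open_T finite_volume in auto)

lemma dirichlet_integrable:
  assumes "w \<in> Poly l"
  shows "set_integrable lborel T (\<lambda>x. grad w x \<bullet> grad w x)"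
proof (intro bdd_measurable_integrable bdd_measurable_continuous_UNIV)
  show "continuous_on UNIV (\<lambda>x. grad w x \<bullet> grad w x)"
    by (intro continuous_on_inner continuous_on_grad [OF assms])
qed (use T_bounded open_T finite_volume in auto)

lemma energy_semi_inner_product: "semi_inner_product (Poly l) energy"
proof
  show "subspace (Poly l)"
    by (rule subspace_Poly)
  show "energy (p + q) w = energy p w + energy q w" if "p \<in> Poly l" "q \<in> Poly l" "w \<in> Poly l" for p q w
    using set_integral_add(2) [OF energy_integrable [OF that(1,3)] energy_integrable [OF that(2,3)]]
    by (simp add: energy_def l2_inner_def plus_fun_def grad_add [OF that(1,2)] matrix_vector_right_distrib
        inner_add_left)
  show "energy (c *\<^sub>R p) w = c * energy p w" if "p \<in> Poly l" for c p w
    by (simp add: energy_def l2_inner_def scaleR_fun_def grad_scale [OF that] matrix_vector_mult_scaleR)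
  show "energy p w = energy w p" for p w
    by (simp add: energy_def l2_inner_def K_inner_commute)
  show "0 \<le> energy p p" for p
    unfolding energy_def l2_inner_def set_lebesgue_integral_def
    by (rule Bochner_Integration.integral_nonneg) (simp add: indicator_def K_nonneg)
qed

lemma dirichlet_le_energy: "w \<in> Poly l \<Longrightarrow> Kmin * dirichlet w \<le> energy w w"
  unfolding dirichlet_def energy_def l2_inner_def set_integral_mult_right [symmetric]
  by (intro set_integral_mono energy_integrable K_lower) (auto intro!: dirichlet_integrable)

lemma energy_le_dirichlet: "w \<in> Poly l \<Longrightarrow> energy w w \<le> Kmax * dirichlet w"
  unfolding dirichlet_def energy_def l2_inner_def set_integral_mult_right [symmetric]
  by (intro set_integral_mono energy_integrable K_upper) (auto intro!: dirichlet_integrable)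

text \<open>Ellipticity makes the gradient vanish on \<open>T\<close>, and a polynomial vanishing on
  a nonempty open set is zero. This identifies the null vectors on which the right-hand side of the
  reconstruction problem has to vanish.\<close>

lemma energy_zero_imp_grad_zero:
  assumes "w \<in> Poly l" "energy w w = 0"
  shows "grad w x = 0"
proof -
  have "grad w y $ i = 0" if "y \<in> T" for y i
  proof -
    have "(K *v grad w y) \<bullet> grad w y = 0"
    proof (rule set_integral_continuous_zero [OF _ open_T T_bounded _ _ that])
      show "continuous_on UNIV (\<lambda>x. (K *v grad w x) \<bullet> grad w x)"
        by (intro continuous_on_inner continuous_on_grad [OF assms(1)]
            bounded_linear.continuous_on [OF matrix_vector_mul_bounded_linear])
    qed (use K_nonneg assms(2) in \<open>auto simp: energy_def l2_inner_def\<close>)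
    then have "Kmin * (grad w y \<bullet> grad w y) \<le> 0"
      using K_lower [of "grad w y"] by simp
    then have "grad w y = 0"
      using Kmin by (metis inner_gt_zero_iff mult_pos_pos not_le)
    then show ?thesis
      by simp
  qed
  then have "grad w x $ i = 0" for i
    by (rule Poly_zero_on_open [OF Poly_partial [OF assms(1)] open_T T_nonempty])
  then show ?thesis
    by (simp add: vec_eq_iff)
qed

lemma volume_nonzero: "(LINT x:T|lborel. (1::real)) \<noteq> 0"
proof
  assume "(LINT x:T|lborel. (1::real)) = 0"
  moreover obtain x where "x \<in> T"
    using T_nonempty by blast
  ultimately show False
    using set_integral_continuous_zero [OF _ open_T T_bounded, of "\<lambda>_. 1" x] by simp
qed

text \<open>A Neumann problem: the energy fixes the solution up to a constant, the right-hand side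
  is compatible because it sees \<open>w\<close> only through derivatives, and the mean value
  selects the constant.\<close>

lemma reconstruction_properties:
  assumes v: "v \<in> local_space k \<nu> \<F>"
  shows "reconstruction k K T \<F> v \<in> Poly (k + 1)"
    and "(LINT x:T|lborel. reconstruction k K T \<F> v x - fst v x) = 0"
proof -
  define L where "L w = - l2_inner lborel T (fst v) (divergence (\<lambda>x. K *v grad w x))
      + l2_inner surface (\<Union>\<F>) (snd v) (\<lambda>x. (K *v grad w x) \<bullet> outer_normal T x)" for w
  have v1: "fst v \<in> Poly k" and v2: "\<And>F. F \<in> \<F> \<Longrightarrow> snd v \<in> FacePoly k (\<nu> F) F"
    using v by (auto simp: local_space_def)
  have v2m: "snd v \<in> bdd_measurable surface (\<Union>\<F>)"
    by (rule faces_bdd_measurable) (use v2 in auto)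
  interpret E: semi_inner_product "Poly (k + 1)" energy
    by (rule energy_semi_inner_product)
  interpret VT: semi_inner_product "bdd_measurable lborel T" "l2_inner lborel T"
    by (rule l2_inner_semi_inner_product) (use open_T finite_volume in auto)
  interpret VF: semi_inner_product "bdd_measurable surface (\<Union>\<F>)" "l2_inner surface (\<Union>\<F>)"
    by (rule l2_inner_semi_inner_product) (use faces_borel faces_finite_area in auto)
  have mT: "p \<in> bdd_measurable lborel T" if "p \<in> Poly l" for p l
    using that by (rule Poly_bdd_measurable) (use T_bounded open_T in auto)
  have "\<exists>p\<in>Poly (k + 1). \<forall>w\<in>Poly (k + 1). energy p w = L w"
  proof (rule E.riesz_representation)
    show "finite (monomial ` {a :: 'n \<Rightarrow> nat. sum a UNIV \<le> k + 1})"
      by (intro finite_imageI finite_multi_indices)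
    show "Poly (k + 1) = span (monomial ` {a :: 'n \<Rightarrow> nat. sum a UNIV \<le> k + 1})"
      by (rule Poly_eq_span)
  next
    fix w u :: "real^'n \<Rightarrow> real" assume w: "w \<in> Poly (k + 1)" and u: "u \<in> Poly (k + 1)"
    have "divergence (\<lambda>x. K *v grad (w + u) x)
        = divergence (\<lambda>x. K *v grad w x) + divergence (\<lambda>x. K *v grad u x)"
      by (intro ext) (simp add: plus_fun_def [of w u] divergence_mult_grad_add [OF w u])
    moreover have "(\<lambda>x. (K *v grad (w + u) x) \<bullet> outer_normal T x)
        = (\<lambda>x. (K *v grad w x) \<bullet> outer_normal T x) + (\<lambda>x. (K *v grad u x) \<bullet> outer_normal T x)"
      by (intro ext) (simp add: plus_fun_def [of w u] grad_add [OF w u] matrix_vector_right_distrib inner_add_left)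
    ultimately show "L (w + u) = L w + L u"
      unfolding L_def
      by (simp add: VT.add_right VF.add_right mT [OF divergence_mult_grad_Poly [OF w]]
          mT [OF divergence_mult_grad_Poly [OF u]] mT [OF v1] flux_bdd_measurable [OF w]
          flux_bdd_measurable [OF u] v2m)
  next
    fix w :: "real^'n \<Rightarrow> real" and c assume w: "w \<in> Poly (k + 1)"
    have "divergence (\<lambda>x. K *v grad (c *\<^sub>R w) x) = c *\<^sub>R divergence (\<lambda>x. K *v grad w x)"
      by (intro ext) (simp add: scaleR_fun_def [of c w] divergence_mult_grad_scale [OF w])
    moreover have "(\<lambda>x. (K *v grad (c *\<^sub>R w) x) \<bullet> outer_normal T x)
        = c *\<^sub>R (\<lambda>x. (K *v grad w x) \<bullet> outer_normal T x)"
      by (intro ext) (simp add: scaleR_fun_def [of c w] grad_scale [OF w] matrix_vector_mult_scaleR)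
    ultimately show "L (c *\<^sub>R w) = c * L w"
      unfolding L_def
      by (simp add: VT.scale_right VF.scale_right mT [OF divergence_mult_grad_Poly [OF w]]
          mT [OF v1] flux_bdd_measurable [OF w] v2m algebra_simps)
  next
    fix w :: "real^'n \<Rightarrow> real" assume w: "w \<in> Poly (k + 1)" and "energy w w = 0"
    then have "grad w = (\<lambda>x. 0)"
      using energy_zero_imp_grad_zero by blast
    then show "L w = 0"
      using divergence_mult_grad [OF w, of K]
      by (simp add: L_def l2_inner_def grad_const)
  qed
  then obtain p where p: "p \<in> Poly (k + 1)" "\<And>w. w \<in> Poly (k + 1) \<Longrightarrow> energy p w = L w"
    by blast
  have int: "set_integrable lborel T f" if "f \<in> Poly l" for f l
    by (rule bdd_measurable_integrable [OF mT [OF that]]) (use open_T finite_volume in auto)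
  \<comment> \<open>The constant that moves the mean value of \<open>p\<close> to that of
    \<open>fst v\<close>; adding it changes no gradient.\<close>
  define c where "c = (LINT x:T|lborel. fst v x - p x) / (LINT x:T|lborel. (1::real))"
  define p' where "p' x = p x + c" for x
  have p': "p' \<in> Poly (k + 1)"
    unfolding p'_def [abs_def] by (intro Poly_add p Poly_const)
  have "grad p' = grad p"
    unfolding p'_def [abs_def] by (intro ext) (simp add: grad_add [OF p(1) Poly_const] grad_const)
  then have "energy p' w = L w" if "w \<in> Poly (k + 1)" for w
    using p(2) [OF that] by (simp add: energy_def)
  moreover have "(LINT x:T|lborel. p' x - fst v x) = 0"
  proof -
    have "(LINT x:T|lborel. p' x - fst v x) = (LINT x:T|lborel. c * 1 - (fst v x - p x))"
      by (simp add: p'_def algebra_simps)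
    also have "\<dots> = (LINT x:T|lborel. c * 1) - (LINT x:T|lborel. fst v x - p x)"
      by (intro set_integral_diff(2) set_integrable_mult_right set_integral_diff(1) int [OF v1] int [OF p(1)])
        (rule int [OF Poly_const])
    also have "\<dots> = 0"
      unfolding set_integral_mult_right using volume_nonzero by (simp add: c_def)
    finally show ?thesis .
  qed
  ultimately have "\<exists>p. p \<in> Poly (k + 1) \<and> (\<forall>w\<in>Poly (k + 1). l2_inner lborel T (\<lambda>x. K *v grad p x) (grad w) =
           - l2_inner lborel T (fst v) (divergence (\<lambda>x. K *v grad w x))
           + l2_inner surface (\<Union>\<F>) (snd v) (\<lambda>x. (K *v grad w x) \<bullet> outer_normal T x)) \<and>
        (LINT x:T|lborel. p x - fst v x) = 0"
    using p' by (intro exI [of _ p']) (simp add: energy_def L_def)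
  from someI_ex [OF this]
  show "reconstruction k K T \<F> v \<in> Poly (k + 1)"
    and "(LINT x:T|lborel. reconstruction k K T \<F> v x - fst v x) = 0"
    unfolding reconstruction_def by blast+
qed

end

section \<open>Inequalities on a mesh element\<close>

lemma set_integral_le_bound:
  fixes f :: "'a \<Rightarrow> real"
  assumes "set_integrable M X f" "X \<in> sets M" "emeasure M X < \<infinity>" "\<And>x. x \<in> X \<Longrightarrow> f x \<le> b"
  shows "(LINT x:X|M. f x) \<le> b * measure M X"
proof -
  have "set_integrable M X (\<lambda>x. b)"
    by (intro bdd_measurable_integrable bdd_measurable_const assms)
  then have "(LINT x:X|M. f x) \<le> (LINT x:X|M. b)"
    by (intro set_integral_mono assms)
  also have "\<dots> = b * measure M X"
    using assms(2,3) by (simp add: set_lebesgue_integral_def mult.commute)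
  finally show ?thesis .
qed

text \<open>The bound \<open>local_bound\<close> is what \<open>Poly_local_bound\<close> provides, with a constant independent
  of the element.\<close>

locale regular_mesh_element = mesh_element T K \<nu> \<F> Kmin Kmax
  for T :: "(real^'n) set" and K \<nu> \<F> Kmin Kmax +
  fixes z :: "real^'n" and A C :: real and l :: nat
  assumes centre: "z \<in> T"
    and area: "emeasure surface (frontier T) \<le> ennreal (A * diameter T ^ (CARD('n) - 1))" and A: "0 \<le> A"
    and C: "0 < C"
    and local_bound: "\<And>p x. \<lbrakk>p \<in> Poly l; norm (x - z) \<le> diameter T\<rbrakk> \<Longrightarrow>
      (p x)\<^sup>2 \<le> C / diameter T ^ CARD('n) * l2_inner lborel T p p \<and>
      (diameter T)\<^sup>2 * (norm (grad p x))\<^sup>2 \<le> C / diameter T ^ CARD('n) * l2_inner lborel T p p"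
begin

abbreviation h :: real where "h \<equiv> diameter T"

lemma h_pos: "h > 0"
  by (rule domain_diameter_pos [OF T_domain T_bounded])

lemma dist_centre:
  assumes "x \<in> closure T"
  shows "norm (x - z) \<le> h"
  using diameter_bounded_bound [of "closure T" x z] assms centre closure_subset [of T] T_bounded
  by (auto simp: dist_norm diameter_closure bounded_closure)

lemma volume_le: "measure lborel T \<le> unit_ball_vol (real CARD('n)) * h ^ CARD('n)"
proof -
  have "T \<subseteq> cball z h"
    using dist_centre closure_subset [of T] by (auto simp: dist_norm norm_minus_commute subset_iff)
  then have "measure lborel T \<le> measure lborel (cball z h)"
    by (intro measure_mono_fmeasurable) (use emeasure_lborel_cball_finite [of z h] in \<open>auto simp: T_borel fmeasurable_def\<close>)
  then show ?thesis
    using h_pos by (simp add: content_cball)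
qed

lemma volume_pos: "measure lborel T > 0"
  using volume_nonzero T_borel finite_volume zero_less_measure_iff [of lborel T]
  by (simp add: set_lebesgue_integral_def)

lemma Poly_bdd_measurable_T: "p \<in> Poly m \<Longrightarrow> p \<in> bdd_measurable lborel T"
  by (rule Poly_bdd_measurable) (use T_bounded T_borel in auto)

lemma Poly_bdd_measurable_faces: "p \<in> Poly m \<Longrightarrow> p \<in> bdd_measurable surface (\<Union>\<F>)"
  by (rule Poly_bdd_measurable) (use faces_bounded faces_borel in auto)

lemma l2_le_bound:
  assumes "p \<in> Poly m" "\<And>x. x \<in> T \<Longrightarrow> (p x)\<^sup>2 \<le> b" "0 \<le> b"
  shows "l2_inner lborel T p p \<le> b * (unit_ball_vol (real CARD('n)) * h ^ CARD('n))"
proof -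
  have "l2_inner lborel T p p \<le> b * measure lborel T"
    unfolding l2_inner_def
  proof (rule set_integral_le_bound)
    show "set_integrable lborel T (\<lambda>x. p x \<bullet> p x)"
      unfolding inner_real_def using assms(1) finite_volume T_borel
      by (intro bdd_measurable_integrable bdd_measurable_mult Poly_bdd_measurable_T) auto
  qed (use assms finite_volume T_borel in \<open>auto simp: power2_eq_square\<close>)
  also have "\<dots> \<le> b * (unit_ball_vol (real CARD('n)) * h ^ CARD('n))"
    by (intro mult_left_mono volume_le assms)
  finally show ?thesis .
qed

lemma l2_nonneg: "0 \<le> l2_inner M X f f"
  unfolding l2_inner_def set_lebesgue_integral_def
  by (rule Bochner_Integration.integral_nonneg) (simp add: indicator_def)

lemma dirichlet_nonneg: "0 \<le> dirichlet w"
  unfolding dirichlet_def by (rule l2_nonneg)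

text \<open>Integrates the pointwise gradient bound; the volume of \<open>T\<close> is at most a
  multiple of \<open>h ^ CARD('n)\<close>, which cancels the denominator.\<close>

lemma inverse_inequality:
  assumes "w \<in> Poly l"
  shows "h\<^sup>2 * dirichlet w \<le> unit_ball_vol (real CARD('n)) * C * l2_inner lborel T w w"
proof -
  define b where "b = C / h ^ CARD('n) * l2_inner lborel T w w / h\<^sup>2"
  have b0: "0 \<le> b"
    using h_pos C l2_nonneg [of lborel T w] by (simp add: b_def)
  have "dirichlet w \<le> b * measure lborel T"
    unfolding dirichlet_def l2_inner_def [of lborel T "grad w"]
  proof (rule set_integral_le_bound)
    fix x assume "x \<in> T"
    then have "h\<^sup>2 * (norm (grad w x))\<^sup>2 \<le> C / h ^ CARD('n) * l2_inner lborel T w w"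
      using local_bound [OF assms] dist_centre closure_subset by blast
    then show "grad w x \<bullet> grad w x \<le> b"
      using h_pos by (simp add: b_def pos_le_divide_eq mult_ac dot_square_norm)
  qed (use dirichlet_integrable [OF assms] finite_volume T_borel in auto)
  also have "\<dots> \<le> b * (unit_ball_vol (real CARD('n)) * h ^ CARD('n))"
    by (intro mult_left_mono volume_le b0)
  finally have "h\<^sup>2 * dirichlet w \<le> h\<^sup>2 * (b * (unit_ball_vol (real CARD('n)) * h ^ CARD('n)))"
    by (intro mult_left_mono) auto
  also have "\<dots> = unit_ball_vol (real CARD('n)) * C * l2_inner lborel T w w"
    using h_pos by (simp add: b_def field_simps)
  finally show ?thesis .
qed

lemma dirichlet_eq_sum:
  assumes "w \<in> Poly m"
  shows "dirichlet w = (\<Sum>i\<in>UNIV. l2_inner lborel T (\<lambda>x. grad w x $ i) (\<lambda>x. grad w x $ i))"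
proof -
  have "set_integrable lborel T (\<lambda>x. grad w x $ i * grad w x $ i)" for i
    using finite_volume T_borel Poly_partial [OF assms]
    by (intro bdd_measurable_integrable bdd_measurable_mult Poly_bdd_measurable_T) auto
  then show ?thesis
    unfolding dirichlet_def l2_inner_def set_lebesgue_integral_def set_integrable_def inner_vec_def
      inner_real_def scaleR_sum_right
    by (intro Bochner_Integration.integral_sum)
qed

text \<open>The ball of radius \<open>h\<close> around \<open>z\<close> is convex and contains
  \<open>closure T\<close>, so the mean value theorem applies in it. The gradient is bounded there
  because \<open>local_bound\<close> holds for each of its components.\<close>

lemma oscillation_bound:
  assumes w: "w \<in> Poly l" and x: "x \<in> closure T"
  shows "(w x - w z)\<^sup>2 \<le> C * h\<^sup>2 / h ^ CARD('n) * dirichlet w"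
proof -
  define b where "b = C / h ^ CARD('n) * dirichlet w"
  have b0: "0 \<le> b"
    using h_pos C dirichlet_nonneg by (simp add: b_def)
  have grad_le: "norm (grad w y) \<le> sqrt b" if y: "norm (y - z) \<le> h" for y
  proof (rule real_le_rsqrt)
    have "(norm (grad w y))\<^sup>2 = (\<Sum>i\<in>UNIV. (grad w y $ i)\<^sup>2)"
      unfolding power2_norm_eq_inner inner_vec_def by (simp add: power2_eq_square)
    also have "\<dots> \<le> (\<Sum>i\<in>UNIV. C / h ^ CARD('n) * l2_inner lborel T (\<lambda>x. grad w x $ i) (\<lambda>x. grad w x $ i))"
      using local_bound [OF Poly_partial [OF w] y] by (intro sum_mono) blast
    also have "\<dots> = b"
      by (simp add: b_def dirichlet_eq_sum [OF w] sum_distrib_left)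
    finally show "(norm (grad w y))\<^sup>2 \<le> b" .
  qed
  have "norm (w x - w z) \<le> sqrt b * norm (x - z)"
  proof (rule differentiable_bound [of "cball z h"])
    show "(w has_derivative (\<lambda>v. v \<bullet> grad w y)) (at y within cball z h)" for y
      using Poly_has_derivative [OF w] by (rule has_derivative_at_withinI)
    show "onorm (\<lambda>v. v \<bullet> grad w y) \<le> sqrt b" if "y \<in> cball z h" for y
    proof (rule onorm_le)
      fix v
      have "norm (v \<bullet> grad w y) \<le> norm v * norm (grad w y)"
        using Cauchy_Schwarz_ineq2 by simp
      also have "\<dots> \<le> norm v * sqrt b"
        using that by (intro mult_left_mono grad_le) (auto simp: dist_norm norm_minus_commute)
      finally show "norm (v \<bullet> grad w y) \<le> sqrt b * norm v"
        by (simp add: mult.commute)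
    qed
  qed (use dist_centre [OF x] h_pos in \<open>auto simp: dist_norm norm_minus_commute\<close>)
  also have "\<dots> \<le> sqrt b * h"
    using b0 by (intro mult_left_mono dist_centre x) auto
  finally have "(norm (w x - w z))\<^sup>2 \<le> (sqrt b * h)\<^sup>2"
    by (intro power_mono) auto
  then show ?thesis
    using b0 by (simp add: power_mult_distrib b_def mult_ac)
qed

text \<open>On \<open>T\<close> the values stay within \<open>s\<close> of \<open>w z\<close>; a
  zero mean then forces \<open>w z\<close> itself to be at most \<open>s\<close> in absolute value.
  The resulting bound \<open>2 * s\<close> gives the factor 4 after squaring.\<close>

lemma mean_zero_bound:
  assumes w: "w \<in> Poly l" and mean: "(LINT x:T|lborel. w x) = 0" and x: "x \<in> closure T"
  shows "(w x)\<^sup>2 \<le> 4 * (C * h\<^sup>2 / h ^ CARD('n) * dirichlet w)"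
proof -
  define s where "s = sqrt (C * h\<^sup>2 / h ^ CARD('n) * dirichlet w)"
  have s0: "0 \<le> C * h\<^sup>2 / h ^ CARD('n) * dirichlet w"
    using h_pos C dirichlet_nonneg by simp
  have osc: "\<bar>w y - w z\<bar> \<le> s" if "y \<in> closure T" for y
    unfolding s_def by (rule real_le_rsqrt) (use oscillation_bound [OF w that] in simp)
  have int: "set_integrable lborel T w" "set_integrable lborel T (\<lambda>x. - w x)"
    using finite_volume T_borel w Poly_bdd_measurable_T [OF Poly_scale [OF w, of "-1"]]
    by (auto intro!: bdd_measurable_integrable Poly_bdd_measurable_T)
  have T_osc: "w y \<le> w z + s" "- w y \<le> s - w z" if "y \<in> T" for y
    using osc [of y] that closure_subset by (force simp: abs_le_iff)+
  have "0 \<le> (w z + s) * measure lborel T"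
    using set_integral_le_bound [OF int(1) _ finite_volume T_osc(1)] T_borel mean by simp
  moreover have "0 \<le> (s - w z) * measure lborel T"
    using set_integral_le_bound [OF int(2) _ finite_volume T_osc(2)] T_borel mean
    by (simp add: set_integral_uminus int)
  ultimately have "\<bar>w z\<bar> \<le> s"
    using volume_pos by (auto simp: zero_le_mult_iff abs_le_iff)
  then have "\<bar>w x\<bar> \<le> 2 * s"
    using osc [OF x] by linarith
  then have "\<bar>w x\<bar>\<^sup>2 \<le> (2 * s)\<^sup>2"
    by (intro power_mono) auto
  then show ?thesis
    using s0 by (simp add: s_def power_mult_distrib)
qed

lemma area_le: "measure surface (\<Union>\<F>) \<le> A * h ^ (CARD('n) - 1)"
  unfolding measure_def
  by (rule enn2real_leI) (use order_trans [OF faces_area area] A h_pos in auto)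

lemma faces_l2_le_bound:
  assumes "f \<in> bdd_measurable surface (\<Union>\<F>)" "\<And>x. x \<in> \<Union>\<F> \<Longrightarrow> (f x)\<^sup>2 \<le> b" "0 \<le> b"
  shows "l2_inner surface (\<Union>\<F>) f f \<le> b * (A * h ^ (CARD('n) - 1))"
proof -
  have "l2_inner surface (\<Union>\<F>) f f \<le> b * measure surface (\<Union>\<F>)"
    unfolding l2_inner_def
  proof (rule set_integral_le_bound)
    show "set_integrable surface (\<Union>\<F>) (\<lambda>x. f x \<bullet> f x)"
      unfolding inner_real_def using assms(1) faces_finite_area faces_borel
      by (intro bdd_measurable_integrable bdd_measurable_mult) auto
  qed (use assms faces_finite_area faces_borel in \<open>auto simp: power2_eq_square\<close>)
  also have "\<dots> \<le> b * (A * h ^ (CARD('n) - 1))"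
    by (intro mult_left_mono area_le assms)
  finally show ?thesis .
qed

section \<open>The weighted product on the faces\<close>

lemma bd_integrable:
  assumes "f \<in> bdd_measurable surface (\<Union>\<F>)" "g \<in> bdd_measurable surface (\<Union>\<F>)"
  shows "set_integrable surface (\<Union>\<F>) (\<lambda>x. ((K *v outer_normal T x) \<bullet> outer_normal T x) * f x * g x)"
  by (intro bdd_measurable_integrable bdd_measurable_mult normal_weight_bdd_measurable assms)
    (use faces_borel faces_finite_area in auto)

lemma bd_semi_inner_product: "semi_inner_product (bdd_measurable surface (\<Union>\<F>)) (bd_inner K T \<F>)"
proof
  let ?S = "bdd_measurable surface (\<Union>\<F>)"
  show "subspace ?S"
    by (rule subspace_bdd_measurable) (simp add: faces_borel)
  show "bd_inner K T \<F> (f + g) u = bd_inner K T \<F> f u + bd_inner K T \<F> g u"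
    if "f \<in> ?S" "g \<in> ?S" "u \<in> ?S" for f g u
    using set_integral_add(2) [OF bd_integrable [OF that(1,3)] bd_integrable [OF that(2,3)]]
    by (simp add: bd_inner_def l2_inner_def distrib_left distrib_right)
  show "bd_inner K T \<F> (c *\<^sub>R f) u = c * bd_inner K T \<F> f u" for c f u
    unfolding bd_inner_def l2_inner_def set_integral_mult_right [symmetric]
    by (simp add: mult_ac)
  show "bd_inner K T \<F> f u = bd_inner K T \<F> u f" for f u
    unfolding bd_inner_def l2_inner_def by (simp add: mult_ac)
  show "0 \<le> bd_inner K T \<F> f f" for f
    unfolding bd_inner_def l2_inner_def set_lebesgue_integral_def
    by (rule Bochner_Integration.integral_nonneg) (simp add: indicator_def K_nonneg mult.assoc)
qed

lemma bd_inner_le: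
  assumes "f \<in> bdd_measurable surface (\<Union>\<F>)"
  shows "bd_inner K T \<F> f f \<le> Kmax * l2_inner surface (\<Union>\<F>) f f"
proof -
  have "(LINT x:\<Union>\<F>|surface. ((K *v outer_normal T x) \<bullet> outer_normal T x) * f x * f x)
      \<le> (LINT x:\<Union>\<F>|surface. Kmax * (f x * f x))"
  proof (rule set_integral_mono_AE)
    show "set_integrable surface (\<Union>\<F>) (\<lambda>x. Kmax * (f x * f x))"
      using faces_borel faces_finite_area assms
      by (intro set_integrable_mult_right bdd_measurable_integrable bdd_measurable_mult) auto
    show "AE x\<in>\<Union>\<F> in surface. ((K *v outer_normal T x) \<bullet> outer_normal T x) * f x * f x \<le> Kmax * (f x * f x)"
      using normal_weight_le
    proof eventually_elim
      case (elim x)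
      then show ?case
        by (auto simp: mult.assoc intro!: mult_right_mono)
    qed
  qed (rule bd_integrable [OF assms assms])
  then show ?thesis
    by (simp add: bd_inner_def l2_inner_def)
qed

end

section \<open>The norm estimate\<close>

context regular_mesh_element
begin

lemma proj_faces_eq:
  assumes "F \<in> \<F>" "x \<in> F"
  shows "proj_faces k \<nu> \<F> f x = proj_face k (\<nu> F) F f x"
proof -
  have "indicator G x * proj_face k (\<nu> G) G f x = (if G = F then proj_face k (\<nu> F) F f x else 0)"
    if "G \<in> \<F>" for G
    using assms that disjoint_faces by (auto simp: indicator_def disjoint_def)
  then show ?thesis
    using assms(1) finite_faces by (simp add: proj_faces_def)
qed

text \<open>Each face projection is a best approximation, and \<open>FacePoly\<close> contains the
  constants even on curved faces, so the same \<open>c\<close> competes on all of them. The bounds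
  add up since the faces are disjoint.\<close>

lemma proj_faces_properties:
  assumes p: "p \<in> Poly m"
  shows "proj_faces k \<nu> \<F> p \<in> bdd_measurable surface (\<Union>\<F>)"
    and "l2_inner surface (\<Union>\<F>) (\<lambda>x. p x - proj_faces k \<nu> \<F> p x) (\<lambda>x. p x - proj_faces k \<nu> \<F> p x)
      \<le> l2_inner surface (\<Union>\<F>) (\<lambda>x. p x - c) (\<lambda>x. p x - c)"
proof -
  have pF: "p \<in> bdd_measurable surface F" if "F \<in> \<F>" for F
    using p by (rule Poly_bdd_measurable) (use that face_bounded face_borel in auto)
  have face_proj: "proj_face k (\<nu> F) F p \<in> FacePoly k (\<nu> F) F"
    "\<And>q. q \<in> FacePoly k (\<nu> F) F \<Longrightarrow> l2_inner surface F (\<lambda>x. p x - proj_face k (\<nu> F) F p x) q = 0"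
    if "F \<in> \<F>" for F
    using face that
    by (auto intro!: proj_face_properties face_borel face_bounded face_finite_area pF)
  show m: "proj_faces k \<nu> \<F> p \<in> bdd_measurable surface (\<Union>\<F>)"
    by (rule faces_bdd_measurable) (rule FacePoly_cong [OF face_proj(1) proj_faces_eq])
  have split: "l2_inner surface (\<Union>\<F>) f f = (\<Sum>F\<in>\<F>. l2_inner surface F f f)"
    if f: "f \<in> bdd_measurable surface (\<Union>\<F>)" for f
  proof -
    have "set_integrable surface (\<Union>\<F>) (\<lambda>x. f x \<bullet> f x)"
      unfolding inner_real_def using f faces_finite_area faces_borel
      by (intro bdd_measurable_integrable bdd_measurable_mult) auto
    then have "set_integrable surface F (\<lambda>x. f x \<bullet> f x)" if "F \<in> \<F>" for F
      by (rule set_integrable_subset) (use that face_borel in auto)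
    moreover have "disjoint_family_on (\<lambda>F. F) \<F>"
      using disjoint_faces by (auto simp: disjoint_def disjoint_family_on_def)
    ultimately show ?thesis
      unfolding l2_inner_def
      using set_integral_finite_Union [of \<F> "\<lambda>F. F" surface "\<lambda>x. f x \<bullet> f x"] finite_faces face_borel
      by simp
  qed
  have "l2_inner surface F (\<lambda>x. p x - proj_faces k \<nu> \<F> p x) (\<lambda>x. p x - proj_faces k \<nu> \<F> p x)
      \<le> l2_inner surface F (\<lambda>x. p x - c) (\<lambda>x. p x - c)" if F: "F \<in> \<F>" for F
  proof -
    interpret semi_inner_product "bdd_measurable surface F" "l2_inner surface F"
      by (rule l2_inner_semi_inner_product) (use F face_borel face_finite_area in auto)
    let ?q = "proj_face k (\<nu> F) F p"
    have "?q \<in> bdd_measurable surface F"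
      using face [OF F] by (intro FacePoly_bdd_measurable [OF _ face_borel face_bounded face_proj(1)] F) auto
    moreover have "(\<lambda>x. c) \<in> bdd_measurable surface F"
      using F by (intro bdd_measurable_const) (simp add: face_borel)
    ultimately have "l2_inner surface F (p - ?q) (p - ?q) \<le> l2_inner surface F (p - (\<lambda>x. c)) (p - (\<lambda>x. c))"
      using face_proj [OF F] FacePoly_const [of c k "\<nu> F" F]
      by (intro projection_minimal pF F) (auto simp: fun_diff_def)
    moreover have "l2_inner surface F (\<lambda>x. p x - proj_faces k \<nu> \<F> p x) (\<lambda>x. p x - proj_faces k \<nu> \<F> p x)
        = l2_inner surface F (p - ?q) (p - ?q)"
      unfolding l2_inner_def using proj_faces_eq [OF F] face_borel [OF F]
      by (intro set_lebesgue_integral_cong) auto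
    ultimately show ?thesis
      by (simp add: fun_diff_def)
  qed
  then have "(\<Sum>F\<in>\<F>. l2_inner surface F (\<lambda>x. p x - proj_faces k \<nu> \<F> p x) (\<lambda>x. p x - proj_faces k \<nu> \<F> p x))
      \<le> (\<Sum>F\<in>\<F>. l2_inner surface F (\<lambda>x. p x - c) (\<lambda>x. p x - c))"
    by (rule sum_mono)
  then show "l2_inner surface (\<Union>\<F>) (\<lambda>x. p x - proj_faces k \<nu> \<F> p x) (\<lambda>x. p x - proj_faces k \<nu> \<F> p x)
      \<le> l2_inner surface (\<Union>\<F>) (\<lambda>x. p x - c) (\<lambda>x. p x - c)"
    by (subst (1 2) split) (auto intro!: bdd_measurable_diff bdd_measurable_const m
        Poly_bdd_measurable_faces [OF p] simp: faces_borel)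
qed

lemma discrete_norm_sq:
  assumes "snd v \<in> bdd_measurable surface (\<Union>\<F>)" "fst v \<in> Poly m"
  shows "(discrete_norm K T \<F> v)\<^sup>2 = energy (fst v) (fst v)
    + inverse h * bd_inner K T \<F> (\<lambda>x. snd v x - fst v x) (\<lambda>x. snd v x - fst v x)"
proof -
  interpret E: semi_inner_product "Poly m" energy
    by (rule energy_semi_inner_product)
  interpret B: semi_inner_product "bdd_measurable surface (\<Union>\<F>)" "bd_inner K T \<F>"
    by (rule bd_semi_inner_product)
  have d: "(\<lambda>x. snd v x - fst v x) \<in> bdd_measurable surface (\<Union>\<F>)"
    by (intro bdd_measurable_diff assms Poly_bdd_measurable_faces [OF assms(2)]) (simp add: faces_borel)
  have "(H1_seminorm K T (fst v))\<^sup>2 = energy (fst v) (fst v)"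
    using E.nonneg [OF assms(2)]
    by (simp add: H1_seminorm_def l2_norm_def energy_def l2_inner_def mat_sqrt_inner K_sym K_nonneg)
  moreover have "(bd_norm K T \<F> (\<lambda>x. snd v x - fst v x))\<^sup>2
      = bd_inner K T \<F> (\<lambda>x. snd v x - fst v x) (\<lambda>x. snd v x - fst v x)"
    using B.nonneg [OF d] by (simp add: bd_norm_def)
  ultimately show ?thesis
    using E.nonneg [OF assms(2)] B.nonneg [OF d] h_pos by (simp add: discrete_norm_def)
qed

text \<open>The degree of the reconstruction is \<open>k + 1\<close>. In the constant, the volume of
  the unit ball comes from integrating over the element, \<open>C\<close> from norm equivalence and
  \<open>A\<close> from the area of the boundary.\<close>

lemma discrete_norm_le_form:
  assumes l: "l = k + 1" and Kmax: "Kmin \<le> Kmax" and v: "v \<in> local_space k \<nu> \<F>"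
  shows "(discrete_norm K T \<F> v)\<^sup>2
    \<le> (4 + 4 * (unit_ball_vol (real CARD('n)) * C)\<^sup>2 + 20 * C * A + 4 * unit_ball_vol (real CARD('n)) * C\<^sup>2 * A)
      * (Kmax / Kmin * local_form k K T \<F> (gradient_stabilisation k K T \<nu> \<F>) v v)"
proof -
  let ?w = "unit_ball_vol (real CARD('n))"
  define n where "n = CARD('n)"
  define p where "p = reconstruction k K T \<F> v"
  define \<pi> where "\<pi> = proj_elem k T p"
  define \<pi>F where "\<pi>F = proj_faces k \<nu> \<F> p"
  define r where "r x = p x - \<pi> x" for x
  define e where "e x = fst v x - \<pi> x" for x
  define a where "a x = snd v x - \<pi>F x" for x
  define b where "b x = p x - \<pi>F x" for x
  define D where "D = dirichlet p"
  interpret E: semi_inner_product "Poly l" energy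
    by (rule energy_semi_inner_product)
  interpret B: semi_inner_product "bdd_measurable surface (\<Union>\<F>)" "bd_inner K T \<F>"
    by (rule bd_semi_inner_product)
  interpret L: semi_inner_product "bdd_measurable lborel T" "l2_inner lborel T"
    by (rule l2_inner_semi_inner_product) (use open_T finite_volume in auto)
  have hn: "h ^ n = h * h ^ (n - 1)"
    unfolding n_def by (metis One_nat_def Suc_pred power_Suc zero_less_card_finite)
  have w0: "0 \<le> ?w"
    by simp
  have Kmax0: "0 < Kmax"
    using Kmin Kmax by simp
  have v1: "fst v \<in> Poly k" and v2F: "\<And>F. F \<in> \<F> \<Longrightarrow> snd v \<in> FacePoly k (\<nu> F) F"
    using v by (auto simp: local_space_def)
  have v1l: "fst v \<in> Poly l"
    using v1 Poly_mono [of k l] l by auto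
  have v2: "snd v \<in> bdd_measurable surface (\<Union>\<F>)"
    by (rule faces_bdd_measurable [OF v2F])
  have p: "p \<in> Poly l" and p_mean: "(LINT x:T|lborel. p x - fst v x) = 0"
    using reconstruction_properties [OF v] by (auto simp: p_def l)
  have \<pi>k: "\<pi> \<in> Poly k" and \<pi>_orth: "\<And>q. q \<in> Poly k \<Longrightarrow> l2_inner lborel T (\<lambda>x. p x - \<pi> x) q = 0"
    unfolding \<pi>_def by (rule proj_elem_properties [OF T_borel T_bounded Poly_bdd_measurable_T [OF p]])+
  have \<pi>: "\<pi> \<in> Poly l"
    using \<pi>k Poly_mono [of k l] l by auto
  have r: "r \<in> Poly l" and e: "e \<in> Poly l"
    unfolding r_def [abs_def] e_def [abs_def] by (intro Poly_diff p \<pi> v1l)+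
  have \<pi>F: "\<pi>F \<in> bdd_measurable surface (\<Union>\<F>)"
    unfolding \<pi>F_def by (rule proj_faces_properties [OF p])
  have a: "a \<in> bdd_measurable surface (\<Union>\<F>)" and b: "b \<in> bdd_measurable surface (\<Union>\<F>)"
    unfolding a_def [abs_def] b_def [abs_def]
    by (intro bdd_measurable_diff v2 \<pi>F Poly_bdd_measurable_faces [OF p]; simp add: faces_borel)+
  have rm: "r \<in> bdd_measurable surface (\<Union>\<F>)" and em: "e \<in> bdd_measurable surface (\<Union>\<F>)"
    using Poly_bdd_measurable_faces r e by auto
  have closure: "x \<in> closure T" if "x \<in> T \<or> x \<in> \<Union>\<F>" for x
    using that closure_subset faces_subset by (auto simp: frontier_def)
  have D0: "0 \<le> D"
    unfolding D_def by (rule dirichlet_nonneg)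

  have osc: "(p x - p z)\<^sup>2 \<le> C * h\<^sup>2 / h ^ n * D" if "x \<in> closure T" for x
    using oscillation_bound [OF p that] by (simp add: D_def n_def)
  have osc0: "0 \<le> C * h\<^sup>2 / h ^ n * D"
    using C h_pos D0 by simp
  \<comment> \<open>The constant \<open>p z\<close> competes with the projection; it lies in
    \<open>Poly k\<close> also for \<open>k = 0\<close>.\<close>
  have R: "l2_inner lborel T r r \<le> ?w * C * h\<^sup>2 * D"
  proof -
    have pz: "(\<lambda>x. p x - p z) \<in> Poly l"
      by (intro Poly_diff p Poly_const)
    have "l2_inner lborel T (p - \<pi>) (p - \<pi>) \<le> l2_inner lborel T (p - (\<lambda>x. p z)) (p - (\<lambda>x. p z))"
      using \<pi>_orth [OF \<pi>k] \<pi>_orth [OF Poly_const]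
      by (intro L.projection_minimal Poly_bdd_measurable_T [OF p] Poly_bdd_measurable_T [OF \<pi>k]
          Poly_bdd_measurable_T [OF Poly_const]) (auto simp: fun_diff_def)
    moreover have "p - \<pi> = r" "p - (\<lambda>x. p z) = (\<lambda>x. p x - p z)"
      by (auto simp: r_def)
    ultimately have "l2_inner lborel T r r \<le> l2_inner lborel T (\<lambda>x. p x - p z) (\<lambda>x. p x - p z)"
      by simp
    also have "\<dots> \<le> C * h\<^sup>2 / h ^ n * D * (?w * h ^ n)"
      unfolding n_def by (rule l2_le_bound [OF pz]) (use osc osc0 closure in \<open>auto simp: n_def\<close>)
    also have "\<dots> = ?w * C * h\<^sup>2 * D"
      using h_pos by simp
    finally show ?thesis .
  qed
  \<comment> \<open>The inverse inequality uses up the factor \<open>h\<^sup>2\<close> gained in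
    \<open>R\<close>: the Dirichlet energy of the projection error is controlled by that of
    \<open>p\<close>.\<close>
  have Dr: "dirichlet r \<le> (?w * C)\<^sup>2 * D"
  proof -
    have "h\<^sup>2 * dirichlet r \<le> ?w * C * l2_inner lborel T r r"
      by (rule inverse_inequality [OF r])
    also have "\<dots> \<le> ?w * C * (?w * C * h\<^sup>2 * D)"
      using C w0 R by (intro mult_left_mono) auto
    also have "\<dots> = h\<^sup>2 * ((?w * C)\<^sup>2 * D)"
      by (simp add: power2_eq_square)
    finally show ?thesis
      using h_pos by simp
  qed
  \<comment> \<open>Powers of \<open>h\<close>: the scaling of the norm gives -1, the pointwise
    bound \<open>2 - n\<close> and the area \<open>n - 1\<close>, which add up to 0.\<close>
  have face_bound: "inverse h * bd_inner K T \<F> f f \<le> Kmax * c * A"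
    if f: "f \<in> bdd_measurable surface (\<Union>\<F>)" and c: "0 \<le> c"
      and le: "l2_inner surface (\<Union>\<F>) f f \<le> c * h\<^sup>2 / h ^ n * (A * h ^ (n - 1))" for f c
  proof -
    have "bd_inner K T \<F> f f \<le> Kmax * (c * h\<^sup>2 / h ^ n * (A * h ^ (n - 1)))"
      using bd_inner_le [OF f] le Kmax0 by (meson less_imp_le mult_left_mono order_trans)
    also have "\<dots> = h * (Kmax * c * A)"
      using h_pos by (simp add: hn power2_eq_square)
    finally show ?thesis
      using h_pos by (simp add: field_simps)
  qed
  have Bb: "inverse h * bd_inner K T \<F> b b \<le> Kmax * (C * D) * A"
  proof (rule face_bound [OF b])
    have "l2_inner surface (\<Union>\<F>) b b \<le> l2_inner surface (\<Union>\<F>) (\<lambda>x. p x - p z) (\<lambda>x. p x - p z)"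
      unfolding b_def [abs_def] \<pi>F_def by (rule proj_faces_properties [OF p])
    also have "\<dots> \<le> C * h\<^sup>2 / h ^ n * D * (A * h ^ (n - 1))"
      unfolding n_def
      by (rule faces_l2_le_bound) (use osc osc0 closure in
          \<open>auto simp: n_def intro!: Poly_bdd_measurable_faces [OF Poly_diff [OF p Poly_const]]\<close>)
    finally show "l2_inner surface (\<Union>\<F>) b b \<le> C * D * h\<^sup>2 / h ^ n * (A * h ^ (n - 1))"
      by (simp add: mult_ac)
  qed (use C D0 in auto)
  \<comment> \<open>Unlike \<open>b\<close>, the error \<open>r\<close> is no best approximation on
    the faces; its pointwise bound comes from its norm on \<open>T\<close>.\<close>
  have Br: "inverse h * bd_inner K T \<F> r r \<le> Kmax * (?w * C\<^sup>2 * D) * A"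
  proof (rule face_bound [OF rm])
    show "l2_inner surface (\<Union>\<F>) r r \<le> ?w * C\<^sup>2 * D * h\<^sup>2 / h ^ n * (A * h ^ (n - 1))"
      unfolding n_def
    proof (rule faces_l2_le_bound [OF rm])
      fix x assume "x \<in> \<Union>\<F>"
      then have "(r x)\<^sup>2 \<le> C / h ^ n * l2_inner lborel T r r"
        using local_bound [OF r] dist_centre closure by (auto simp: n_def)
      also have "\<dots> \<le> C / h ^ n * (?w * C * h\<^sup>2 * D)"
        using C h_pos R by (intro mult_left_mono) auto
      finally show "(r x)\<^sup>2 \<le> ?w * C\<^sup>2 * D * h\<^sup>2 / h ^ CARD('n)"
        by (simp add: power2_eq_square n_def mult_ac)
    qed (use C D0 w0 h_pos in auto)
  qed (use C D0 w0 in auto)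
  have Be: "inverse h * bd_inner K T \<F> e e \<le> Kmax * (4 * C * dirichlet e) * A"
  proof (rule face_bound [OF em])
    \<comment> \<open>The mean value of \<open>p\<close> agrees with that of \<open>fst v\<close> by
      the normalisation of the reconstruction, and with that of \<open>\<pi>\<close> by
      orthogonality to constants.\<close>
    have "(LINT x:T|lborel. e x) = 0"
    proof -
      have int: "set_integrable lborel T f" if "f \<in> Poly l" for f
        by (rule bdd_measurable_integrable [OF Poly_bdd_measurable_T [OF that]])
          (use open_T finite_volume in auto)
      have "(LINT x:T|lborel. r x) = 0"
        using \<pi>_orth [OF Poly_const, of 1] by (simp add: l2_inner_def r_def)
      moreover have "(LINT x:T|lborel. e x) = (LINT x:T|lborel. r x - (p x - fst v x))"
        by (simp add: e_def r_def)
      ultimately show ?thesis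
        using p_mean set_integral_diff(2) [OF int [OF r] int [OF Poly_diff [OF p v1l]]] by simp
    qed
    from mean_zero_bound [OF e this]
    show "l2_inner surface (\<Union>\<F>) e e \<le> 4 * C * dirichlet e * h\<^sup>2 / h ^ n * (A * h ^ (n - 1))"
      unfolding n_def
      by (intro faces_l2_le_bound em) (use C h_pos closure dirichlet_nonneg in \<open>auto simp: mult_ac\<close>)
  qed (use C dirichlet_nonneg in auto)

  define \<alpha> where "\<alpha> = Kmax / Kmin"
  have \<alpha>1: "1 \<le> \<alpha>"
    using Kmin Kmax by (simp add: \<alpha>_def)
  \<comment> \<open>The ratio arises here, as \<open>\<alpha> * Kmin = Kmax\<close>.\<close>
  have weighted: "Kmax * dirichlet w \<le> \<alpha> * energy w w" if "w \<in> Poly l" for w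
  proof -
    have "\<alpha> * (Kmin * dirichlet w) \<le> \<alpha> * energy w w"
      using \<alpha>1 dirichlet_le_energy [OF that] by (intro mult_left_mono) auto
    then show ?thesis
      using Kmin by (simp add: \<alpha>_def)
  qed
  have KD: "Kmax * D \<le> \<alpha> * energy p p"
    unfolding D_def by (rule weighted [OF p])
  have Er: "energy r r \<le> (?w * C)\<^sup>2 * (\<alpha> * energy p p)"
  proof -
    have "energy r r \<le> Kmax * ((?w * C)\<^sup>2 * D)"
      using energy_le_dirichlet [OF r] Dr Kmax0 by (meson less_imp_le mult_left_mono order_trans)
    also have "\<dots> = (?w * C)\<^sup>2 * (Kmax * D)"
      by simp
    also have "\<dots> \<le> (?w * C)\<^sup>2 * (\<alpha> * energy p p)"
      by (intro mult_left_mono KD) auto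
    finally show ?thesis .
  qed
  have Bb': "inverse h * bd_inner K T \<F> b b \<le> C * A * (\<alpha> * energy p p)"
  proof -
    have "C * A * (Kmax * D) \<le> C * A * (\<alpha> * energy p p)"
      using C A by (intro mult_left_mono KD) auto
    then show ?thesis
      using Bb by (simp add: mult_ac)
  qed
  have Br': "inverse h * bd_inner K T \<F> r r \<le> ?w * C\<^sup>2 * A * (\<alpha> * energy p p)"
  proof -
    have "?w * C\<^sup>2 * A * (Kmax * D) \<le> ?w * C\<^sup>2 * A * (\<alpha> * energy p p)"
      using C A w0 by (intro mult_left_mono KD) auto
    then show ?thesis
      using Br by (simp add: mult_ac)
  qed
  have Be': "inverse h * bd_inner K T \<F> e e \<le> 4 * C * A * (\<alpha> * energy e e)"
  proof -
    have "4 * C * A * (Kmax * dirichlet e) \<le> 4 * C * A * (\<alpha> * energy e e)"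
      using C A by (intro mult_left_mono weighted e) auto
    then show ?thesis
      using Be by (simp add: mult_ac)
  qed
  \<comment> \<open>Nested use of the inequalities with factor 2 gives the coefficients 2, 4, 4 here
    and four times 4 in \<open>split_F\<close>.\<close>
  have split_T: "energy (fst v) (fst v) \<le> 2 * energy e e + 4 * energy p p + 4 * energy r r"
  proof -
    have "fst v = e + (p - r)"
      by (auto simp: e_def r_def)
    then show ?thesis
      using E.norm_add_le [OF e E.diff_mem [OF p r]] E.norm_diff_le [OF p r] by simp
  qed
  have split_F: "bd_inner K T \<F> (\<lambda>x. snd v x - fst v x) (\<lambda>x. snd v x - fst v x)
      \<le> 4 * bd_inner K T \<F> a a + 4 * bd_inner K T \<F> b b + 4 * bd_inner K T \<F> r r + 4 * bd_inner K T \<F> e e"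
  proof -
    have "(\<lambda>x. snd v x - fst v x) = (a - b) + (r - e)"
      by (auto simp: a_def b_def e_def r_def)
    then show ?thesis
      using B.norm_add_le [OF B.diff_mem [OF a b] B.diff_mem [OF rm em]]
        B.norm_diff_le [OF a b] B.norm_diff_le [OF rm em] by simp
  qed
  have form: "local_form k K T \<F> (gradient_stabilisation k K T \<nu> \<F>) v v
      = energy p p + energy e e + inverse h * bd_inner K T \<F> a a"
    by (simp add: local_form_def gradient_stabilisation_def Let_def energy_def p_def e_def [abs_def]
        a_def [abs_def] \<pi>_def \<pi>F_def)
  \<comment> \<open>Since \<open>\<alpha> \<ge> 1\<close>, the terms bounded without the ratio may
    be enlarged by it and collected with the others.\<close>
  define P Q S where "P = \<alpha> * energy p p" and "Q = \<alpha> * energy e e"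
    and "S = \<alpha> * (inverse h * bd_inner K T \<F> a a)"
  have pos: "0 \<le> energy p p" "0 \<le> energy e e" "0 \<le> inverse h * bd_inner K T \<F> a a"
    using E.nonneg [OF p] E.nonneg [OF e] B.nonneg [OF a] h_pos by auto
  then have PQS: "0 \<le> P" "0 \<le> Q" "0 \<le> S" "energy p p \<le> P" "energy e e \<le> Q"
      "inverse h * bd_inner K T \<F> a a \<le> S"
    using \<alpha>1 mult_right_mono [OF \<alpha>1] by (auto simp: P_def Q_def S_def)
  have "(discrete_norm K T \<F> v)\<^sup>2 \<le> 2 * energy e e + 4 * energy p p + 4 * energy r r
      + 4 * (inverse h * bd_inner K T \<F> a a + inverse h * bd_inner K T \<F> b b
        + inverse h * bd_inner K T \<F> r r + inverse h * bd_inner K T \<F> e e)"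
  proof -
    have "inverse h * bd_inner K T \<F> (\<lambda>x. snd v x - fst v x) (\<lambda>x. snd v x - fst v x)
      \<le> inverse h * (4 * bd_inner K T \<F> a a + 4 * bd_inner K T \<F> b b + 4 * bd_inner K T \<F> r r
          + 4 * bd_inner K T \<F> e e)"
      using split_F h_pos by (intro mult_left_mono) auto
    then show ?thesis
      unfolding discrete_norm_sq [OF v2 v1] using split_T by (simp add: distrib_left)
  qed
  also have "\<dots> \<le> 2 * Q + 4 * P + 4 * ((?w * C)\<^sup>2 * P)
      + 4 * (S + C * A * P + ?w * C\<^sup>2 * A * P + 4 * C * A * Q)"
    by (intro add_mono mult_left_mono PQS Er [folded P_def] Bb' [folded P_def] Br' [folded P_def]
        Be' [folded Q_def]) auto
  \<comment> \<open>The 20 is the sum of 4, from \<open>b\<close> as a multiple of \<open>P\<close>,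
    and 16, from \<open>e\<close> as a multiple of \<open>Q\<close>.\<close>
  also have "\<dots> \<le> (4 + 4 * (?w * C)\<^sup>2 + 20 * C * A + 4 * ?w * C\<^sup>2 * A) * (P + Q + S)"
  proof -
    have nonneg: "0 \<le> (?w * C)\<^sup>2 * Q" "0 \<le> (?w * C)\<^sup>2 * S" "0 \<le> C * A * P" "0 \<le> C * A * Q" "0 \<le> C * A * S"
      "0 \<le> ?w * C\<^sup>2 * A * Q" "0 \<le> ?w * C\<^sup>2 * A * S"
      using C A w0 PQS by auto
    then show ?thesis
      using PQS by (simp add: algebra_simps)
  qed
  also have "P + Q + S = \<alpha> * local_form k K T \<F> (gradient_stabilisation k K T \<nu> \<F>) v v"
    unfolding form by (simp add: P_def Q_def S_def distrib_left)
  finally show ?thesis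
    unfolding \<alpha>_def .
qed

end

text \<open>Symmetry is assumed on \<open>\<Omega>\<close>, while elements are related to it through
  closures. As \<open>T\<close> is open, nonempty and contained in \<open>closure \<Omega>\<close>,
  it meets \<open>\<Omega>\<close>, and a common point transfers symmetry to the constant
  value.\<close>

lemma mesh_tensor_symmetric:
  assumes mesh: "is_mesh \<Omega> Ts Fs" and K: "elliptic_tensor \<Omega> K" and T: "T \<in> Ts" and const: "\<forall>x\<in>T. K x = K\<^sub>T"
  shows "transpose K\<^sub>T = K\<^sub>T"
proof -
  have "open T" "T \<noteq> {}" "closure T \<subseteq> closure \<Omega>"
    using mesh T by (auto simp: is_mesh_def domain_def)
  then have "T \<inter> closure \<Omega> \<noteq> {}"
    using closure_subset by blast
  then have "T \<inter> \<Omega> \<noteq> {}"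
    using open_Int_closure_eq_empty [OF \<open>open T\<close>] by blast
  then obtain x where "x \<in> T" "x \<in> \<Omega>"
    by blast
  then show ?thesis
    using K const by (metis elliptic_tensor_def)
qed

theorem lemma8:
  fixes k :: nat and \<rho> :: real
  assumes "CARD('n::finite) \<ge> 2" and "\<rho> > 0"
  shows "\<exists>C>0. \<forall>(\<Omega> :: (real^'n) set) K H Ts Fs \<nu>.
    domain \<Omega> \<longrightarrow> regular_mesh_family \<Omega> \<rho> H Ts Fs \<longrightarrow>
    (\<forall>h\<in>H. \<forall>F\<in>Fs h. unit_normal_field F (\<nu> F)) \<longrightarrow>
    elliptic_tensor \<Omega> K \<longrightarrow> constant_on_elements H Ts K \<longrightarrow>
    (\<forall>h\<in>H. \<forall>T\<in>Ts h. \<forall>K\<^sub>T Kmin Kmax.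
       (\<forall>x\<in>T. K x = K\<^sub>T) \<longrightarrow> 0 < Kmin \<longrightarrow> Kmin \<le> Kmax \<longrightarrow>
       (\<forall>x. Kmin * (x \<bullet> x) \<le> (K\<^sub>T *v x) \<bullet> x \<and> (K\<^sub>T *v x) \<bullet> x \<le> Kmax * (x \<bullet> x)) \<longrightarrow>
       (let \<F> = faces_of (Fs h) T; \<alpha> = Kmax / Kmin in
          \<forall>v\<in>local_space k \<nu> \<F>.
            (discrete_norm K\<^sub>T T \<F> v)\<^sup>2
              \<le> C * (\<alpha> * local_form k K\<^sub>T T \<F> (gradient_stabilisation k K\<^sub>T T \<nu> \<F>) v v)))"
proof -
  let ?n = "CARD('n)"
  let ?w = "unit_ball_vol (real ?n)"
  \<comment> \<open>The area bound for the boundary of an element, divided by the power of its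
    diameter.\<close>
  define A where "A = 2 * real ?n * unit_ball_vol (real (?n - 1)) / \<rho> * (4 * real ?n * (1 / \<rho> + 1)) ^ (?n - 1)"
  have A: "0 \<le> A"
    using assms(2) by (simp add: A_def)
  obtain C where C: "C > 0" and local_bound: "\<forall>p\<in>Poly (k + 1). \<forall>z h. \<forall>T :: (real^'n) set. \<forall>x.
      h > 0 \<longrightarrow> ball z (\<rho> * h) \<subseteq> T \<longrightarrow> bounded T \<longrightarrow> T \<in> sets borel \<longrightarrow> norm (x - z) \<le> h \<longrightarrow>
      (p x)\<^sup>2 \<le> C / h ^ ?n * l2_inner lborel T p p \<and>
      h\<^sup>2 * (norm (grad p x))\<^sup>2 \<le> C / h ^ ?n * l2_inner lborel T p p"
    using Poly_local_bound [OF assms(2), of "k + 1"] by blast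
  \<comment> \<open>Fixed before domain, meshes and tensor are introduced: it is built from the
    dimension, \<open>k\<close> and \<open>\<rho>\<close> alone.\<close>
  define M where "M = 4 + 4 * (?w * C)\<^sup>2 + 20 * C * A + 4 * ?w * C\<^sup>2 * A"
  have "(discrete_norm K\<^sub>T T (faces_of (Fs h) T) v)\<^sup>2
      \<le> M * (Kmax / Kmin * local_form k K\<^sub>T T (faces_of (Fs h) T)
          (gradient_stabilisation k K\<^sub>T T \<nu> (faces_of (Fs h) T)) v v)"
    if reg: "regular_mesh_family \<Omega> \<rho> H Ts Fs" and \<nu>: "\<forall>h\<in>H. \<forall>F\<in>Fs h. unit_normal_field F (\<nu> F)"
      and K: "elliptic_tensor \<Omega> K" and h: "h \<in> H" and T: "T \<in> Ts h"
      and const: "\<forall>x\<in>T. K x = K\<^sub>T" and pos: "0 < Kmin" and le: "Kmin \<le> Kmax"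
      and bounds: "\<forall>x. Kmin * (x \<bullet> x) \<le> (K\<^sub>T *v x) \<bullet> x \<and> (K\<^sub>T *v x) \<bullet> x \<le> Kmax * (x \<bullet> x)"
      and v: "v \<in> local_space k \<nu> (faces_of (Fs h) T)"
    for \<Omega> :: "(real^'n) set" and K H Ts Fs \<nu> h T K\<^sub>T Kmin Kmax v
  proof -
    have mesh: "is_mesh \<Omega> (Ts h) (Fs h)" and conn: "connected_by_star_shaped \<rho> T"
      using reg h T by (auto simp: regular_mesh_family_def)
    have dom: "domain T" "bounded T" "piecewise_C1_boundary T" "finite (faces_of (Fs h) T)"
      and Fs: "disjoint (Fs h)" "\<And>F. F \<in> Fs h \<Longrightarrow> C1_hypersurface F"
      using mesh T by (auto simp: is_mesh_def)
    have dim: "DIM(real^'n) \<ge> 2"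
      using assms(1) by simp
    note star = connected_by_star_shaped_frontier [OF dom(1,2) conn assms(2) dim]
    have area: "emeasure surface (frontier T) \<le> ennreal (A * diameter T ^ (?n - 1))"
      using star(2) by (simp add: A_def)
    obtain z where z: "ball z (\<rho> * diameter T) \<subseteq> T"
      using star(1) by blast
    have h0: "diameter T > 0"
      by (rule domain_diameter_pos [OF dom(1,2)])
    have borel: "T \<in> sets borel"
      using dom(1) by (simp add: domain_def)
    \<comment> \<open>The degree \<open>k + 1\<close> of the reconstruction is the highest that
      occurs among the polynomials to be bounded.\<close>
    interpret regular_mesh_element T K\<^sub>T \<nu> "faces_of (Fs h) T" Kmin Kmax z A C "k + 1"
    proof
      show "disjoint (faces_of (Fs h) T)"
        using Fs(1) by (auto simp: faces_of_def disjoint_def)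
      show "F \<subseteq> frontier T \<and> C1_hypersurface F \<and> unit_normal_field F (\<nu> F)"
        if "F \<in> faces_of (Fs h) T" for F
        using that Fs(2) \<nu> h by (auto simp: faces_of_def)
      show "emeasure surface (frontier T) < \<infinity>"
        using area by (rule le_less_trans) simp
      show "transpose K\<^sub>T = K\<^sub>T"
        by (rule mesh_tensor_symmetric [OF mesh K T const])
      show "z \<in> T"
        using z h0 assms(2) by auto
      show "(p x)\<^sup>2 \<le> C / diameter T ^ ?n * l2_inner lborel T p p \<and>
          (diameter T)\<^sup>2 * (norm (grad p x))\<^sup>2 \<le> C / diameter T ^ ?n * l2_inner lborel T p p"
        if "p \<in> Poly (k + 1)" "norm (x - z) \<le> diameter T" for p x
        using local_bound that h0 z dom(2) borel by blast
    qed (use dom pos bounds area A C in auto)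
    show ?thesis
      unfolding M_def by (rule discrete_norm_le_form [OF refl le v])
  qed
  moreover have "M > 0"
    using A C by (auto simp: M_def intro!: add_pos_nonneg)
  ultimately show ?thesis
    by (intro exI [of _ M]) (auto simp: Let_def)
qed

end
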